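(* Let $\mathcal{M}\models\mathrm{KP}^{\mathcal{P}}+\Sigma_2^{\mathcal{P}}\text{-Separation}+\Pi_2^{\mathcal{P}}\text{-Foundation}$ be countable and non-standard. Let $\mathcal{S}$ be a rank-initial topless substructure of $\mathcal{M}$. For any $\alpha\in\mathrm{Ord}^{\mathcal{M}}$ there are $\beta\in\mathrm{Ord}^{\mathcal{M}}$ and a topless rank-initial self-embedding $i:\mathcal{M}\to\mathcal{M}$ fixing $\mathcal{S}$ pointwise, such that $\mathcal{M}_\alpha\subseteq i(\mathcal{M})\subseteq\mathcal{M}_\beta$ and \[\forall\gamma\in\mathrm{Ord}^{\mathcal{M}}\setminus\mathcal{S}\,.\,\exists m\in\mathcal{M}\,.\,(\mathrm{rank}^{\mathcal{M}}(m)=\gamma\wedge i(m)\neq m).\]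
   Context: Theories. The language is $\{\in\}$. Quantifiers of the forms $\exists x\in y$, $\forall x\in y$, $\exists x\subseteq y$, $\forall x\subseteq y$ count as bounded. $\Delta_0^{\mathcal{P}}=\Sigma_0^{\mathcal{P}}=\Pi_0^{\mathcal{P}}$ is the set of formulae all of whose quantifiers are bounded in this sense; $\Sigma_{n+1}^{\mathcal{P}}$ consists of the formulae $\exists x\,.\,\phi$ with $\phi\in\Pi_n^{\mathcal{P}}$, and $\Pi_{n+1}^{\mathcal{P}}$ of the $\forall x\,.\,\phi$ with $\phi\in\Sigma_n^{\mathcal{P}}$ (all up to provable equivalence in the background theory). $\Gamma$-Foundation is the schema $\exists x\,\phi(x)\to\exists y(\phi(y)\wedge\forall v\in y\,\neg\phi(v))$ for $\phi\in\Gamma$. $\mathrm{KP}^{\mathcal{P}}$ is axiomatized by Extensionality, Pair, Union, Powerset, Infinity, $\Delta_0^{\mathcal{P}}$-Separation, $\Delta_0^{\mathcal{P}}$-Collection ($\forall u\in x\exists v\,\phi(u,v)\to\exists y\forall u\in x\exists v\in y\,\phi(u,v)$) and $\Pi_1^{\mathcal{P}}$-Foundation. It proves that each set has an ordinal rank. Models. A model is non-standard if its membership relation is not well-founded. $\mathcal{M}_\alpha=\{m\in\mathcal{M}\mid\mathcal{M}\models\mathrm{rank}(m)<\alpha\}$. An embedding is an injection preserving and reflecting $\in$. An embedding $i:\mathcal{M}\to\mathcal{N}$ is rank-initial if every $n\in\mathcal{N}$ with $\mathrm{rank}^{\mathcal{N}}(n)\le\mathrm{rank}^{\mathcal{N}}(i(m))$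 for some $m\in\mathcal{M}$ lies in $i(\mathcal{M})$; it is topless if $i(\mathcal{M})\subseteq\mathcal{N}_\alpha$ for some $\alpha\in\mathrm{Ord}^{\mathcal{N}}$ and $\mathrm{Ord}^{\mathcal{N}}\setminus i(\mathcal{M})$ has no least element. A substructure is rank-initial/topless if its inclusion map is. *)

theory Defs
  imports "HOL-Library.Countable_Set"
begin

section \<open>The language of set theory\<close>

text \<open>First-order formulas over \<open>\<in>\<close> and \<open>=\<close>, with named variables.\<close>

datatype fm =
    Mem nat nat
  | Eq nat nat
  | Neg fm
  | Conj fm fm
  | Disj fm fm
  | Imp fm fm
  | Ex nat fm
  | All nat fm

definition Iff :: "fm \<Rightarrow> fm \<Rightarrow> fm" where
  "Iff \<phi> \<psi> = Conj (Imp \<phi> \<psi>) (Imp \<psi> \<phi>)"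

text \<open>\<open>Sub z x y\<close> is \<open>x \<subseteq> y\<close>, written with the auxiliary bound variable \<open>z\<close>,
  which must differ from \<open>x\<close> and \<open>y\<close>.\<close>

definition Sub :: "nat \<Rightarrow> nat \<Rightarrow> nat \<Rightarrow> fm" where
  "Sub z x y = All z (Imp (Mem z x) (Mem z y))"

fun fv :: "fm \<Rightarrow> nat set" where
  "fv (Mem x y) = {x, y}"
| "fv (Eq x y) = {x, y}"
| "fv (Neg \<phi>) = fv \<phi>"
| "fv (Conj \<phi> \<psi>) = fv \<phi> \<union> fv \<psi>"
| "fv (Disj \<phi> \<psi>) = fv \<phi> \<union> fv \<psi>"
| "fv (Imp \<phi> \<psi>) = fv \<phi> \<union> fv \<psi>"
| "fv (Ex x \<phi>) = fv \<phi> - {x}"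
| "fv (All x \<phi>) = fv \<phi> - {x}"

inductive_set Delta0P :: "fm set" where
  Mem: "Mem x y \<in> Delta0P"
| Eq: "Eq x y \<in> Delta0P"
| Neg: "\<phi> \<in> Delta0P \<Longrightarrow> Neg \<phi> \<in> Delta0P"
| Conj: "\<phi> \<in> Delta0P \<Longrightarrow> \<psi> \<in> Delta0P \<Longrightarrow> Conj \<phi> \<psi> \<in> Delta0P"
| Disj: "\<phi> \<in> Delta0P \<Longrightarrow> \<psi> \<in> Delta0P \<Longrightarrow> Disj \<phi> \<psi> \<in> Delta0P"
| Imp: "\<phi> \<in> Delta0P \<Longrightarrow> \<psi> \<in> Delta0P \<Longrightarrow> Imp \<phi> \<psi> \<in> Delta0P"
| Ex_mem: "\<phi> \<in> Delta0P \<Longrightarrow> x \<noteq> y \<Longrightarrow> Ex x (Conj (Mem x y) \<phi>) \<in> Delta0P"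
| All_mem: "\<phi> \<in> Delta0P \<Longrightarrow> x \<noteq> y \<Longrightarrow> All x (Imp (Mem x y) \<phi>) \<in> Delta0P"
| Ex_sub: "\<phi> \<in> Delta0P \<Longrightarrow> distinct [x, y, z] \<Longrightarrow> Ex x (Conj (Sub z x y) \<phi>) \<in> Delta0P"
| All_sub: "\<phi> \<in> Delta0P \<Longrightarrow> distinct [x, y, z] \<Longrightarrow> All x (Imp (Sub z x y) \<phi>) \<in> Delta0P"

text \<open>The classes are taken literally, not closed under provable equivalence.
  For the schemas below this makes no difference: by the lemmas
  \<open>models_Separation_iff\<close>, \<open>models_Collection_iff\<close> and \<open>models_Foundation_iff\<close>,
  whether a structure satisfies the instances for \<open>\<phi>\<close> depends only on the truth
  values of \<open>\<phi>\<close> in that structure.\<close>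

fun SigmaP :: "nat \<Rightarrow> fm set" and PiP :: "nat \<Rightarrow> fm set" where
  "SigmaP 0 = Delta0P"
| "SigmaP (Suc n) = {Ex x \<phi> | x \<phi>. \<phi> \<in> PiP n}"
| "PiP 0 = Delta0P"
| "PiP (Suc n) = {All x \<phi> | x \<phi>. \<phi> \<in> SigmaP n}"


section \<open>Structures and satisfaction\<close>

text \<open>\<open>mem M x y\<close> means that \<open>x\<close> is an element of \<open>y\<close> in the sense of \<open>M\<close>;
  only its values on \<open>carrier M\<close> matter.\<close>

record 'a memstruct =
  carrier :: "'a set"
  mem :: "'a \<Rightarrow> 'a \<Rightarrow> bool"

fun sat :: "'a memstruct \<Rightarrow> (nat \<Rightarrow> 'a) \<Rightarrow> fm \<Rightarrow> bool" where
  "sat M v (Mem x y) \<longleftrightarrow> mem M (v x) (v y)"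
| "sat M v (Eq x y) \<longleftrightarrow> v x = v y"
| "sat M v (Neg \<phi>) \<longleftrightarrow> \<not> sat M v \<phi>"
| "sat M v (Conj \<phi> \<psi>) \<longleftrightarrow> sat M v \<phi> \<and> sat M v \<psi>"
| "sat M v (Disj \<phi> \<psi>) \<longleftrightarrow> sat M v \<phi> \<or> sat M v \<psi>"
| "sat M v (Imp \<phi> \<psi>) \<longleftrightarrow> (sat M v \<phi> \<longrightarrow> sat M v \<psi>)"
| "sat M v (Ex x \<phi>) \<longleftrightarrow> (\<exists>a\<in>carrier M. sat M (v(x := a)) \<phi>)"
| "sat M v (All x \<phi>) \<longleftrightarrow> (\<forall>a\<in>carrier M. sat M (v(x := a)) \<phi>)"

text \<open>Formulas in a theory are read as their universal closures.\<close>

definition models :: "'a memstruct \<Rightarrow> fm set \<Rightarrow> bool" where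
  "models M T \<longleftrightarrow> carrier M \<noteq> {} \<and>
     (\<forall>\<phi>\<in>T. \<forall>v. range v \<subseteq> carrier M \<longrightarrow> sat M v \<phi>)"


section \<open>Axioms\<close>

definition Extensionality :: fm where
  "Extensionality =
     All 0 (All 1 (Imp (All 2 (Iff (Mem 2 0) (Mem 2 1))) (Eq 0 1)))"

definition Pairing :: fm where
  "Pairing = All 0 (All 1 (Ex 2 (All 3 (Iff (Mem 3 2) (Disj (Eq 3 0) (Eq 3 1))))))"

definition Unions :: fm where
  "Unions = All 0 (Ex 1 (All 2 (Iff (Mem 2 1) (Ex 3 (Conj (Mem 3 0) (Mem 2 3))))))"

definition Powerset :: fm where
  "Powerset = All 0 (Ex 1 (All 2 (Iff (Mem 2 1) (Sub 3 2 0))))"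

text \<open>Some set contains \<open>\<emptyset>\<close> and is closed under \<open>y \<mapsto> y \<union> {y}\<close>.\<close>

definition Infinity :: fm where
  "Infinity =
     Ex 0 (Conj
       (Ex 1 (Conj (Mem 1 0) (All 2 (Neg (Mem 2 1)))))
       (All 1 (Imp (Mem 1 0)
          (Ex 2 (Conj (Mem 2 0) (All 3 (Iff (Mem 3 2) (Disj (Mem 3 1) (Eq 3 1)))))))))"

text \<open>In the schemas all further free variables of \<open>\<phi>\<close> act as parameters.\<close>

definition Separation :: "fm set \<Rightarrow> fm set" where
  "Separation \<Gamma> =
     {All x (Ex y (All z (Iff (Mem z y) (Conj (Mem z x) \<phi>)))) | x y z \<phi>.
        \<phi> \<in> \<Gamma> \<and> distinct [x, y, z] \<and> y \<notin> fv \<phi>}"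

definition Collection :: "fm set \<Rightarrow> fm set" where
  "Collection \<Gamma> =
     {All x (Imp
        (All u (Imp (Mem u x) (Ex v \<phi>)))
        (Ex y (All u (Imp (Mem u x) (Ex v (Conj (Mem v y) \<phi>)))))) | x y u v \<phi>.
        \<phi> \<in> \<Gamma> \<and> distinct [x, y, u, v] \<and> y \<notin> fv \<phi>}"

text \<open>Substitution is avoided: \<open>\<phi>(y)\<close> is written \<open>\<exists>x. x = y \<and> \<phi>(x)\<close>, and
  \<open>\<forall>v\<in>y. \<not> \<phi>(v)\<close> is written with \<open>x\<close> itself as the bound variable.\<close>

definition Foundation :: "fm set \<Rightarrow> fm set" where
  "Foundation \<Gamma> =
     {Imp (Ex x \<phi>)
        (Ex y (Conj (Ex x (Conj (Eq x y) \<phi>)) (All x (Imp (Mem x y) (Neg \<phi>))))) | x y \<phi>.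
        \<phi> \<in> \<Gamma> \<and> x \<noteq> y \<and> y \<notin> fv \<phi>}"

definition KPP :: "fm set" where
  "KPP = {Extensionality, Pairing, Unions, Powerset, Infinity}
     \<union> Separation Delta0P \<union> Collection Delta0P \<union> Foundation (PiP 1)"

lemma finite_fv: "finite (fv \<phi>)"
  by (induction \<phi>) auto

lemma sat_cong: "(\<And>x. x \<in> fv \<phi> \<Longrightarrow> v x = w x) \<Longrightarrow> sat M v \<phi> \<longleftrightarrow> sat M w \<phi>"
proof (induction \<phi> arbitrary: v w)
  case (Ex x \<phi>)
  have "sat M (v(x := a)) \<phi> \<longleftrightarrow> sat M (w(x := a)) \<phi>" for a
    by (rule Ex.IH) (use Ex.prems in auto)
  then show ?case by simp
next
  case (All x \<phi>)
  have "sat M (v(x := a)) \<phi> \<longleftrightarrow> sat M (w(x := a)) \<phi>" for a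
    by (rule All.IH) (use All.prems in auto)
  then show ?case by simp
next
  case (Neg \<phi>)
  have "sat M v \<phi> \<longleftrightarrow> sat M w \<phi>"
    by (rule Neg.IH) (use Neg.prems in auto)
  then show ?case by simp
next
  case (Conj \<phi> \<psi>)
  have "sat M v \<phi> \<longleftrightarrow> sat M w \<phi>" "sat M v \<psi> \<longleftrightarrow> sat M w \<psi>"
    by (rule Conj.IH; use Conj.prems in auto)+
  then show ?case by simp
next
  case (Disj \<phi> \<psi>)
  have "sat M v \<phi> \<longleftrightarrow> sat M w \<phi>" "sat M v \<psi> \<longleftrightarrow> sat M w \<psi>"
    by (rule Disj.IH; use Disj.prems in auto)+
  then show ?case by simp
next
  case (Imp \<phi> \<psi>)
  have "sat M v \<phi> \<longleftrightarrow> sat M w \<phi>" "sat M v \<psi> \<longleftrightarrow> sat M w \<psi>"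
    by (rule Imp.IH; use Imp.prems in auto)+
  then show ?case by simp
qed auto

lemma sat_Iff: "sat M v (Iff \<phi> \<psi>) \<longleftrightarrow> (sat M v \<phi> \<longleftrightarrow> sat M v \<psi>)"
  by (auto simp: Iff_def)

lemma fresh_var: "finite (A :: nat set) \<Longrightarrow> \<exists>y. y \<notin> A"
  by (rule ex_new_if_finite) auto

lemma models_Separation_iff:
  fixes M :: "'a memstruct"
  shows "models M (Separation \<Gamma>) \<longleftrightarrow> carrier M \<noteq> {} \<and>
     (\<forall>\<phi>\<in>\<Gamma>. \<forall>z v. range v \<subseteq> carrier M \<longrightarrow>
        (\<forall>a\<in>carrier M. \<exists>b\<in>carrier M. \<forall>c\<in>carrier M.
           mem M c b \<longleftrightarrow> mem M c a \<and> sat M (v(z := c)) \<phi>))"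
  (is "?L \<longleftrightarrow> ?R")
proof
  assume L: ?L
  show ?R
  proof (intro conjI ballI allI impI)
    show "carrier M \<noteq> {}" using L by (simp add: models_def)
  next
    fix \<phi> z a and v :: "nat \<Rightarrow> 'a"
    assume \<phi>: "\<phi> \<in> \<Gamma>" and v: "range v \<subseteq> carrier M" and a: "a \<in> carrier M"
    obtain x where x: "x \<notin> insert z (fv \<phi>)" using fresh_var finite_fv by blast
    obtain y where y: "y \<notin> insert x (insert z (fv \<phi>))"
      using fresh_var[of "insert x (insert z (fv \<phi>))"] finite_fv by auto
    have "All x (Ex y (All z (Iff (Mem z y) (Conj (Mem z x) \<phi>)))) \<in> Separation \<Gamma>"
      unfolding Separation_def
      by (rule CollectI, rule exI[of _ x], rule exI[of _ y], rule exI[of _ z], rule exI[of _ \<phi>])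
        (use \<phi> x y in simp)
    then have "sat M v (All x (Ex y (All z (Iff (Mem z y) (Conj (Mem z x) \<phi>)))))"
      using L v unfolding models_def by blast
    moreover have "sat M (v(x := a, y := b, z := c)) \<phi> \<longleftrightarrow> sat M (v(z := c)) \<phi>" for a b c
      by (rule sat_cong) (use x y in auto)
    ultimately show "\<exists>b\<in>carrier M. \<forall>c\<in>carrier M.
        mem M c b \<longleftrightarrow> mem M c a \<and> sat M (v(z := c)) \<phi>"
      using a x y by (simp add: sat_Iff)
  qed
next
  assume R: ?R
  have "sat M v (All x (Ex y (All z (Iff (Mem z y) (Conj (Mem z x) \<phi>)))))"
    if \<phi>: "\<phi> \<in> \<Gamma>" and d: "distinct [x, y, z]" and y: "y \<notin> fv \<phi>"
      and v: "range v \<subseteq> carrier M" for x y z \<phi> and v :: "nat \<Rightarrow> 'a"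
  proof -
    have "\<exists>b\<in>carrier M. \<forall>c\<in>carrier M.
        mem M c b \<longleftrightarrow> mem M c a \<and> sat M (v(x := a, y := b, z := c)) \<phi>"
      if a: "a \<in> carrier M" for a
    proof -
      have "range (v(x := a)) \<subseteq> carrier M" using v a by auto
      then have "\<exists>b\<in>carrier M. \<forall>c\<in>carrier M.
          mem M c b \<longleftrightarrow> mem M c a \<and> sat M (v(x := a, z := c)) \<phi>"
        by (rule R[THEN conjunct2, THEN bspec, OF \<phi>, THEN spec, THEN spec, THEN mp, THEN bspec, OF _ a])
      moreover have "sat M (v(x := a, y := b, z := c)) \<phi> \<longleftrightarrow> sat M (v(x := a, z := c)) \<phi>" for b c
        by (rule sat_cong) (use y in auto)
      ultimately show ?thesis by simp
    qed
    then show ?thesis using d by (simp add: sat_Iff)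
  qed
  with R show ?L
    unfolding models_def Separation_def mem_Collect_eq Ball_def by (elim conjE) (intro conjI allI impI, assumption, elim exE conjE, simp only:)
qed

lemma models_Collection_iff:
  fixes M :: "'a memstruct"
  shows "models M (Collection \<Gamma>) \<longleftrightarrow> carrier M \<noteq> {} \<and>
     (\<forall>\<phi>\<in>\<Gamma>. \<forall>i j v. i \<noteq> j \<longrightarrow> range v \<subseteq> carrier M \<longrightarrow>
        (\<forall>a\<in>carrier M.
           (\<forall>c\<in>carrier M. mem M c a \<longrightarrow> (\<exists>d\<in>carrier M. sat M (v(i := c, j := d)) \<phi>)) \<longrightarrow>
           (\<exists>b\<in>carrier M. \<forall>c\<in>carrier M. mem M c a \<longrightarrow>
              (\<exists>d\<in>carrier M. mem M d b \<and> sat M (v(i := c, j := d)) \<phi>))))"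
  (is "?L \<longleftrightarrow> ?R")
proof
  assume L: ?L
  show ?R
  proof (intro conjI ballI allI impI)
    show "carrier M \<noteq> {}" using L by (simp add: models_def)
  next
    fix \<phi> i j a and v :: "nat \<Rightarrow> 'a"
    assume \<phi>: "\<phi> \<in> \<Gamma>" and ij: "i \<noteq> j" and v: "range v \<subseteq> carrier M" and a: "a \<in> carrier M"
      and prem: "\<forall>c\<in>carrier M. mem M c a \<longrightarrow> (\<exists>d\<in>carrier M. sat M (v(i := c, j := d)) \<phi>)"
    obtain x where x: "x \<notin> {i, j} \<union> fv \<phi>"
      using fresh_var[of "{i, j} \<union> fv \<phi>"] finite_fv by auto
    obtain y where y: "y \<notin> {x, i, j} \<union> fv \<phi>"
      using fresh_var[of "{x, i, j} \<union> fv \<phi>"] finite_fv by auto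
    let ?F = "All x (Imp
        (All i (Imp (Mem i x) (Ex j \<phi>)))
        (Ex y (All i (Imp (Mem i x) (Ex j (Conj (Mem j y) \<phi>))))))"
    have "?F \<in> Collection \<Gamma>"
      unfolding Collection_def
      by (rule CollectI, rule exI[of _ x], rule exI[of _ y], rule exI[of _ i], rule exI[of _ j],
          rule exI[of _ \<phi>])
        (use \<phi> x y ij in simp)
    then have F: "sat M v ?F" using L v unfolding models_def by blast
    have e1: "sat M (v(x := a, i := c, j := d)) \<phi> \<longleftrightarrow> sat M (v(i := c, j := d)) \<phi>" for a c d
      by (rule sat_cong) (use x in auto)
    have e2: "sat M (v(x := a, y := b, i := c, j := d)) \<phi> \<longleftrightarrow> sat M (v(i := c, j := d)) \<phi>" for a b c d
      by (rule sat_cong) (use x y in auto)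
    show "\<exists>b\<in>carrier M. \<forall>c\<in>carrier M. mem M c a \<longrightarrow>
              (\<exists>d\<in>carrier M. mem M d b \<and> sat M (v(i := c, j := d)) \<phi>)"
      using F a prem x y ij by (simp add: e1 e2)
  qed
next
  assume R: ?R
  have "sat M w (All x (Imp
        (All u (Imp (Mem u x) (Ex v \<phi>)))
        (Ex y (All u (Imp (Mem u x) (Ex v (Conj (Mem v y) \<phi>)))))))"
    if \<phi>: "\<phi> \<in> \<Gamma>" and d: "distinct [x, y, u, v]" and y: "y \<notin> fv \<phi>"
      and w: "range w \<subseteq> carrier M" for x y u v \<phi> and w :: "nat \<Rightarrow> 'a"
  proof -
    have e: "sat M (w(x := a, y := b, u := c, v := d)) \<phi>
        \<longleftrightarrow> sat M (w(x := a, u := c, v := d)) \<phi>" for a b c d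
      by (rule sat_cong) (use y in auto)
    have w': "range (w(x := a)) \<subseteq> carrier M" if "a \<in> carrier M" for a
      using w that by auto
    have "u \<noteq> v" using d by auto
    have "(\<forall>c\<in>carrier M. mem M c a \<longrightarrow> (\<exists>d\<in>carrier M. sat M (w(x := a, u := c, v := d)) \<phi>)) \<longrightarrow>
           (\<exists>b\<in>carrier M. \<forall>c\<in>carrier M. mem M c a \<longrightarrow>
              (\<exists>d\<in>carrier M. mem M d b \<and> sat M (w(x := a, u := c, v := d)) \<phi>))"
      if "a \<in> carrier M" for a
      by (rule R[THEN conjunct2, THEN bspec, OF \<phi>, THEN spec, THEN spec, THEN spec, THEN mp,
            THEN mp, OF \<open>u \<noteq> v\<close> w'[OF that], THEN bspec, OF that])
    then show ?thesis using d by (simp add: e)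
  qed
  with R show ?L
    unfolding models_def Collection_def mem_Collect_eq Ball_def by (elim conjE) (intro conjI allI impI, assumption, elim exE conjE, simp only:)
qed

lemma models_Foundation_iff:
  fixes M :: "'a memstruct"
  shows "models M (Foundation \<Gamma>) \<longleftrightarrow> carrier M \<noteq> {} \<and>
     (\<forall>\<phi>\<in>\<Gamma>. \<forall>x v. range v \<subseteq> carrier M \<longrightarrow>
        (\<exists>a\<in>carrier M. sat M (v(x := a)) \<phi>) \<longrightarrow>
        (\<exists>a\<in>carrier M. sat M (v(x := a)) \<phi> \<and>
           (\<forall>b\<in>carrier M. mem M b a \<longrightarrow> \<not> sat M (v(x := b)) \<phi>)))"
  (is "?L \<longleftrightarrow> ?R")
proof -
  have key: "sat M v (Imp (Ex x \<phi>)
        (Ex y (Conj (Ex x (Conj (Eq x y) \<phi>)) (All x (Imp (Mem x y) (Neg \<phi>)))))) \<longleftrightarrow>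
      ((\<exists>a\<in>carrier M. sat M (v(x := a)) \<phi>) \<longrightarrow>
        (\<exists>a\<in>carrier M. sat M (v(x := a)) \<phi> \<and>
           (\<forall>b\<in>carrier M. mem M b a \<longrightarrow> \<not> sat M (v(x := b)) \<phi>)))"
    if "x \<noteq> y" "y \<notin> fv \<phi>" for x y \<phi> and v :: "nat \<Rightarrow> 'a"
  proof -
    have "sat M (v(y := a, x := b)) \<phi> \<longleftrightarrow> sat M (v(x := b)) \<phi>" for a b
      by (rule sat_cong) (use that in auto)
    with that show ?thesis by auto
  qed
  have fresh: "\<exists>y. x \<noteq> y \<and> y \<notin> fv \<phi>" for x \<phi>
    using fresh_var[of "insert x (fv \<phi>)"] finite_fv[of \<phi>] by (metis finite_insert insert_iff)
  show ?thesis
  proof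
    assume L: ?L
    show ?R
    proof (intro conjI ballI allI impI[of "range _ \<subseteq> _"])
      show "carrier M \<noteq> {}" using L by (simp add: models_def)
    next
      fix \<phi> x and v :: "nat \<Rightarrow> 'a"
      assume \<phi>: "\<phi> \<in> \<Gamma>" and v: "range v \<subseteq> carrier M"
      obtain y where y: "x \<noteq> y" "y \<notin> fv \<phi>" using fresh by blast
      have "Imp (Ex x \<phi>) (Ex y (Conj (Ex x (Conj (Eq x y) \<phi>)) (All x (Imp (Mem x y) (Neg \<phi>)))))
          \<in> Foundation \<Gamma>"
        unfolding Foundation_def using \<phi> y by blast
      then have "sat M v (Imp (Ex x \<phi>)
          (Ex y (Conj (Ex x (Conj (Eq x y) \<phi>)) (All x (Imp (Mem x y) (Neg \<phi>))))))"
        using L v unfolding models_def by blast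
      then show "(\<exists>a\<in>carrier M. sat M (v(x := a)) \<phi>) \<longrightarrow>
          (\<exists>a\<in>carrier M. sat M (v(x := a)) \<phi> \<and>
           (\<forall>b\<in>carrier M. mem M b a \<longrightarrow> \<not> sat M (v(x := b)) \<phi>))"
        unfolding key[OF y] .
    qed
  next
    assume R: ?R
    have "sat M v (Imp (Ex x \<phi>)
        (Ex y (Conj (Ex x (Conj (Eq x y) \<phi>)) (All x (Imp (Mem x y) (Neg \<phi>))))))"
      if "\<phi> \<in> \<Gamma>" "x \<noteq> y" "y \<notin> fv \<phi>" "range v \<subseteq> carrier M" for x y \<phi> and v :: "nat \<Rightarrow> 'a"
      unfolding key[OF that(2,3)] using R that(1,4) by blast
    with R show ?L
    unfolding models_def Foundation_def mem_Collect_eq Ball_def by (elim conjE) (intro conjI allI impI, assumption, elim exE conjE, simp only:)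
  qed
qed


section \<open>Ordinals and rank inside a structure\<close>

text \<open>The predicates of this section are first-order definitions evaluated in \<open>M\<close>:
  every quantifier ranges over \<open>carrier M\<close>.\<close>

definition trans_in :: "'a memstruct \<Rightarrow> 'a \<Rightarrow> bool" where
  "trans_in M d \<longleftrightarrow> (\<forall>y\<in>carrier M. \<forall>z\<in>carrier M. mem M z y \<longrightarrow> mem M y d \<longrightarrow> mem M z d)"

text \<open>An ordinal is a transitive set of transitive sets.\<close>

definition Ords :: "'a memstruct \<Rightarrow> 'a set" where
  "Ords M = {a \<in> carrier M. trans_in M a \<and> (\<forall>y\<in>carrier M. mem M y a \<longrightarrow> trans_in M y)}"

definition upair_in :: "'a memstruct \<Rightarrow> 'a \<Rightarrow> 'a \<Rightarrow> 'a \<Rightarrow> bool" where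
  "upair_in M x y p \<longleftrightarrow> (\<forall>w\<in>carrier M. mem M w p \<longleftrightarrow> w = x \<or> w = y)"

text \<open>\<open>p\<close> is the Kuratowski pair \<open>{{x}, {x, y}}\<close>.\<close>

definition opair_in :: "'a memstruct \<Rightarrow> 'a \<Rightarrow> 'a \<Rightarrow> 'a \<Rightarrow> bool" where
  "opair_in M x y p \<longleftrightarrow>
     (\<exists>s\<in>carrier M. \<exists>t\<in>carrier M. upair_in M x x s \<and> upair_in M x y t \<and> upair_in M s t p)"

text \<open>\<open>app_in M f x y\<close> means that \<open>f\<close> contains the pair of \<open>x\<close> and \<open>y\<close>.\<close>

definition app_in :: "'a memstruct \<Rightarrow> 'a \<Rightarrow> 'a \<Rightarrow> 'a \<Rightarrow> bool" where
  "app_in M f x y \<longleftrightarrow> (\<exists>p\<in>carrier M. opair_in M x y p \<and> mem M p f)"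

definition function_on_in :: "'a memstruct \<Rightarrow> 'a \<Rightarrow> 'a \<Rightarrow> bool" where
  "function_on_in M f d \<longleftrightarrow>
     (\<forall>p\<in>carrier M. mem M p f \<longrightarrow>
        (\<exists>x\<in>carrier M. \<exists>y\<in>carrier M. mem M x d \<and> opair_in M x y p)) \<and>
     (\<forall>x\<in>carrier M. mem M x d \<longrightarrow> (\<exists>!y. y \<in> carrier M \<and> app_in M f x y))"

text \<open>\<open>is_rank M x a\<close> says, inside \<open>M\<close>, that \<open>a = f(x)\<close> for some function \<open>f\<close> whose domain
  \<open>d\<close> is transitive with \<open>x \<in> d\<close>, and which satisfies the rank recursion
  \<open>f(y) = \<Union>{f(z) \<union> {f(z)} | z \<in> y}\<close> for all \<open>y \<in> d\<close>.\<close>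

definition is_rank :: "'a memstruct \<Rightarrow> 'a \<Rightarrow> 'a \<Rightarrow> bool" where
  "is_rank M x a \<longleftrightarrow>
     (\<exists>d\<in>carrier M. \<exists>f\<in>carrier M.
        trans_in M d \<and> mem M x d \<and> function_on_in M f d \<and> app_in M f x a \<and>
        (\<forall>y\<in>carrier M. \<forall>b\<in>carrier M. mem M y d \<longrightarrow> app_in M f y b \<longrightarrow>
           (\<forall>w\<in>carrier M. mem M w b \<longleftrightarrow>
              (\<exists>z\<in>carrier M. \<exists>c\<in>carrier M.
                 mem M z y \<and> app_in M f z c \<and> (mem M w c \<or> w = c)))))"

definition rank :: "'a memstruct \<Rightarrow> 'a \<Rightarrow> 'a" where
  "rank M x = (THE a. a \<in> carrier M \<and> is_rank M x a)"

text \<open>The set \<open>M\<^sub>\<alpha>\<close>; the order on the ordinals of \<open>M\<close> is membership.\<close>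

definition below_rank :: "'a memstruct \<Rightarrow> 'a \<Rightarrow> 'a set" where
  "below_rank M \<alpha> = {m \<in> carrier M. mem M (rank M m) \<alpha>}"


section \<open>Embeddings\<close>

definition nonstandard :: "'a memstruct \<Rightarrow> bool" where
  "nonstandard M \<longleftrightarrow> \<not> wfp_on (carrier M) (mem M)"

definition embedding :: "'a memstruct \<Rightarrow> 'b memstruct \<Rightarrow> ('a \<Rightarrow> 'b) \<Rightarrow> bool" where
  "embedding M N i \<longleftrightarrow> i ` carrier M \<subseteq> carrier N \<and> inj_on i (carrier M) \<and>
     (\<forall>x\<in>carrier M. \<forall>y\<in>carrier M. mem N (i x) (i y) \<longleftrightarrow> mem M x y)"

definition rank_initial :: "'a memstruct \<Rightarrow> 'b memstruct \<Rightarrow> ('a \<Rightarrow> 'b) \<Rightarrow> bool" where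
  "rank_initial M N i \<longleftrightarrow> embedding M N i \<and>
     (\<forall>n\<in>carrier N. \<forall>m\<in>carrier M.
        rank N n = rank N (i m) \<or> mem N (rank N n) (rank N (i m)) \<longrightarrow> n \<in> i ` carrier M)"

definition topless :: "'a memstruct \<Rightarrow> 'b memstruct \<Rightarrow> ('a \<Rightarrow> 'b) \<Rightarrow> bool" where
  "topless M N i \<longleftrightarrow> embedding M N i \<and>
     (\<exists>\<alpha>\<in>Ords N. i ` carrier M \<subseteq> below_rank N \<alpha>) \<and>
     \<not> (\<exists>\<alpha>\<in>Ords N - i ` carrier M. \<forall>\<beta>\<in>Ords N - i ` carrier M. \<alpha> = \<beta> \<or> mem N \<alpha> \<beta>)"

definition substructure :: "'a memstruct \<Rightarrow> 'a memstruct \<Rightarrow> bool" where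
  "substructure S M \<longleftrightarrow> carrier S \<noteq> {} \<and> carrier S \<subseteq> carrier M \<and>
     (\<forall>x\<in>carrier S. \<forall>y\<in>carrier S. mem S x y \<longleftrightarrow> mem M x y)"

end

theory Submission
  imports Defs
begin

text \<open>
  The embedding is the union of finite partial maps \<open>H\<close> from \<open>M\<close> to \<open>M\<close>, built along an enumeration
  of \<open>M\<close>; the point is to find a property of \<open>H\<close> that guarantees that it can be continued. A set of
  pairs is called \<open>similar\<close> if it belongs to a back-and-forth system that preserves \<open>\<in>\<close> and the levels
  \<open>V\<^sub>\<gamma>\<close>, fixes \<open>S\<close> pointwise, and whose moves lead to elements of sets already matched. The map
  \<open>H\<close> is \<open>good\<close> below a level \<open>b\<close> if for every level \<open>x\<close> of \<open>M\<close> there is a \<open>y \<in> b\<close> such that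
  \<open>H \<union> {(x, y)}\<close> is similar: whatever the universe says about the domain of \<open>H\<close> is imitated below
  \<open>b\<close> for its range.

  Similarity comes from types. For a level \<open>X\<close>, the type at an ordinal \<open>\<xi>\<close> of a finite tuple from \<open>X\<close>
  is a subset of \<open>V\<^sub>\<xi>\<close> which records the membership relations between the entries, which of them are
  levels, those that are small enough, and the types at smaller ordinals of the tuples with one more entry. Equality of two types at a
  single ordinal outside \<open>S\<close> implies similarity (\<open>same_type_similar\<close>): since \<open>S\<close> is topless, there
  is an infinite descending sequence of ordinals outside \<open>S\<close> below \<open>\<xi>\<close>, so finitely many moves never
  exhaust \<open>\<xi>\<close>, and every element of \<open>S\<close> lies in all the sets \<open>V\<^sub>\<xi>\<close> concerned. This replaces a
  satisfaction predicate and an overspill argument.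

  The types at \<open>\<xi>\<close> are subsets of \<open>V\<^sub>\<xi>\<close>, whatever the level \<open>X\<close> is. By Separation for
  \<open>\<Sigma>\<^sub>1\<close> formulas those that occur in some level form a set, and by Collection each of them occurs in a
  level below a fixed level \<open>c\<close> (\<open>ex_reflects\<close>). If \<open>d\<close> is matched with such a \<open>c\<close>, then
  what happens anywhere in \<open>M\<close> happens inside \<open>c\<close> and is copied into \<open>d\<close>. This gives the four steps of
  the construction. New elements can be added to the domain (\<open>good_forth\<close>), and so can elements of the
  range that belong to a member of the range (\<open>good_back\<close>). Given an ordinal \<open>\<delta>\<close>, either the image of
  a suitable \<open>c\<close> contains \<open>\<delta>\<close>, or that image can serve as a new bound for the rest of the construction,
  and the supremum of the range stays strictly below \<open>\<delta>\<close> (\<open>good_cut\<close>); this makes the embedding topless.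
  Finally, if \<open>\<xi> < \<gamma>\<close>, there are more sets of rank \<open>\<gamma>\<close> than subsets of \<open>V\<^sub>\<xi>\<close>, so two different sets
  of rank \<open>\<gamma>\<close> have the same type, and one of them may be sent to a set other than itself
  (\<open>good_move\<close>). The construction starts with the map that fixes \<open>V\<^sub>\<alpha>\<close>, which is good below some \<open>V\<^sub>\<beta>\<close>.

  Before this the necessary set theory is developed inside \<open>M\<close>: a calculus of \<open>\<Delta>\<^sub>1\<close> predicates and
  \<open>\<Sigma>\<^sub>1\<close> operations in the sense of the hierarchy with bounded quantifiers over subsets, recursion on membership, ordinals, ranks and the cumulative hierarchy. All of
  it takes place in an isomorphic copy of \<open>M\<close> whose carrier is a whole type.
\<close>

section \<open>\<open>\<Delta>\<^sub>0\<close>, \<open>\<Sigma>\<^sub>1\<close> and \<open>\<Delta>\<^sub>1\<close> predicates of a structure\<close>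

fun rename :: "(nat \<Rightarrow> nat) \<Rightarrow> fm \<Rightarrow> fm" where
  "rename f (Mem x y) = Mem (f x) (f y)"
| "rename f (Eq x y) = Eq (f x) (f y)"
| "rename f (Neg \<phi>) = Neg (rename f \<phi>)"
| "rename f (Conj \<phi> \<psi>) = Conj (rename f \<phi>) (rename f \<psi>)"
| "rename f (Disj \<phi> \<psi>) = Disj (rename f \<phi>) (rename f \<psi>)"
| "rename f (Imp \<phi> \<psi>) = Imp (rename f \<phi>) (rename f \<psi>)"
| "rename f (Ex x \<phi>) = Ex (f x) (rename f \<phi>)"
| "rename f (All x \<phi>) = All (f x) (rename f \<phi>)"

lemma fun_upd_comp_inj: "inj f \<Longrightarrow> (\<lambda>n. (v(f x := a)) (f n)) = (\<lambda>n. v (f n))(x := a)"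
  by (auto simp: fun_eq_iff inj_eq)

lemma sat_rename: "inj f \<Longrightarrow> sat M v (rename f \<phi>) \<longleftrightarrow> sat M (\<lambda>n. v (f n)) \<phi>"
proof (induction \<phi> arbitrary: v)
  case (Ex x \<phi>)
  then show ?case by (simp add: fun_upd_comp_inj del: fun_upd_apply)
next
  case (All x \<phi>)
  then show ?case by (simp add: fun_upd_comp_inj del: fun_upd_apply)
qed simp_all

lemma Delta0P_rename: "\<phi> \<in> Delta0P \<Longrightarrow> inj f \<Longrightarrow> rename f \<phi> \<in> Delta0P"
  by (induction rule: Delta0P.induct) (auto simp: Sub_def[symmetric] inj_eq intro!: Delta0P.intros,
     auto simp: Sub_def inj_eq Delta0P.Ex_sub[unfolded Sub_def] Delta0P.All_sub[unfolded Sub_def])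

text \<open>Even positions carry the arguments of a predicate and odd positions its parameters, so that
  there is always room for further parameters.\<close>

definition mix :: "(nat \<Rightarrow> 'a) \<Rightarrow> (nat \<Rightarrow> 'a) \<Rightarrow> nat \<Rightarrow> 'a" where
  "mix v e n = (if even n then v (n div 2) else e (n div 2))"

lemma mix_even [simp]: "mix v e (2 * n) = v n"
  and mix_odd [simp]: "mix v e (Suc (2 * n)) = e n"
  by (simp_all add: mix_def)

lemma mix_update: "(mix v e)(2 * k := a) = mix (v(k := a)) e"
  by (rule ext) (auto simp: mix_def)

text \<open>The carrier is the whole type, so that the quantifiers of the structure are those of the logic.\<close>

locale membership =
  fixes E :: "'a \<Rightarrow> 'a \<Rightarrow> bool" (infix "\<epsilon>" 50)
begin

definition M :: "'a memstruct" where
  "M = \<lparr>carrier = UNIV, mem = (\<epsilon>)\<rparr>"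

lemma M_simps [simp]: "carrier M = UNIV" "mem M = (\<epsilon>)"
  by (simp_all add: M_def)

text \<open>Definability by a formula in \<open>Delta0P\<close> with parameters, as a property of predicates of assignments.
  Assignments are used in the style of de Bruijn: under a quantifier the bound variable becomes
  position 0 and all other positions move up by one.\<close>

definition delta0 :: "((nat \<Rightarrow> 'a) \<Rightarrow> bool) \<Rightarrow> bool" where
  "delta0 P \<longleftrightarrow> (\<exists>\<phi>\<in>Delta0P. \<exists>e. \<forall>v. P v \<longleftrightarrow> sat M (mix v e) \<phi>)"

lemma delta0_mem: "delta0 (\<lambda>v. v i \<epsilon> v j)"
  unfolding delta0_def by (rule bexI[of _ "Mem (2*i) (2*j)"]) (auto intro: Delta0P.intros)

lemma delta0_eq: "delta0 (\<lambda>v. v i = v j)"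
  unfolding delta0_def by (rule bexI[of _ "Eq (2*i) (2*j)"]) (auto intro: Delta0P.intros)

lemma delta0_not: "delta0 P \<Longrightarrow> delta0 (\<lambda>v. \<not> P v)"
  unfolding delta0_def by (meson Delta0P.Neg sat.simps(3))

lemma sat_mix_rename:
  assumes "inj g" "\<And>n. mix v e (g n) = mix w d n"
  shows "sat M (mix v e) (rename g \<phi>) \<longleftrightarrow> sat M (mix w d) \<phi>"
  using assms by (simp add: sat_rename)

lemma delta0_rename:
  assumes "delta0 P" "inj f"
  shows "delta0 (\<lambda>v. P (\<lambda>n. v (f n)))"
proof -
  obtain \<phi> e where \<phi>: "\<phi> \<in> Delta0P" "\<And>v. P v \<longleftrightarrow> sat M (mix v e) \<phi>"
    using assms(1) unfolding delta0_def by blast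
  define g where "g n = (if even n then 2 * f (n div 2) else n)" for n
  have g: "inj g"
  proof (rule injI)
    fix x y assume "g x = g y"
    then show "x = y"
      using assms(2) by (cases "even x"; cases "even y") (auto simp: g_def inj_eq elim!: evenE)
  qed
  have "mix v e (g n) = mix (\<lambda>n. v (f n)) e n" for v n
    by (auto simp: g_def mix_def)
  then have "P (\<lambda>n. v (f n)) \<longleftrightarrow> sat M (mix v e) (rename g \<phi>)" for v
    using \<phi>(2) sat_mix_rename[OF g] by blast
  with Delta0P_rename[OF \<phi>(1) g] show ?thesis unfolding delta0_def by blast
qed

lemma delta0_rename':
  assumes "delta0 P" "inj f" "\<And>w n. w (f n) = h w n"
  shows "delta0 (\<lambda>w. P (h w))"
proof -
  have "h w = (\<lambda>n. w (f n))" for w using assms(3) by (simp add: fun_eq_iff)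
  then show ?thesis using delta0_rename[OF assms(1,2)] by simp
qed

text \<open>The two formulas come with their own parameters. These are interleaved, and the variables are
  renamed accordingly.\<close>

lemma delta0_conj:
  assumes "delta0 P" "delta0 Q"
  shows "delta0 (\<lambda>v. P v \<and> Q v)"
proof -
  obtain \<phi> e where \<phi>: "\<phi> \<in> Delta0P" "\<And>v. P v \<longleftrightarrow> sat M (mix v e) \<phi>"
    using assms(1) unfolding delta0_def by blast
  obtain \<psi> d where \<psi>: "\<psi> \<in> Delta0P" "\<And>v. Q v \<longleftrightarrow> sat M (mix v d) \<psi>"
    using assms(2) unfolding delta0_def by blast
  define g where "g n = (if even n then n else 2 * n - 1)" for n :: nat
  define h where "h n = (if even n then n else 2 * n + 1)" for n :: nat
  have g: "inj g"
    unfolding g_def by (rule injI) (simp split: if_splits; presburger)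
  have h: "inj h"
    unfolding h_def by (rule injI) (simp split: if_splits; presburger)
  have "mix v (mix e d) (g n) = mix v e n" "mix v (mix e d) (h n) = mix v d n" for v n
  proof -
    have "mix v (mix e d) (g n) = mix v e n \<and> mix v (mix e d) (h n) = mix v d n"
    proof (cases "even n")
      case False
      then obtain k where k: "n = Suc (2 * k)" by (metis oddE Suc_eq_plus1)
      have "g n = Suc (2 * (2 * k))" "h n = Suc (2 * Suc (2 * k))"
        using False by (simp_all add: g_def h_def k)
      then show ?thesis by (simp only: k mix_odd mix_even)
    qed (simp add: g_def h_def mix_def)
    then show "mix v (mix e d) (g n) = mix v e n" "mix v (mix e d) (h n) = mix v d n" by auto
  qed
  then have "P v \<and> Q v \<longleftrightarrow> sat M (mix v (mix e d)) (Conj (rename g \<phi>) (rename h \<psi>))" for v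
    using \<phi>(2) \<psi>(2) by (simp add: sat_mix_rename[OF g, where d = e and w = v] sat_mix_rename[OF h, where d = d and w = v])
  with Delta0P_rename[OF \<phi>(1) g] Delta0P_rename[OF \<psi>(1) h] show ?thesis
    unfolding delta0_def by (meson Delta0P.Conj)
qed

text \<open>Turns variable 0 into the odd variable 1 and closes the gap among the even ones.\<close>

definition shift :: "nat \<Rightarrow> nat" where
  "shift n = (if n = 0 then 1 else if even n then n - 2 else n + 2)"

lemma inj_shift: "inj shift"
  unfolding shift_def by (rule injI) (simp split: if_splits; presburger)

lemma sat_shift:
  assumes "w 1 = a" "\<And>n. w (2 * n) = v n" "\<And>n. w (2 * n + 3) = e n"
  shows "sat M w (rename shift \<phi>) \<longleftrightarrow> sat M (mix (case_nat a v) e) \<phi>"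
proof -
  have "w (shift n) = mix (case_nat a v) e n" for n
  proof (cases "even n")
    case True
    then obtain k where "n = 2 * k" by blast
    then show ?thesis using assms by (cases k) (auto simp: shift_def mix_def)
  next
    case False
    then obtain k where "n = 2 * k + 1" using oddE by blast
    then show ?thesis using assms(3)[of k] by (auto simp: shift_def mix_def numeral_3_eq_3)
  qed
  then show ?thesis by (simp add: sat_rename[OF inj_shift])
qed

lemma delta0_bex:
  assumes "delta0 (\<lambda>w. P (\<lambda>n. w (Suc n)) (w 0))"
  shows "delta0 (\<lambda>v. \<exists>x. x \<epsilon> v i \<and> P v x)"
proof -
  obtain \<phi> e where \<phi>: "\<phi> \<in> Delta0P" "\<And>w. P (\<lambda>n. w (Suc n)) (w 0) \<longleftrightarrow> sat M (mix w e) \<phi>"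
    using assms unfolding delta0_def by blast
  let ?\<phi> = "Ex 1 (Conj (Mem 1 (2 * i)) (rename shift \<phi>))"
  have ne: "1 \<noteq> 2 * i" by presburger
  have "?\<phi> \<in> Delta0P"
    by (rule Delta0P.Ex_mem[OF Delta0P_rename[OF \<phi>(1) inj_shift] ne])
  moreover have "(\<exists>x. x \<epsilon> v i \<and> P v x) \<longleftrightarrow> sat M (mix v (case_nat undefined e)) ?\<phi>" for v
  proof -
    have "sat M ((mix v (case_nat undefined e))(1 := x)) (rename shift \<phi>) \<longleftrightarrow> P v x" for x
      using \<phi>(2)[of "case_nat x v"] by (subst sat_shift[where a = x and v = v and e = e])
        (use ne in \<open>auto simp: mix_def\<close>)
    moreover have "(mix v (case_nat undefined e)) (2 * i) = v i" by simp
    ultimately show ?thesis using ne by simp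
  qed
  ultimately show ?thesis unfolding delta0_def by blast
qed

text \<open>The bounded quantification over subsets is what makes the power set operation definable.\<close>

lemma delta0_ball_sub:
  assumes "delta0 (\<lambda>w. P (\<lambda>n. w (Suc n)) (w 0))"
  shows "delta0 (\<lambda>v. \<forall>x. (\<forall>z. z \<epsilon> x \<longrightarrow> z \<epsilon> v i) \<longrightarrow> P v x)"
proof -
  obtain \<phi> e where \<phi>: "\<phi> \<in> Delta0P" "\<And>w. P (\<lambda>n. w (Suc n)) (w 0) \<longleftrightarrow> sat M (mix w e) \<phi>"
    using assms unfolding delta0_def by blast
  let ?\<phi> = "All 1 (Imp (Sub 3 1 (2 * i)) (rename shift \<phi>))"
  have ne: "1 \<noteq> 2 * i" "3 \<noteq> 2 * i" by presburger+
  have "?\<phi> \<in> Delta0P"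
    by (rule Delta0P.All_sub[OF Delta0P_rename[OF \<phi>(1) inj_shift]]) (use ne in simp)
  moreover have "(\<forall>x. (\<forall>z. z \<epsilon> x \<longrightarrow> z \<epsilon> v i) \<longrightarrow> P v x) \<longleftrightarrow> sat M (mix v (case_nat undefined e)) ?\<phi>" for v
  proof -
    have "sat M ((mix v (case_nat undefined e))(1 := x)) (rename shift \<phi>) \<longleftrightarrow> P v x" for x
      using \<phi>(2)[of "case_nat x v"] by (subst sat_shift[where a = x and v = v and e = e])
        (use ne in \<open>auto simp: mix_def\<close>)
    moreover have "(mix v (case_nat undefined e)) (2 * i) = v i" by simp
    ultimately show ?thesis using ne by (simp add: Sub_def)
  qed
  ultimately show ?thesis unfolding delta0_def by blast
qed

lemma delta0_param:
  assumes "delta0 (\<lambda>w. P (\<lambda>n. w (Suc n)) (w 0))"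
  shows "delta0 (\<lambda>v. P v c)"
proof -
  obtain \<phi> e where \<phi>: "\<phi> \<in> Delta0P" "\<And>w. P (\<lambda>n. w (Suc n)) (w 0) \<longleftrightarrow> sat M (mix w e) \<phi>"
    using assms unfolding delta0_def by blast
  have "P v c \<longleftrightarrow> sat M (mix v (case_nat c e)) (rename shift \<phi>)" for v
    using \<phi>(2)[of "case_nat c v"] by (subst sat_shift[where a = c and v = v and e = e])
        (auto simp: mix_def)
  with Delta0P_rename[OF \<phi>(1) inj_shift] show ?thesis unfolding delta0_def by blast
qed

lemma delta0_disj: "delta0 P \<Longrightarrow> delta0 Q \<Longrightarrow> delta0 (\<lambda>v. P v \<or> Q v)"
  using delta0_not[OF delta0_conj[OF delta0_not delta0_not], of P Q] by simp

lemma delta0_ball: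
  assumes "delta0 (\<lambda>w. P (\<lambda>n. w (Suc n)) (w 0))"
  shows "delta0 (\<lambda>v. \<forall>x. x \<epsilon> v i \<longrightarrow> P v x)"
  using delta0_not[OF delta0_bex[OF delta0_not[OF assms], of i]] by simp

definition sigma1 :: "((nat \<Rightarrow> 'a) \<Rightarrow> bool) \<Rightarrow> bool" where
  "sigma1 P \<longleftrightarrow> (\<exists>Q. delta0 Q \<and> (\<forall>v. P v \<longleftrightarrow> (\<exists>a. Q (case_nat a v))))"

lemma sigma1_I:
  assumes "delta0 (\<lambda>w. Q (\<lambda>n. w (Suc n)) (w 0))" "\<And>v. P v \<longleftrightarrow> (\<exists>a. Q v a)"
  shows "sigma1 P"
  unfolding sigma1_def by (rule exI, rule conjI, rule assms(1)) (simp add: assms(2))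

lemma sigma1_E:
  assumes "sigma1 P"
  obtains Q where "delta0 Q" "\<And>v. P v \<longleftrightarrow> (\<exists>a. Q (case_nat a v))"
  using assms unfolding sigma1_def by blast

lemma sigma1_delta0: "delta0 P \<Longrightarrow> sigma1 P"
  by (rule sigma1_I[of "\<lambda>v a. P v"]) (auto intro: delta0_rename)

end

locale set_theory = membership +
  assumes axioms: "models \<lparr>carrier = UNIV, mem = (\<epsilon>)\<rparr> (KPP \<union> Separation (SigmaP 2) \<union> Foundation (PiP 2))"
begin

lemma axioms_M: "models M (KPP \<union> Separation (SigmaP 2) \<union> Foundation (PiP 2))"
  using axioms by (simp add: M_def)

lemma models_subset: "models N T \<Longrightarrow> T' \<subseteq> T \<Longrightarrow> models N T'"
  unfolding models_def by blast

lemma sat_axiom: "\<phi> \<in> KPP \<Longrightarrow> sat M v \<phi>"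
  using axioms_M unfolding models_def M_simps by blast

lemma extensionality: "(\<And>z. z \<epsilon> x \<longleftrightarrow> z \<epsilon> y) \<Longrightarrow> x = y"
  using sat_axiom[of Extensionality] by (simp add: KPP_def Extensionality_def sat_Iff)

lemma pairing: "\<exists>p. \<forall>w. w \<epsilon> p \<longleftrightarrow> w = x \<or> w = y"
  using sat_axiom[of Pairing] by (simp add: KPP_def Pairing_def sat_Iff)

lemma common_set: "\<exists>c. x \<epsilon> c \<and> y \<epsilon> c"
  using pairing[of x y] by blast

lemma union_set: "\<exists>u. \<forall>w. w \<epsilon> u \<longleftrightarrow> (\<exists>z. z \<epsilon> x \<and> w \<epsilon> z)"
  using sat_axiom[of Unions] by (simp add: KPP_def Unions_def sat_Iff)

lemma power_set: "\<exists>p. \<forall>w. w \<epsilon> p \<longleftrightarrow> (\<forall>z. z \<epsilon> w \<longrightarrow> z \<epsilon> x)"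
  using sat_axiom[of Powerset] by (simp add: KPP_def Powerset_def Sub_def sat_Iff)

lemma delta0_collection:
  assumes "delta0 R" and "\<And>c. c \<epsilon> a \<Longrightarrow> \<exists>d. R (case_nat c (case_nat d v))"
  shows "\<exists>b. \<forall>c. c \<epsilon> a \<longrightarrow> (\<exists>d. d \<epsilon> b \<and> R (case_nat c (case_nat d v)))"
proof -
  obtain \<phi> e where \<phi>: "\<phi> \<in> Delta0P" "\<And>v. R v \<longleftrightarrow> sat M (mix v e) \<phi>"
    using assms(1) unfolding delta0_def by blast
  have *: "(mix (case_nat undefined (case_nat undefined v)) e)(0 := c, 2 := d)
      = mix (case_nat c (case_nat d v)) e" for c d
  proof -
    have "(case_nat undefined (case_nat undefined v))(0 := c, Suc 0 := d) = case_nat c (case_nat d v)"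
      by (rule ext) (simp split: nat.split)
    then show ?thesis
      using mix_update[of "case_nat undefined (case_nat undefined v)" e 0 c]
        mix_update[of "(case_nat undefined (case_nat undefined v))(0 := c)" e "Suc 0" d]
      by simp
  qed
  have "models M (Collection Delta0P)"
    by (rule models_subset[OF axioms_M]) (unfold KPP_def, blast)
  from this[unfolded models_Collection_iff, THEN conjunct2, rule_format, OF \<phi>(1),
      where i = 0 and j = 2 and a = a and v = "mix (case_nat undefined (case_nat undefined v)) e"]
  have "(\<forall>c. c \<epsilon> a \<longrightarrow> (\<exists>d. sat M (mix (case_nat c (case_nat d v)) e) \<phi>)) \<longrightarrow>
      (\<exists>b. \<forall>c. c \<epsilon> a \<longrightarrow> (\<exists>d. d \<epsilon> b \<and> sat M (mix (case_nat c (case_nat d v)) e) \<phi>))"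
    unfolding * by simp
  then show ?thesis using assms(2) \<phi>(2) by blast
qed

text \<open>Two witnesses can be found as elements of one set, and the quantifiers over its elements are
  bounded; the same applies to conjunctions.\<close>

lemma sigma1_ex:
  assumes "sigma1 (\<lambda>w. P (\<lambda>n. w (Suc n)) (w 0))"
  shows "sigma1 (\<lambda>v. \<exists>x. P v x)"
proof -
  obtain Q where Q: "delta0 Q" "\<And>w. P (\<lambda>n. w (Suc n)) (w 0) \<longleftrightarrow> (\<exists>a. Q (case_nat a w))"
    using sigma1_E[OF assms] by blast
  have P: "P v x \<longleftrightarrow> (\<exists>a. Q (case_nat a (case_nat x v)))" for v x
    using Q(2)[of "case_nat x v"] by simp
  define f where "f n = (if n < 2 then n else Suc n)" for n
  have "inj f" by (auto simp: f_def inj_def)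
  then have "delta0 (\<lambda>w. Q (case_nat (w 0) (case_nat (w (Suc 0)) (\<lambda>n. w (Suc (Suc (Suc n)))))))"
    by (rule delta0_rename'[OF Q(1)]) (simp add: f_def split: nat.split)
  then have "delta0 (\<lambda>w. \<exists>x. x \<epsilon> w 0 \<and> (\<exists>a. a \<epsilon> w 0 \<and> Q (case_nat a (case_nat x (\<lambda>n. w (Suc n))))))"
    by (intro delta0_bex) simp
  then show ?thesis
  proof (rule sigma1_I[where Q = "\<lambda>v c. \<exists>x. x \<epsilon> c \<and> (\<exists>a. a \<epsilon> c \<and> Q (case_nat a (case_nat x v)))"])
    fix v
    show "(\<exists>x. P v x) \<longleftrightarrow> (\<exists>c. \<exists>x. x \<epsilon> c \<and> (\<exists>a. a \<epsilon> c \<and> Q (case_nat a (case_nat x v))))"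
      unfolding P using common_set by blast
  qed
qed

lemma sigma1_conj:
  assumes "sigma1 P" "sigma1 P'"
  shows "sigma1 (\<lambda>v. P v \<and> P' v)"
proof -
  obtain Q where Q: "delta0 Q" "\<And>v. P v \<longleftrightarrow> (\<exists>a. Q (case_nat a v))"
    using sigma1_E[OF assms(1)] by blast
  obtain Q' where Q': "delta0 Q'" "\<And>v. P' v \<longleftrightarrow> (\<exists>a. Q' (case_nat a v))"
    using sigma1_E[OF assms(2)] by blast
  define f where "f n = (if n = 0 then 0 else Suc n)" for n
  have "inj f" by (auto simp: f_def inj_def)
  then have "delta0 (\<lambda>w. Q (case_nat (w 0) (\<lambda>n. w (Suc (Suc n)))))"
    "delta0 (\<lambda>w. Q' (case_nat (w 0) (\<lambda>n. w (Suc (Suc n)))))"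
    by (rule delta0_rename'[OF Q(1)] delta0_rename'[OF Q'(1)]; simp add: f_def split: nat.split)+
  then have "delta0 (\<lambda>w. (\<exists>a. a \<epsilon> w 0 \<and> Q (case_nat a (\<lambda>n. w (Suc n))))
      \<and> (\<exists>b. b \<epsilon> w 0 \<and> Q' (case_nat b (\<lambda>n. w (Suc n)))))"
    by (intro delta0_bex delta0_conj)
  then show ?thesis
  proof (rule sigma1_I[where Q = "\<lambda>v c. (\<exists>a. a \<epsilon> c \<and> Q (case_nat a v)) \<and> (\<exists>b. b \<epsilon> c \<and> Q' (case_nat b v))"])
    fix v
    show "P v \<and> P' v \<longleftrightarrow> (\<exists>c. (\<exists>a. a \<epsilon> c \<and> Q (case_nat a v)) \<and> (\<exists>b. b \<epsilon> c \<and> Q' (case_nat b v)))"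
      unfolding Q(2) Q'(2) using common_set by blast
  qed
qed

lemma sigma1_disj:
  assumes "sigma1 P" "sigma1 P'"
  shows "sigma1 (\<lambda>v. P v \<or> P' v)"
proof -
  obtain Q where Q: "delta0 Q" "\<And>v. P v \<longleftrightarrow> (\<exists>a. Q (case_nat a v))"
    using sigma1_E[OF assms(1)] by blast
  obtain Q' where Q': "delta0 Q'" "\<And>v. P' v \<longleftrightarrow> (\<exists>a. Q' (case_nat a v))"
    using sigma1_E[OF assms(2)] by blast
  have "delta0 (\<lambda>w. Q w \<or> Q' w)" using Q(1) Q'(1) by (rule delta0_disj)
  then show ?thesis unfolding sigma1_def Q(2) Q'(2) by (intro exI conjI) (assumption, auto)
qed

text \<open>By Collection a single set contains witnesses for all the elements of the bound.\<close>

lemma sigma1_ball_var: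
  assumes "sigma1 (\<lambda>w. P (\<lambda>n. w (Suc n)) (w 0))"
  shows "sigma1 (\<lambda>v. \<forall>x. x \<epsilon> v i \<longrightarrow> P v x)"
proof -
  obtain Q where Q: "delta0 Q" "\<And>w. P (\<lambda>n. w (Suc n)) (w 0) \<longleftrightarrow> (\<exists>a. Q (case_nat a w))"
    using sigma1_E[OF assms] by blast
  have P: "P v x \<longleftrightarrow> (\<exists>a. Q (case_nat a (case_nat x v)))" for v x
    using Q(2)[of "case_nat x v"] by simp
  define f where "f n = (if n < 2 then n else Suc n)" for n
  have "inj f" by (auto simp: f_def inj_def)
  then have "delta0 (\<lambda>w. Q (case_nat (w 0) (case_nat (w (Suc 0)) (\<lambda>n. w (Suc (Suc (Suc n)))))))"
    by (rule delta0_rename'[OF Q(1)]) (simp add: f_def split: nat.split)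
  then have D: "delta0 (\<lambda>w. \<forall>x. x \<epsilon> w (Suc i) \<longrightarrow> (\<exists>a. a \<epsilon> w 0 \<and> Q (case_nat a (case_nat x (\<lambda>n. w (Suc n))))))"
    by (intro delta0_ball delta0_bex) simp
  define g :: "nat \<Rightarrow> nat" where "g n = (if n = 0 then 1 else if n = 1 then 0 else n)" for n
  have "inj g" by (auto simp: g_def inj_def)
  then have g: "delta0 (\<lambda>w. Q (\<lambda>n. w (g n)))"
    using delta0_rename[OF Q(1)] by blast
  have swap: "(\<lambda>n. case_nat x (case_nat a v) (g n)) = case_nat a (case_nat x v)" for x a and v :: "nat \<Rightarrow> 'a"
    by (rule ext) (simp add: g_def split: nat.split)
  from D show ?thesis
  proof (rule sigma1_I[where Q = "\<lambda>v b. \<forall>x. x \<epsilon> v i \<longrightarrow> (\<exists>a. a \<epsilon> b \<and> Q (case_nat a (case_nat x v)))"])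
    fix v
    show "(\<forall>x. x \<epsilon> v i \<longrightarrow> P v x) \<longleftrightarrow> (\<exists>b. \<forall>x. x \<epsilon> v i \<longrightarrow> (\<exists>a. a \<epsilon> b \<and> Q (case_nat a (case_nat x v))))"
    proof
      assume "\<forall>x. x \<epsilon> v i \<longrightarrow> P v x"
      then show "\<exists>b. \<forall>x. x \<epsilon> v i \<longrightarrow> (\<exists>a. a \<epsilon> b \<and> Q (case_nat a (case_nat x v)))"
        using delta0_collection[OF g, of "v i" v, unfolded swap] unfolding P by simp
    next
      assume "\<exists>b. \<forall>x. x \<epsilon> v i \<longrightarrow> (\<exists>a. a \<epsilon> b \<and> Q (case_nat a (case_nat x v)))"
      then show "\<forall>x. x \<epsilon> v i \<longrightarrow> P v x" unfolding P by metis
    qed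
  qed
qed

lemma sigma1_rename:
  assumes "sigma1 P" "inj f"
  shows "sigma1 (\<lambda>v. P (\<lambda>n. v (f n)))"
proof -
  obtain Q where Q: "delta0 Q" "\<And>v. P v \<longleftrightarrow> (\<exists>a. Q (case_nat a v))"
    using sigma1_E[OF assms(1)] by blast
  define g where "g = case_nat 0 (\<lambda>n. Suc (f n))"
  have "inj g"
  proof (rule injI)
    fix x y assume "g x = g y"
    then show "x = y" by (cases x; cases y) (simp_all add: g_def inj_eq[OF assms(2)])
  qed
  then have "delta0 (\<lambda>w. Q (case_nat (w 0) (\<lambda>n. w (Suc (f n)))))"
    by (rule delta0_rename'[OF Q(1)]) (simp add: g_def split: nat.split)
  then show ?thesis
    by (rule sigma1_I[where Q = "\<lambda>v a. Q (case_nat a (\<lambda>n. v (f n)))"]) (rule Q(2))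
qed

lemma sigma1_param:
  assumes "sigma1 (\<lambda>w. P (\<lambda>n. w (Suc n)) (w 0))"
  shows "sigma1 (\<lambda>v. P v c)"
proof -
  obtain Q where Q: "delta0 Q" "\<And>w. P (\<lambda>n. w (Suc n)) (w 0) \<longleftrightarrow> (\<exists>a. Q (case_nat a w))"
    using sigma1_E[OF assms] by blast
  have P: "P v x \<longleftrightarrow> (\<exists>a. Q (case_nat a (case_nat x v)))" for v x
    using Q(2)[of "case_nat x v"] by simp
  define g :: "nat \<Rightarrow> nat" where "g n = (if n = 0 then 1 else if n = 1 then 0 else n)" for n
  have "inj g" by (auto simp: g_def inj_def)
  then have "delta0 (\<lambda>w. Q (case_nat (w (Suc 0)) (case_nat (w 0) (\<lambda>n. w (Suc (Suc n))))))"
    by (rule delta0_rename'[OF Q(1)]) (simp add: g_def split: nat.split)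
  then have "delta0 (\<lambda>w. Q (case_nat (w 0) (case_nat c (\<lambda>n. w (Suc n)))))"
    by (rule delta0_param[where P = "\<lambda>w x. Q (case_nat (w 0) (case_nat x (\<lambda>n. w (Suc n))))"])
  then show ?thesis
    by (rule sigma1_I[where Q = "\<lambda>v a. Q (case_nat a (case_nat c v))"]) (rule P)
qed

definition delta1 :: "((nat \<Rightarrow> 'a) \<Rightarrow> bool) \<Rightarrow> bool" where
  "delta1 P \<longleftrightarrow> sigma1 P \<and> sigma1 (\<lambda>v. \<not> P v)"

lemma delta1_delta0: "delta0 P \<Longrightarrow> delta1 P"
  unfolding delta1_def by (simp add: sigma1_delta0 delta0_not)

lemma delta1_not: "delta1 P \<Longrightarrow> delta1 (\<lambda>v. \<not> P v)"
  unfolding delta1_def by simp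

lemma delta1_conj: "delta1 P \<Longrightarrow> delta1 Q \<Longrightarrow> delta1 (\<lambda>v. P v \<and> Q v)"
  unfolding delta1_def de_Morgan_conj de_Morgan_disj
  by (elim conjE) (intro conjI sigma1_conj sigma1_disj; assumption)

lemma delta1_disj: "delta1 P \<Longrightarrow> delta1 Q \<Longrightarrow> delta1 (\<lambda>v. P v \<or> Q v)"
  unfolding delta1_def de_Morgan_conj de_Morgan_disj
  by (elim conjE) (intro conjI sigma1_conj sigma1_disj; assumption)

lemma delta1_imp: "delta1 P \<Longrightarrow> delta1 Q \<Longrightarrow> delta1 (\<lambda>v. P v \<longrightarrow> Q v)"
  using delta1_disj[OF delta1_not, of P Q] by (simp only: imp_conv_disj)

lemma delta1_iff:
  assumes "delta1 P" "delta1 Q"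
  shows "delta1 (\<lambda>v. P v \<longleftrightarrow> Q v)"
proof -
  have "delta1 (\<lambda>v. (P v \<longrightarrow> Q v) \<and> (Q v \<longrightarrow> P v))"
    by (rule delta1_conj[OF delta1_imp[OF assms] delta1_imp[OF assms(2,1)]])
  moreover have "(\<lambda>v. (P v \<longrightarrow> Q v) \<and> (Q v \<longrightarrow> P v)) = (\<lambda>v. P v \<longleftrightarrow> Q v)" by auto
  ultimately show ?thesis by (rule back_subst)
qed

text \<open>Operations with a \<open>\<Sigma>\<^sub>1\<close> graph serve as terms. As they are total, both \<open>P (t v)\<close> and its
  negation can be written with an existential quantifier over the value, so that terms may be
  substituted into \<open>\<Delta>\<^sub>1\<close> predicates.\<close>

definition sigma1_fun :: "((nat \<Rightarrow> 'a) \<Rightarrow> 'a) \<Rightarrow> bool" where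
  "sigma1_fun t \<longleftrightarrow> sigma1 (\<lambda>w. w 0 = t (\<lambda>n. w (Suc n)))"

lemma sigma1_fun_var: "sigma1_fun (\<lambda>v. v i)"
  unfolding sigma1_fun_def by (rule sigma1_delta0[OF delta0_eq])

lemma sigma1_fun_const: "sigma1_fun (\<lambda>v. c)"
  unfolding sigma1_fun_def by (rule sigma1_param[where P = "\<lambda>w c. w 0 = c"]) (rule sigma1_delta0[OF delta0_eq])

lemma sigma1_subst:
  assumes "sigma1_fun t" "sigma1 (\<lambda>w. P (\<lambda>n. w (Suc n)) (w 0))"
  shows "sigma1 (\<lambda>v. P v (t v))"
proof -
  have "sigma1 (\<lambda>v. \<exists>x. x = t v \<and> P v x)"
    by (intro sigma1_ex sigma1_conj assms(2) assms(1)[unfolded sigma1_fun_def])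
  then show ?thesis by simp
qed

lemma delta1_subst:
  assumes "sigma1_fun t" "delta1 (\<lambda>w. P (\<lambda>n. w (Suc n)) (w 0))"
  shows "delta1 (\<lambda>v. P v (t v))"
  using sigma1_subst[OF assms(1)] assms(2) unfolding delta1_def by auto

lemma sigma1_fun_rename: "sigma1_fun t \<Longrightarrow> inj f \<Longrightarrow> sigma1_fun (\<lambda>v. t (\<lambda>n. v (f n)))"
proof -
  assume t: "sigma1_fun t" and f: "inj f"
  define g where "g = case_nat 0 (\<lambda>n. Suc (f n))"
  have "inj g"
  proof (rule injI)
    fix x y assume "g x = g y"
    then show "x = y" by (cases x; cases y) (simp_all add: g_def inj_eq[OF f])
  qed
  from sigma1_rename[OF t[unfolded sigma1_fun_def] this] show ?thesis
    unfolding sigma1_fun_def by (simp add: g_def)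
qed

lemma sigma1_fun_subst:
  assumes "sigma1_fun t" "sigma1_fun (\<lambda>w. s (\<lambda>n. w (Suc n)) (w 0))"
  shows "sigma1_fun (\<lambda>v. s v (t v))"
proof -
  have "sigma1 (\<lambda>w. \<exists>x. x = t (\<lambda>n. w (Suc n)) \<and> w 0 = s (\<lambda>n. w (Suc n)) x)"
  proof (intro sigma1_ex sigma1_conj)
    show "sigma1 (\<lambda>w. w 0 = t (\<lambda>n. w (Suc (Suc n))))"
      using sigma1_fun_rename[OF assms(1), of Suc] by (simp add: sigma1_fun_def)
    define g :: "nat \<Rightarrow> nat" where "g n = (if n = 0 then 1 else if n = 1 then 0 else n)" for n
    have "inj g" by (auto simp: g_def inj_def)
    then show "sigma1 (\<lambda>w. w (Suc 0) = s (\<lambda>n. w (Suc (Suc n))) (w 0))"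
      using sigma1_rename[OF assms(2)[unfolded sigma1_fun_def], of g] by (simp add: g_def)
  qed
  then show ?thesis unfolding sigma1_fun_def by simp
qed

lemma sigma1_bex:
  assumes "sigma1_fun t" "sigma1 (\<lambda>w. P (\<lambda>n. w (Suc n)) (w 0))"
  shows "sigma1 (\<lambda>v. \<exists>x. x \<epsilon> t v \<and> P v x)"
proof (intro sigma1_ex sigma1_conj assms(2))
  show "sigma1 (\<lambda>w. w 0 \<epsilon> t (\<lambda>n. w (Suc n)))"
    by (rule sigma1_subst[where t = "\<lambda>w. t (\<lambda>n. w (Suc n))" and P = "\<lambda>w x. w 0 \<epsilon> x"])
      (simp_all add: sigma1_fun_rename[OF assms(1)] sigma1_delta0[OF delta0_mem])
qed

lemma sigma1_ball:
  assumes "sigma1_fun t" "sigma1 (\<lambda>w. P (\<lambda>n. w (Suc n)) (w 0))"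
  shows "sigma1 (\<lambda>v. \<forall>x. x \<epsilon> t v \<longrightarrow> P v x)"
proof (rule sigma1_subst[OF assms(1), where P = "\<lambda>v s. \<forall>x. x \<epsilon> s \<longrightarrow> P v x"], rule sigma1_ball_var)
  define g where "g n = (if n = 0 then 0 else Suc n)" for n :: nat
  have "inj g" by (auto simp: g_def inj_def)
  then show "sigma1 (\<lambda>w. P (\<lambda>n. w (Suc (Suc n))) (w 0))"
    using sigma1_rename[OF assms(2), of g] by (simp add: g_def)
qed

lemma delta1_bex:
  assumes "sigma1_fun t" "delta1 (\<lambda>w. P (\<lambda>n. w (Suc n)) (w 0))"
  shows "delta1 (\<lambda>v. \<exists>x. x \<epsilon> t v \<and> P v x)"
  using sigma1_bex[OF assms(1), of P] sigma1_ball[OF assms(1), of "\<lambda>v x. \<not> P v x"] assms(2)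
  unfolding delta1_def by simp

lemma delta1_ball:
  assumes "sigma1_fun t" "delta1 (\<lambda>w. P (\<lambda>n. w (Suc n)) (w 0))"
  shows "delta1 (\<lambda>v. \<forall>x. x \<epsilon> t v \<longrightarrow> P v x)"
  using sigma1_ball[OF assms(1), of P] sigma1_bex[OF assms(1), of "\<lambda>v x. \<not> P v x"] assms(2)
  unfolding delta1_def by simp

lemma delta1_sigma1: "delta1 P \<Longrightarrow> sigma1 P"
  unfolding delta1_def by simp

lemma delta1_mem: "sigma1_fun s \<Longrightarrow> sigma1_fun t \<Longrightarrow> delta1 (\<lambda>v. s v \<epsilon> t v)"
  by (rule delta1_subst[where P = "\<lambda>v x. s v \<epsilon> x"], assumption,
      rule delta1_subst[where t = "\<lambda>w. s (\<lambda>n. w (Suc n))" and P = "\<lambda>v x. x \<epsilon> v 0"])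
    (simp_all add: sigma1_fun_rename delta1_delta0 delta0_mem)

lemma delta1_eq: "sigma1_fun s \<Longrightarrow> sigma1_fun t \<Longrightarrow> delta1 (\<lambda>v. s v = t v)"
  by (rule delta1_subst[where P = "\<lambda>v x. s v = x"], assumption,
      rule delta1_subst[where t = "\<lambda>w. s (\<lambda>n. w (Suc n))" and P = "\<lambda>v x. x = v 0"])
    (simp_all add: sigma1_fun_rename delta1_delta0 delta0_eq)

text \<open>Used as introduction rules these follow the syntax of an explicitly given predicate.\<close>

lemmas definability = delta1_mem delta1_eq delta1_not delta1_conj delta1_disj delta1_imp delta1_iff delta1_bex delta1_ball sigma1_fun_var sigma1_fun_const

section \<open>Separation, foundation and collection\<close>

lemma sigma1_sat:
  assumes "sigma1 P"
  obtains \<phi> e where "\<phi> \<in> Delta0P"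
    "\<And>c v u. P (case_nat c v) \<longleftrightarrow>
      (\<exists>a. sat M ((mix (case_nat u (case_nat u v)) e)(2 := c, 0 := a)) \<phi>)"
proof -
  obtain Q where Q: "delta0 Q" "\<And>v. P v \<longleftrightarrow> (\<exists>a. Q (case_nat a v))"
    using sigma1_E[OF assms] by blast
  obtain \<phi> e where \<phi>: "\<phi> \<in> Delta0P" "\<And>v. Q v \<longleftrightarrow> sat M (mix v e) \<phi>"
    using Q(1) unfolding delta0_def by blast
  have *: "(mix (case_nat u (case_nat u v)) e)(2 := c, 0 := a) = mix (case_nat a (case_nat c v)) e"
    for u v c a
  proof -
    have "(case_nat u (case_nat u v))(Suc 0 := c, 0 := a) = case_nat a (case_nat c v)"
      by (rule ext) (simp split: nat.split)
    then show ?thesis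
      using mix_update[of "case_nat u (case_nat u v)" e "Suc 0" c]
        mix_update[of "(case_nat u (case_nat u v))(Suc 0 := c)" e 0 a]
      by simp
  qed
  show thesis
    by (rule that[OF \<phi>(1), of e]) (unfold * Q(2) \<phi>(2), rule refl)
qed

lemma sat_dummy:
  assumes "N \<notin> fv \<phi>"
  shows "sat M (v(N := a)) \<phi> \<longleftrightarrow> sat M v \<phi>"
  by (rule sat_cong) (use assms in auto)

text \<open>A vacuous universal quantifier turns a \<open>\<Sigma>\<^sub>1\<close> formula into one of each of the classes whose
  schemas are among the axioms.\<close>

lemma sigma1_SigmaP_PiP:
  assumes "sigma1 P"
  obtains \<sigma> \<pi> e where "\<sigma> \<in> SigmaP 2" "\<pi> \<in> PiP 2"
    "\<And>c v u. P (case_nat c v) \<longleftrightarrow> sat M ((mix (case_nat u (case_nat u v)) e)(2 := c)) \<sigma>"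
    "\<And>c v u. P (case_nat c v) \<longleftrightarrow> sat M ((mix (case_nat u (case_nat u v)) e)(2 := c)) \<pi>"
proof -
  obtain \<phi> e where \<phi>: "\<phi> \<in> Delta0P"
    "\<And>c v u. P (case_nat c v) \<longleftrightarrow>
      (\<exists>a. sat M ((mix (case_nat u (case_nat u v)) e)(2 := c, 0 := a)) \<phi>)"
    using sigma1_sat[OF assms] by blast
  obtain N where N: "N \<notin> fv \<phi>" "N \<noteq> 0" "N \<noteq> 2"
    using fresh_var[of "fv \<phi> \<union> {0, 2}"] finite_fv[of \<phi>] by auto
  have "Ex 0 (All N \<phi>) \<in> SigmaP 2" "All N (Ex 0 \<phi>) \<in> PiP 2"
    using \<phi>(1) by (auto simp: numeral_2_eq_2)
  then show thesis
  proof (rule that)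
    fix c v u
    show "P (case_nat c v) \<longleftrightarrow> sat M ((mix (case_nat u (case_nat u v)) e)(2 := c)) (Ex 0 (All N \<phi>))"
      unfolding \<phi>(2)[of c v u] using sat_dummy[OF N(1)] by simp
    have "sat M (w(N := b)) (Ex 0 \<phi>) \<longleftrightarrow> sat M w (Ex 0 \<phi>)" for w b
      by (rule sat_cong) (use N in auto)
    then show "P (case_nat c v) \<longleftrightarrow> sat M ((mix (case_nat u (case_nat u v)) e)(2 := c)) (All N (Ex 0 \<phi>))"
      unfolding \<phi>(2)[of c v u] by simp
  qed
qed

lemma separation_env:
  assumes "sigma1 P"
  shows "\<exists>b. \<forall>c. c \<epsilon> b \<longleftrightarrow> c \<epsilon> a \<and> P (case_nat c v)"
proof -
  obtain \<sigma> e where \<sigma>: "\<sigma> \<in> SigmaP 2"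
    "\<And>c v u. P (case_nat c v) \<longleftrightarrow> sat M ((mix (case_nat u (case_nat u v)) e)(2 := c)) \<sigma>"
    using sigma1_SigmaP_PiP[OF assms] by metis
  have "models M (Separation (SigmaP 2))"
    by (rule models_subset[OF axioms_M]) blast
  from this[unfolded models_Separation_iff, THEN conjunct2, rule_format, OF \<sigma>(1),
      of "mix (case_nat undefined (case_nat undefined v)) e" a 2]
  show ?thesis unfolding \<sigma>(2)[of _ v undefined] by simp
qed

lemma separation: "sigma1 (\<lambda>v. P (v 0)) \<Longrightarrow> \<exists>b. \<forall>c. c \<epsilon> b \<longleftrightarrow> c \<epsilon> a \<and> P c"
  using separation_env[of "\<lambda>v. P (v 0)" a undefined] by simp

lemma foundation_sigma1:
  assumes "sigma1 (\<lambda>v. P (v 0))" "P x"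
  shows "\<exists>x. P x \<and> (\<forall>y. y \<epsilon> x \<longrightarrow> \<not> P y)"
proof -
  obtain \<pi> e where \<pi>: "\<pi> \<in> PiP 2"
    "\<And>c v u. P (case_nat c v 0) \<longleftrightarrow> sat M ((mix (case_nat u (case_nat u v)) e)(2 := c)) \<pi>"
    using sigma1_SigmaP_PiP[OF assms(1)] by metis
  then have \<pi>2: "sat M ((mix (case_nat undefined (case_nat undefined undefined)) e)(2 := c)) \<pi> \<longleftrightarrow> P c" for c
    by (metis nat.case(1))
  have "models M (Foundation (PiP 2))"
    by (rule models_subset[OF axioms_M]) blast
  from this[unfolded models_Foundation_iff, THEN conjunct2, rule_format, OF \<pi>(1),
      of "mix (case_nat undefined (case_nat undefined undefined)) e" 2]
  show ?thesis unfolding \<pi>2 using assms(2) by auto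
qed

lemma foundation_pi1:
  assumes "sigma1 (\<lambda>v. \<not> P (v 0))" "P x"
  shows "\<exists>x. P x \<and> (\<forall>y. y \<epsilon> x \<longrightarrow> \<not> P y)"
proof -
  obtain \<phi> e where \<phi>: "\<phi> \<in> Delta0P"
    "\<And>c v u. (\<not> P (case_nat c v 0)) \<longleftrightarrow>
      (\<exists>a. sat M ((mix (case_nat u (case_nat u v)) e)(2 := c, 0 := a)) \<phi>)"
    using sigma1_sat[OF assms(1)] by metis
  have \<phi>2: "sat M ((mix (case_nat undefined (case_nat undefined undefined)) e)(2 := c)) (All 0 (Neg \<phi>)) \<longleftrightarrow> P c" for c
    using \<phi>(2)[of c undefined undefined] by auto
  have in_Pi: "All 0 (Neg \<phi>) \<in> PiP 1" using Delta0P.Neg[OF \<phi>(1)] by simp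
  have "models M (Foundation (PiP 1))"
    by (rule models_subset[OF axioms_M]) (unfold KPP_def, blast)
  from this[unfolded models_Foundation_iff, THEN conjunct2, rule_format, OF in_Pi,
      of "mix (case_nat undefined (case_nat undefined undefined)) e" 2]
  show ?thesis unfolding \<phi>2 using assms(2) by auto
qed

lemma mem_induct_pi1:
  assumes "sigma1 (\<lambda>v. \<not> P (v 0))" "\<And>x. (\<And>y. y \<epsilon> x \<Longrightarrow> P y) \<Longrightarrow> P x"
  shows "P x"
  using foundation_sigma1[of "\<lambda>x. \<not> P x", OF assms(1), of x] assms(2) by blast

lemma mem_induct_sigma1:
  assumes "sigma1 (\<lambda>v. P (v 0))" "\<And>x. (\<And>y. y \<epsilon> x \<Longrightarrow> P y) \<Longrightarrow> P x"
  shows "P x"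
  using foundation_pi1[of "\<lambda>x. \<not> P x" x] assms by auto

lemma mem_induct_delta1:
  assumes "delta1 (\<lambda>v. P (v 0))" "\<And>x. (\<And>y. y \<epsilon> x \<Longrightarrow> P y) \<Longrightarrow> P x"
  shows "P x"
  by (rule mem_induct_sigma1[OF delta1_sigma1[OF assms(1)] assms(2)])

text \<open>The witness for the \<open>\<Sigma>\<^sub>1\<close> predicate is collected together with the value: a set \<open>q\<close> containing
  both is chosen, and the union of all the \<open>q\<close> contains the values.\<close>

lemma collection_env:
  assumes "sigma1 P" "\<And>c. c \<epsilon> a \<Longrightarrow> \<exists>d. P (case_nat c (case_nat d v))"
  shows "\<exists>b. \<forall>c. c \<epsilon> a \<longrightarrow> (\<exists>d. d \<epsilon> b \<and> P (case_nat c (case_nat d v)))"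
proof -
  obtain Q where Q: "delta0 Q" "\<And>v. P v \<longleftrightarrow> (\<exists>p. Q (case_nat p v))"
    using sigma1_E[OF assms(1)] by blast
  define f :: "nat \<Rightarrow> nat"
    where "f n = (if n = 0 then 0 else if n = Suc 0 then Suc (Suc 0) else if n = Suc (Suc 0) then Suc 0 else Suc n)" for n
  have "inj f" by (auto simp: f_def inj_def)
  then have "delta0 (\<lambda>w. Q (case_nat (w 0) (case_nat (w (Suc (Suc 0))) (case_nat (w (Suc 0)) (\<lambda>n. w (Suc (Suc (Suc (Suc n)))))))))"
    by (rule delta0_rename'[OF Q(1)]) (auto simp: f_def split: nat.split)
  then have D: "delta0 (\<lambda>w. \<exists>d. d \<epsilon> w (Suc 0) \<and> (\<exists>p. p \<epsilon> w (Suc 0) \<and>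
      Q (case_nat p (case_nat (w 0) (case_nat d (\<lambda>n. w (Suc (Suc n))))))))"
    by (intro delta0_bex) simp
  have "\<exists>q. \<exists>d. d \<epsilon> q \<and> (\<exists>p. p \<epsilon> q \<and> Q (case_nat p (case_nat c (case_nat d v))))"
    if c: "c \<epsilon> a" for c
    using assms(2)[OF c] common_set unfolding Q(2) by meson
  then obtain b where b: "\<And>c. c \<epsilon> a \<Longrightarrow> \<exists>q. q \<epsilon> b \<and> (\<exists>d. d \<epsilon> q \<and> (\<exists>p. p \<epsilon> q \<and>
      Q (case_nat p (case_nat c (case_nat d v)))))"
    using delta0_collection[OF D, of a v] by auto
  obtain u where u: "\<And>w. w \<epsilon> u \<longleftrightarrow> (\<exists>z. z \<epsilon> b \<and> w \<epsilon> z)" using union_set by blast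
  have "\<exists>d. d \<epsilon> u \<and> P (case_nat c (case_nat d v))" if "c \<epsilon> a" for c
    using b[OF that] unfolding Q(2) u by blast
  then show ?thesis by blast
qed

lemma collection:
  assumes "sigma1 (\<lambda>v. P (v 0) (v (Suc 0)))" "\<And>c. c \<epsilon> a \<Longrightarrow> \<exists>d. P c d"
  shows "\<exists>b. \<forall>c. c \<epsilon> a \<longrightarrow> (\<exists>d. d \<epsilon> b \<and> P c d)"
  using collection_env[OF assms(1), of a undefined] assms(2) by simp

lemma delta1_rename: "delta1 P \<Longrightarrow> inj f \<Longrightarrow> delta1 (\<lambda>v. P (\<lambda>n. v (f n)))"
  unfolding delta1_def using sigma1_rename[of P f] sigma1_rename[of "\<lambda>v. \<not> P v" f] by simp

lemma delta1_subst1: "delta1 (\<lambda>v. R (v 0)) \<Longrightarrow> sigma1_fun r \<Longrightarrow> delta1 (\<lambda>v. R (r v))"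
  by (rule delta1_subst[where P = "\<lambda>v. R"])

lemma delta1_subst2:
  assumes "delta1 (\<lambda>v. R (v 0) (v (Suc 0)))" "sigma1_fun r" "sigma1_fun s"
  shows "delta1 (\<lambda>v. R (r v) (s v))"
  by (rule delta1_subst[OF assms(3), where P = "\<lambda>v y. R (r v) y"],
      rule delta1_subst[where t = "\<lambda>w. r (\<lambda>n. w (Suc n))" and P = "\<lambda>v x. R x (v 0)"])
    (simp_all add: sigma1_fun_rename assms)

lemma delta1_subst3:
  assumes "delta1 (\<lambda>v. R (v 0) (v (Suc 0)) (v (Suc (Suc 0))))" "sigma1_fun r" "sigma1_fun s" "sigma1_fun t"
  shows "delta1 (\<lambda>v. R (r v) (s v) (t v))"
  by (rule delta1_subst[OF assms(4), where P = "\<lambda>v y. R (r v) (s v) y"],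
      rule delta1_subst[where t = "\<lambda>w. s (\<lambda>n. w (Suc n))" and P = "\<lambda>v x. R (r (\<lambda>n. v (Suc n))) x (v 0)"],
      simp add: sigma1_fun_rename assms,
      rule delta1_subst[where t = "\<lambda>w. r (\<lambda>n. w (Suc (Suc n)))" and P = "\<lambda>v x. R x (v 0) (v (Suc 0))"])
    (simp_all add: sigma1_fun_rename[where f = "\<lambda>n. Suc (Suc n)"] inj_def assms)

lemma sigma1_fun_I1:
  assumes "sigma1 (\<lambda>v. v 0 = F (v (Suc 0)))" "sigma1_fun r"
  shows "sigma1_fun (\<lambda>v. F (r v))"
  by (rule sigma1_fun_subst[where s = "\<lambda>v. F"]) (use assms in \<open>simp_all add: sigma1_fun_def\<close>)

lemma sigma1_fun_I2:
  assumes "sigma1 (\<lambda>v. v 0 = F (v (Suc 0)) (v (Suc (Suc 0))))" "sigma1_fun r" "sigma1_fun s"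
  shows "sigma1_fun (\<lambda>v. F (r v) (s v))"
  by (rule sigma1_fun_subst[OF assms(3), where s = "\<lambda>v y. F (r v) y"],
      rule sigma1_fun_subst[where t = "\<lambda>w. r (\<lambda>n. w (Suc n))" and s = "\<lambda>v x. F x (v 0)"])
    (simp_all add: sigma1_fun_rename assms, simp add: sigma1_fun_def assms)

lemma delta1_subset: "sigma1_fun s \<Longrightarrow> sigma1_fun t \<Longrightarrow> delta1 (\<lambda>v. \<forall>z. z \<epsilon> s v \<longrightarrow> z \<epsilon> t v)"
  by (rule delta1_subst2[where R = "\<lambda>x y. \<forall>z. z \<epsilon> x \<longrightarrow> z \<epsilon> y"]) (intro definability)

section \<open>Set operations as terms\<close>

definition sep :: "'a \<Rightarrow> ('a \<Rightarrow> bool) \<Rightarrow> 'a" where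
  "sep a P = (THE b. \<forall>w. w \<epsilon> b \<longleftrightarrow> w \<epsilon> a \<and> P w)"

lemma the_set:
  assumes "\<exists>b. \<forall>w. w \<epsilon> b \<longleftrightarrow> P w"
  shows "w \<epsilon> (THE b. \<forall>w. w \<epsilon> b \<longleftrightarrow> P w) \<longleftrightarrow> P w"
proof -
  have "\<exists>!b. \<forall>w. w \<epsilon> b \<longleftrightarrow> P w"
    using assms extensionality by (metis (full_types))
  from theI'[OF this] show ?thesis by blast
qed

lemma mem_sep_env: "sigma1 P \<Longrightarrow> w \<epsilon> sep a (\<lambda>x. P (case_nat x v)) \<longleftrightarrow> w \<epsilon> a \<and> P (case_nat w v)"
  unfolding sep_def by (rule the_set) (rule separation_env)

lemma mem_sep: "sigma1 (\<lambda>v. P (v 0)) \<Longrightarrow> w \<epsilon> sep a P \<longleftrightarrow> w \<epsilon> a \<and> P w"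
  using mem_sep_env[of "\<lambda>v. P (v 0)"] by simp

text \<open>The equation \<open>y = sep a P\<close> only involves quantifiers bounded by \<open>y\<close> and \<open>a\<close>.\<close>

lemma sigma1_fun_sep:
  assumes "sigma1_fun a" "delta1 (\<lambda>w. P (\<lambda>n. w (Suc n)) (w 0))"
  shows "sigma1_fun (\<lambda>v. sep (a v) (P v))"
proof -
  have mem: "x \<epsilon> sep b (P v) \<longleftrightarrow> x \<epsilon> b \<and> P v x" for x b v
    using mem_sep_env[OF delta1_sigma1[OF assms(2)], of x b v] by simp
  have P: "delta1 (\<lambda>u. P (\<lambda>n. u (Suc (Suc n))) (u 0))"
  proof -
    define g :: "nat \<Rightarrow> nat" where "g n = (if n = 0 then 0 else Suc n)" for n
    have "inj g" by (auto simp: g_def inj_def)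
    from delta1_rename[OF assms(2) this] show ?thesis by (simp add: g_def)
  qed
  have "delta1 (\<lambda>w. (\<forall>x. x \<epsilon> w 0 \<longrightarrow> x \<epsilon> a (\<lambda>n. w (Suc n)) \<and> P (\<lambda>n. w (Suc n)) x) \<and>
      (\<forall>x. x \<epsilon> a (\<lambda>n. w (Suc n)) \<longrightarrow> P (\<lambda>n. w (Suc n)) x \<longrightarrow> x \<epsilon> w 0))"
    by (intro definability P sigma1_fun_rename[OF assms(1), of "\<lambda>n. Suc n"] sigma1_fun_rename[OF assms(1), of "\<lambda>n. Suc (Suc n)"])
      (auto simp: inj_def)
  then have "sigma1 (\<lambda>w. (\<forall>x. x \<epsilon> w 0 \<longrightarrow> x \<epsilon> a (\<lambda>n. w (Suc n)) \<and> P (\<lambda>n. w (Suc n)) x) \<and>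
      (\<forall>x. x \<epsilon> a (\<lambda>n. w (Suc n)) \<longrightarrow> P (\<lambda>n. w (Suc n)) x \<longrightarrow> x \<epsilon> w 0))"
    by (rule delta1_sigma1)
  moreover have "(\<forall>x. x \<epsilon> y \<longrightarrow> x \<epsilon> b \<and> P v x) \<and> (\<forall>x. x \<epsilon> b \<longrightarrow> P v x \<longrightarrow> x \<epsilon> y) \<longleftrightarrow> y = sep b (P v)"
    for y b v
  proof
    assume "(\<forall>x. x \<epsilon> y \<longrightarrow> x \<epsilon> b \<and> P v x) \<and> (\<forall>x. x \<epsilon> b \<longrightarrow> P v x \<longrightarrow> x \<epsilon> y)"
    then show "y = sep b (P v)" by (intro extensionality) (unfold mem, blast)
  qed (simp add: mem)
  ultimately show ?thesis unfolding sigma1_fun_def by simp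
qed

definition upair :: "'a \<Rightarrow> 'a \<Rightarrow> 'a" where
  "upair x y = (THE p. \<forall>w. w \<epsilon> p \<longleftrightarrow> w = x \<or> w = y)"

lemma mem_upair [simp]: "w \<epsilon> upair x y \<longleftrightarrow> w = x \<or> w = y"
  unfolding upair_def by (rule the_set) (rule pairing)

definition bigun :: "'a \<Rightarrow> 'a" where
  "bigun x = (THE u. \<forall>w. w \<epsilon> u \<longleftrightarrow> (\<exists>z. z \<epsilon> x \<and> w \<epsilon> z))"

lemma mem_bigun [simp]: "w \<epsilon> bigun x \<longleftrightarrow> (\<exists>z. z \<epsilon> x \<and> w \<epsilon> z)"
  unfolding bigun_def by (rule the_set) (rule union_set)

definition pow :: "'a \<Rightarrow> 'a" where
  "pow x = (THE p. \<forall>w. w \<epsilon> p \<longleftrightarrow> (\<forall>z. z \<epsilon> w \<longrightarrow> z \<epsilon> x))"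

lemma mem_pow [simp]: "w \<epsilon> pow x \<longleftrightarrow> (\<forall>z. z \<epsilon> w \<longrightarrow> z \<epsilon> x)"
  unfolding pow_def by (rule the_set) (rule power_set)

lemma sigma1_fun_upair: "sigma1_fun r \<Longrightarrow> sigma1_fun s \<Longrightarrow> sigma1_fun (\<lambda>v. upair (r v) (s v))"
proof (rule sigma1_fun_I2[where F = upair])
  have "delta1 (\<lambda>v. (\<forall>w. w \<epsilon> v 0 \<longrightarrow> w = v (Suc 0) \<or> w = v (Suc (Suc 0))) \<and> v (Suc 0) \<epsilon> v 0 \<and> v (Suc (Suc 0)) \<epsilon> v 0)"
    by (intro definability)
  moreover have "(y = upair a b) \<longleftrightarrow> (\<forall>w. w \<epsilon> y \<longrightarrow> w = a \<or> w = b) \<and> a \<epsilon> y \<and> b \<epsilon> y" for y a b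
    using extensionality[of y "upair a b"] by auto
  ultimately show "sigma1 (\<lambda>v. v 0 = upair (v (Suc 0)) (v (Suc (Suc 0))))"
    using delta1_sigma1 by presburger
qed

lemma sigma1_fun_bigun: "sigma1_fun r \<Longrightarrow> sigma1_fun (\<lambda>v. bigun (r v))"
proof (rule sigma1_fun_I1[where F = bigun])
  have "delta1 (\<lambda>v. (\<forall>w. w \<epsilon> v 0 \<longrightarrow> (\<exists>z. z \<epsilon> v (Suc 0) \<and> w \<epsilon> z)) \<and> (\<forall>z. z \<epsilon> v (Suc 0) \<longrightarrow> (\<forall>w. w \<epsilon> z \<longrightarrow> w \<epsilon> v 0)))"
    by (intro definability)
  moreover have "(y = bigun x) \<longleftrightarrow> (\<forall>w. w \<epsilon> y \<longrightarrow> (\<exists>z. z \<epsilon> x \<and> w \<epsilon> z)) \<and> (\<forall>z. z \<epsilon> x \<longrightarrow> (\<forall>w. w \<epsilon> z \<longrightarrow> w \<epsilon> y))" for y x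
    using extensionality[of y "bigun x"] by auto
  ultimately show "sigma1 (\<lambda>v. v 0 = bigun (v (Suc 0)))"
    using delta1_sigma1 by presburger
qed

lemma sigma1_fun_pow: "sigma1_fun r \<Longrightarrow> sigma1_fun (\<lambda>v. pow (r v))"
proof (rule sigma1_fun_I1[where F = pow])
  have "delta1 (\<lambda>v. (\<forall>w. w \<epsilon> v 0 \<longrightarrow> (\<forall>z. z \<epsilon> w \<longrightarrow> z \<epsilon> v (Suc 0))) \<and> (\<forall>w. (\<forall>z. z \<epsilon> w \<longrightarrow> z \<epsilon> v (Suc 0)) \<longrightarrow> w \<epsilon> v 0))"
    by (intro definability, rule delta1_delta0, rule delta0_ball_sub, rule delta0_mem)
  moreover have "(y = pow x) \<longleftrightarrow> (\<forall>w. w \<epsilon> y \<longrightarrow> (\<forall>z. z \<epsilon> w \<longrightarrow> z \<epsilon> x)) \<and> (\<forall>w. (\<forall>z. z \<epsilon> w \<longrightarrow> z \<epsilon> x) \<longrightarrow> w \<epsilon> y)" for y x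
    using extensionality[of y "pow x"] by auto
  ultimately show "sigma1 (\<lambda>v. v 0 = pow (v (Suc 0)))"
    using delta1_sigma1 by presburger
qed

definition opair :: "'a \<Rightarrow> 'a \<Rightarrow> 'a" where
  "opair x y = upair (upair x x) (upair x y)"

lemma sigma1_fun_opair: "sigma1_fun r \<Longrightarrow> sigma1_fun s \<Longrightarrow> sigma1_fun (\<lambda>v. opair (r v) (s v))"
  unfolding opair_def by (intro sigma1_fun_upair)

lemma upair_eq_iff: "upair a b = upair c d \<longleftrightarrow> a = c \<and> b = d \<or> a = d \<and> b = c"
proof
  assume "upair a b = upair c d"
  then have "w = a \<or> w = b \<longleftrightarrow> w = c \<or> w = d" for w
    using mem_upair[of w a b] by simp
  then show "a = c \<and> b = d \<or> a = d \<and> b = c" by metis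
qed (auto intro!: extensionality)

lemma opair_eq [simp]: "opair a b = opair c d \<longleftrightarrow> a = c \<and> b = d"
  unfolding opair_def upair_eq_iff by blast

definition un :: "'a \<Rightarrow> 'a \<Rightarrow> 'a" where
  "un x y = bigun (upair x y)"

lemma mem_un [simp]: "w \<epsilon> un x y \<longleftrightarrow> w \<epsilon> x \<or> w \<epsilon> y"
  unfolding un_def by auto

lemma sigma1_fun_un: "sigma1_fun r \<Longrightarrow> sigma1_fun s \<Longrightarrow> sigma1_fun (\<lambda>v. un (r v) (s v))"
  unfolding un_def by (intro sigma1_fun_upair sigma1_fun_bigun)

definition times :: "'a \<Rightarrow> 'a \<Rightarrow> 'a" where
  "times a b = sep (pow (pow (un a b))) (\<lambda>p. \<exists>x. x \<epsilon> a \<and> (\<exists>y. y \<epsilon> b \<and> p = opair x y))"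

lemmas definability_sets = definability delta1_subset sigma1_fun_upair sigma1_fun_bigun sigma1_fun_pow sigma1_fun_opair sigma1_fun_un sigma1_fun_sep

lemma mem_times [simp]: "p \<epsilon> times a b \<longleftrightarrow> (\<exists>x. x \<epsilon> a \<and> (\<exists>y. y \<epsilon> b \<and> p = opair x y))"
  unfolding times_def
  by (subst mem_sep, rule delta1_sigma1, intro definability_sets) (auto simp: opair_def)

lemma sigma1_fun_times: "sigma1_fun r \<Longrightarrow> sigma1_fun s \<Longrightarrow> sigma1_fun (\<lambda>v. times (r v) (s v))"
proof (rule sigma1_fun_I2[where F = times])
  have "sigma1_fun (\<lambda>v. times (v 0) (v (Suc 0)))"
    unfolding times_def by (intro definability_sets)
  then show "sigma1 (\<lambda>v. v 0 = times (v (Suc 0)) (v (Suc (Suc 0))))"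
    unfolding sigma1_fun_def .
qed

text \<open>The value at \<open>z\<close> of a set \<open>f\<close> of pairs, as a total function of \<open>f\<close> and \<open>z\<close>.\<close>

definition val :: "'a \<Rightarrow> 'a \<Rightarrow> 'a" where
  "val f z = bigun (sep (bigun (bigun f)) (\<lambda>c. opair z c \<epsilon> f))"

lemma sigma1_fun_val: "sigma1_fun r \<Longrightarrow> sigma1_fun s \<Longrightarrow> sigma1_fun (\<lambda>v. val (r v) (s v))"
proof (rule sigma1_fun_I2[where F = val])
  have "sigma1_fun (\<lambda>v. val (v 0) (v (Suc 0)))"
    unfolding val_def by (intro definability_sets)
  then show "sigma1 (\<lambda>v. v 0 = val (v (Suc 0)) (v (Suc (Suc 0))))"
    unfolding sigma1_fun_def .
qed

lemma val_eq:
  assumes "\<And>c. opair z c \<epsilon> f \<longleftrightarrow> c = d"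
  shows "val f z = d"
proof (rule extensionality)
  fix w
  have "c \<epsilon> sep (bigun (bigun f)) (\<lambda>c. opair z c \<epsilon> f) \<longleftrightarrow> c = d" for c
  proof -
    have "d \<epsilon> upair z d" "upair z d \<epsilon> opair z d" "opair z d \<epsilon> f"
      using assms by (auto simp: opair_def)
    then have "d \<epsilon> bigun (bigun f)" by auto
    then show ?thesis
      by (subst mem_sep, intro delta1_sigma1 definability_sets) (use assms in auto)
  qed
  then show "w \<epsilon> val f z \<longleftrightarrow> w \<epsilon> d" unfolding val_def by auto
qed

lemma sigma1_fun_I3:
  assumes "sigma1_fun (\<lambda>v. F (v 0) (v (Suc 0)) (v (Suc (Suc 0))))" "sigma1_fun r" "sigma1_fun s" "sigma1_fun t"
  shows "sigma1_fun (\<lambda>v. F (r v) (s v) (t v))"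
  by (rule sigma1_fun_subst[OF assms(4), where s = "\<lambda>v y. F (r v) (s v) y"],
      rule sigma1_fun_subst[where t = "\<lambda>w. s (\<lambda>n. w (Suc n))" and s = "\<lambda>v x. F (r (\<lambda>n. v (Suc n))) x (v 0)"],
      simp add: sigma1_fun_rename assms,
      rule sigma1_fun_subst[where t = "\<lambda>w. r (\<lambda>n. w (Suc (Suc n)))" and s = "\<lambda>v x. F x (v 0) (v (Suc 0))"])
    (simp_all add: sigma1_fun_rename[where f = "\<lambda>n. Suc (Suc n)"] inj_def assms)

definition repl :: "'a \<Rightarrow> ('a \<Rightarrow> 'a) \<Rightarrow> 'a" where
  "repl a F = (THE b. \<forall>w. w \<epsilon> b \<longleftrightarrow> (\<exists>z. z \<epsilon> a \<and> w = F z))"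

lemma mem_repl_env:
  assumes "sigma1_fun (\<lambda>w. F (\<lambda>n. w (Suc n)) (w 0))"
  shows "w \<epsilon> repl a (F v) \<longleftrightarrow> (\<exists>z. z \<epsilon> a \<and> w = F v z)"
  unfolding repl_def
proof (rule the_set)
  define g :: "nat \<Rightarrow> nat" where "g n = (if n = 0 then 1 else if n = 1 then 0 else n)" for n
  have "inj g" by (auto simp: g_def inj_def)
  then have G: "sigma1 (\<lambda>w. w (Suc 0) = F (\<lambda>n. w (Suc (Suc n))) (w 0))"
    using sigma1_rename[OF assms[unfolded sigma1_fun_def], of g] by (simp add: g_def)
  from collection_env[OF G, of a v] obtain b where b: "\<And>c. c \<epsilon> a \<Longrightarrow> F v c \<epsilon> b" by auto
  have "sigma1 (\<lambda>u. \<exists>z. z \<epsilon> a \<and> u 0 = F (\<lambda>n. u (Suc n)) z)"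
    by (rule sigma1_bex[OF sigma1_fun_const G])
  from separation_env[OF this, of b v]
  obtain b' where b': "\<And>c. c \<epsilon> b' \<longleftrightarrow> c \<epsilon> b \<and> (\<exists>z. z \<epsilon> a \<and> c = F v z)" by auto
  have "w \<epsilon> b' \<longleftrightarrow> (\<exists>z. z \<epsilon> a \<and> w = F v z)" for w
    unfolding b' using b by blast
  then show "\<exists>b. \<forall>w. w \<epsilon> b \<longleftrightarrow> (\<exists>z. z \<epsilon> a \<and> w = F v z)" by blast
qed

lemma mem_repl: "sigma1_fun (\<lambda>v. F (v 0)) \<Longrightarrow> w \<epsilon> repl a F \<longleftrightarrow> (\<exists>z. z \<epsilon> a \<and> w = F z)"
  using mem_repl_env[of "\<lambda>v. F"] by simp

lemma sigma1_fun_repl: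
  assumes "sigma1_fun a" "sigma1_fun (\<lambda>w. F (\<lambda>n. w (Suc n)) (w 0))"
  shows "sigma1_fun (\<lambda>v. repl (a v) (F v))"
proof -
  define g :: "nat \<Rightarrow> nat" where "g n = (if n = 0 then 0 else Suc n)" for n
  have "inj g" by (auto simp: g_def inj_def)
  then have F: "sigma1_fun (\<lambda>u. F (\<lambda>n. u (Suc (Suc n))) (u 0))"
    using sigma1_fun_rename[OF assms(2), of g] by (simp add: g_def)
  define h :: "nat \<Rightarrow> nat" where "h n = (if n = 0 then 0 else Suc (Suc n))" for n
  have "inj h" by (auto simp: h_def inj_def)
  then have F2: "sigma1_fun (\<lambda>u. F (\<lambda>n. u (Suc (Suc (Suc n)))) (u 0))"
    using sigma1_fun_rename[OF assms(2), of h] by (simp add: h_def)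
  have "delta1 (\<lambda>w. (\<forall>x. x \<epsilon> w 0 \<longrightarrow> (\<exists>z. z \<epsilon> a (\<lambda>n. w (Suc n)) \<and> x = F (\<lambda>n. w (Suc n)) z)) \<and>
      (\<forall>z. z \<epsilon> a (\<lambda>n. w (Suc n)) \<longrightarrow> F (\<lambda>n. w (Suc n)) z \<epsilon> w 0))"
    by (intro definability F F2 sigma1_fun_rename[OF assms(1), of "\<lambda>n. Suc n"] sigma1_fun_rename[OF assms(1), of "\<lambda>n. Suc (Suc n)"])
      (auto simp: inj_def)
  then have "sigma1 (\<lambda>w. (\<forall>x. x \<epsilon> w 0 \<longrightarrow> (\<exists>z. z \<epsilon> a (\<lambda>n. w (Suc n)) \<and> x = F (\<lambda>n. w (Suc n)) z)) \<and>
      (\<forall>z. z \<epsilon> a (\<lambda>n. w (Suc n)) \<longrightarrow> F (\<lambda>n. w (Suc n)) z \<epsilon> w 0))"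
    by (rule delta1_sigma1)
  moreover have "(\<forall>x. x \<epsilon> y \<longrightarrow> (\<exists>z. z \<epsilon> b \<and> x = F v z)) \<and> (\<forall>z. z \<epsilon> b \<longrightarrow> F v z \<epsilon> y) \<longleftrightarrow> y = repl b (F v)"
    for y b v
  proof
    assume "(\<forall>x. x \<epsilon> y \<longrightarrow> (\<exists>z. z \<epsilon> b \<and> x = F v z)) \<and> (\<forall>z. z \<epsilon> b \<longrightarrow> F v z \<epsilon> y)"
    then show "y = repl b (F v)" by (intro extensionality) (unfold mem_repl_env[OF assms(2)], blast)
  qed (auto simp: mem_repl_env[OF assms(2)])
  ultimately show ?thesis unfolding sigma1_fun_def by simp
qed

section \<open>Recursion on membership\<close>

text \<open>\<open>H p x G\<close> is the value at \<open>x\<close> computed from the values \<open>G z\<close> for \<open>z \<epsilon> x\<close>, depending on a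
  parameter \<open>p\<close>. Definability is required when \<open>G\<close> is coded by a set.\<close>

definition recursor :: "('a \<Rightarrow> 'a \<Rightarrow> ('a \<Rightarrow> 'a) \<Rightarrow> 'a) \<Rightarrow> bool" where
  "recursor H \<longleftrightarrow> sigma1_fun (\<lambda>v. H (v 0) (v (Suc 0)) (val (v (Suc (Suc 0))))) \<and>
     (\<forall>p x G G'. (\<forall>z. z \<epsilon> x \<longrightarrow> G z = G' z) \<longrightarrow> H p x G = H p x G')"

definition recursive_on :: "('a \<Rightarrow> 'a \<Rightarrow> ('a \<Rightarrow> 'a) \<Rightarrow> 'a) \<Rightarrow> 'a \<Rightarrow> 'a \<Rightarrow> 'a \<Rightarrow> bool" where
  "recursive_on H p d f \<longleftrightarrow> (\<forall>y. y \<epsilon> d \<longrightarrow> (\<forall>z. z \<epsilon> y \<longrightarrow> z \<epsilon> d)) \<and>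
     (\<forall>y. y \<epsilon> d \<longrightarrow> val f y = H p y (val f))"

definition rec_graph :: "('a \<Rightarrow> 'a \<Rightarrow> ('a \<Rightarrow> 'a) \<Rightarrow> 'a) \<Rightarrow> 'a \<Rightarrow> 'a \<Rightarrow> 'a \<Rightarrow> bool" where
  "rec_graph H p x c \<longleftrightarrow> (\<exists>d f. recursive_on H p d f \<and> x \<epsilon> d \<and> c = val f x)"

definition rec :: "('a \<Rightarrow> 'a \<Rightarrow> ('a \<Rightarrow> 'a) \<Rightarrow> 'a) \<Rightarrow> 'a \<Rightarrow> 'a \<Rightarrow> 'a" where
  "rec H p x = (THE c. rec_graph H p x c)"

context
  fixes H
  assumes H: "recursor H"
begin

lemma recursor_cong: "(\<And>z. z \<epsilon> x \<Longrightarrow> G z = G' z) \<Longrightarrow> H p x G = H p x G'"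
  using H unfolding recursor_def by blast

lemma delta1_recursive_on:
  "sigma1_fun r \<Longrightarrow> sigma1_fun s \<Longrightarrow> sigma1_fun t \<Longrightarrow> delta1 (\<lambda>v. recursive_on H (r v) (s v) (t v))"
proof (rule delta1_subst3[where R = "recursive_on H"])
  have H': "sigma1_fun (\<lambda>v. H (v 0) (v (Suc 0)) (val (v (Suc (Suc 0)))))"
    using H unfolding recursor_def by blast
  show "delta1 (\<lambda>v. recursive_on H (v 0) (v (Suc 0)) (v (Suc (Suc 0))))"
    unfolding recursive_on_def
    by (intro definability sigma1_fun_val sigma1_fun_I3[OF H'])
qed

lemma recursive_on_unique:
  assumes "recursive_on H p d f" "recursive_on H p d' f'" "y \<epsilon> d" "y \<epsilon> d'"
  shows "val f y = val f' y"
proof -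
  have "y \<epsilon> d \<longrightarrow> y \<epsilon> d' \<longrightarrow> val f y = val f' y"
  proof (rule mem_induct_delta1[where P = "\<lambda>y. y \<epsilon> d \<longrightarrow> y \<epsilon> d' \<longrightarrow> val f y = val f' y"])
    show "delta1 (\<lambda>v. v 0 \<epsilon> d \<longrightarrow> v 0 \<epsilon> d' \<longrightarrow> val f (v 0) = val f' (v 0))"
      by (intro definability sigma1_fun_val)
    fix x assume IH: "\<And>y. y \<epsilon> x \<Longrightarrow> y \<epsilon> d \<longrightarrow> y \<epsilon> d' \<longrightarrow> val f y = val f' y"
    show "x \<epsilon> d \<longrightarrow> x \<epsilon> d' \<longrightarrow> val f x = val f' x"
    proof (intro impI)
      assume x: "x \<epsilon> d" "x \<epsilon> d'"
      have "H p x (val f) = H p x (val f')"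
        by (rule recursor_cong) (use assms(1,2) x IH in \<open>auto simp: recursive_on_def\<close>)
      then show "val f x = val f' x"
        using assms(1,2) x by (simp add: recursive_on_def)
    qed
  qed
  with assms(3,4) show ?thesis by blast
qed

lemma rec_graph_unique: "rec_graph H p x c \<Longrightarrow> rec_graph H p x c' \<Longrightarrow> c = c'"
  unfolding rec_graph_def using recursive_on_unique by blast

text \<open>By induction on \<open>x\<close>. Collection gathers domains of solutions for the elements of \<open>x\<close>; their
  union \<open>D\<close> is transitive, and the recursion has a value at each of its elements. These values
  form a function \<open>f\<close>, which one more pair extends to \<open>x\<close>.\<close>

lemma rec_graph_exists: "\<exists>c. rec_graph H p x c"
proof (rule mem_induct_sigma1[where P = "\<lambda>x. \<exists>c. rec_graph H p x c"])
  have graph: "sigma1 (\<lambda>v. rec_graph H p (v 0) (v (Suc 0)))"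
    unfolding rec_graph_def
    by (intro sigma1_ex delta1_sigma1 definability delta1_recursive_on sigma1_fun_val)
  then show "sigma1 (\<lambda>v. \<exists>c. rec_graph H p (v 0) c)"
    unfolding rec_graph_def
    by (intro sigma1_ex delta1_sigma1 definability delta1_recursive_on sigma1_fun_val)
  fix x assume IH: "\<And>y. y \<epsilon> x \<Longrightarrow> \<exists>c. rec_graph H p y c"
  let ?P = "\<lambda>z d. z \<epsilon> d \<and> (\<exists>f. recursive_on H p d f)"
  have "sigma1 (\<lambda>v. ?P (v 0) (v (Suc 0)))"
    by (intro sigma1_conj sigma1_ex delta1_sigma1 definability delta1_recursive_on)
  moreover have "\<exists>d. ?P z d" if "z \<epsilon> x" for z
    using IH[OF that] unfolding rec_graph_def by blast
  ultimately obtain b where b: "\<And>z. z \<epsilon> x \<Longrightarrow> \<exists>d. d \<epsilon> b \<and> ?P z d"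
    using collection[of ?P x] by blast
  have "sigma1 (\<lambda>v. \<exists>f. recursive_on H p (v 0) f)"
    by (intro sigma1_ex delta1_sigma1 delta1_recursive_on definability)
  then obtain b' where b': "\<And>d. d \<epsilon> b' \<longleftrightarrow> d \<epsilon> b \<and> (\<exists>f. recursive_on H p d f)"
    using separation[of "\<lambda>d. \<exists>f. recursive_on H p d f" b] by blast
  define D where "D = bigun b'"
  have D_trans: "z \<epsilon> D" if "y \<epsilon> D" "z \<epsilon> y" for y z
    using that unfolding D_def mem_bigun b' recursive_on_def by blast
  have xD: "z \<epsilon> D" if "z \<epsilon> x" for z
    using b[OF that] unfolding D_def mem_bigun b' by blast
  have cert: "\<exists>c. rec_graph H p y c" if "y \<epsilon> D" for y
    using that unfolding D_def mem_bigun b' rec_graph_def by blast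
  show "\<exists>c. rec_graph H p x c"
  proof (cases "x \<epsilon> D")
    case True
    then show ?thesis by (rule cert)
  next
    case False
    obtain C where C: "\<And>y. y \<epsilon> D \<Longrightarrow> \<exists>c. c \<epsilon> C \<and> rec_graph H p y c"
      using collection[OF graph cert] by blast
    have "sigma1 (\<lambda>v. \<exists>y. \<exists>c. v 0 = opair y c \<and> rec_graph H p y c)"
      unfolding rec_graph_def by (intro sigma1_ex sigma1_conj delta1_sigma1 definability delta1_recursive_on sigma1_fun_val sigma1_fun_opair)
    then obtain f where f: "\<And>q. q \<epsilon> f \<longleftrightarrow> q \<epsilon> times D C \<and> (\<exists>y. \<exists>c. q = opair y c \<and> rec_graph H p y c)"
      using separation[of "\<lambda>q. \<exists>y. \<exists>c. q = opair y c \<and> rec_graph H p y c" "times D C"] by blast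
    have f_pair: "opair y c \<epsilon> f \<longleftrightarrow> y \<epsilon> D \<and> rec_graph H p y c" for y c
      unfolding f using C rec_graph_unique by (auto, blast)
    define f' where "f' = un f (upair (opair x (H p x (val f))) (opair x (H p x (val f))))"
    have f'_pair: "opair y c \<epsilon> f' \<longleftrightarrow> y \<epsilon> D \<and> rec_graph H p y c \<or> y = x \<and> c = H p x (val f)" for y c
      unfolding f'_def by (simp add: f_pair)
    have val_f: "rec_graph H p y (val f y)" "val f' y = val f y" if y: "y \<epsilon> D" for y
    proof -
      obtain c where c: "rec_graph H p y c" using cert[OF y] by blast
      have "val f y = c" by (rule val_eq) (use f_pair y c rec_graph_unique in blast)
      moreover have "val f' y = c"
        by (rule val_eq) (use f'_pair y c rec_graph_unique False in blast)
      ultimately show "rec_graph H p y (val f y)" "val f' y = val f y" using c by simp_all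
    qed
    have val_x: "val f' x = H p x (val f)"
      by (rule val_eq) (use f'_pair False in blast)
    have "recursive_on H p (un D (upair x x)) f'"
      unfolding recursive_on_def
    proof (intro conjI allI impI)
      fix y z assume "y \<epsilon> un D (upair x x)" "z \<epsilon> y"
      then show "z \<epsilon> un D (upair x x)" using D_trans xD by auto
    next
      fix y assume "y \<epsilon> un D (upair x x)"
      then consider "y \<epsilon> D" | "y = x" by auto
      then show "val f' y = H p y (val f')"
      proof cases
        case 1
        obtain d g where g: "recursive_on H p d g" "y \<epsilon> d" "val f y = val g y"
          using val_f(1)[OF 1] unfolding rec_graph_def by blast
        have "val g z = val f' z" if "z \<epsilon> y" for z
        proof -
          have "z \<epsilon> d" "z \<epsilon> D" using g(1,2) D_trans[OF 1] that unfolding recursive_on_def by blast+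
          moreover have "rec_graph H p z (val g z)"
            using g(1) \<open>z \<epsilon> d\<close> unfolding rec_graph_def by blast
          ultimately show ?thesis
            using val_f[of z] rec_graph_unique by metis
        qed
        then have "H p y (val g) = H p y (val f')" by (rule recursor_cong)
        then show ?thesis using val_f(2)[OF 1] g unfolding recursive_on_def by simp
      next
        case 2
        have "H p x (val f) = H p x (val f')"
          by (rule recursor_cong) (use val_f(2) xD in simp)
        with 2 val_x show ?thesis by simp
      qed
    qed
    then show ?thesis unfolding rec_graph_def by auto
  qed
qed

lemma rec_graph_iff: "rec_graph H p x c \<longleftrightarrow> c = rec H p x"
  unfolding rec_def using rec_graph_exists rec_graph_unique by (metis the_equality)

lemma rec_eq: "rec H p x = H p x (rec H p)"
proof -
  obtain d f where f: "recursive_on H p d f" "x \<epsilon> d" "rec H p x = val f x"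
    using rec_graph_iff[of p x "rec H p x"] unfolding rec_graph_def by blast
  have "val f z = rec H p z" if "z \<epsilon> x" for z
    using f that unfolding rec_graph_iff[symmetric] rec_graph_def recursive_on_def by blast
  then have "H p x (val f) = H p x (rec H p)" by (rule recursor_cong)
  then show ?thesis using f unfolding recursive_on_def by simp
qed

lemma sigma1_fun_rec: "sigma1_fun r \<Longrightarrow> sigma1_fun s \<Longrightarrow> sigma1_fun (\<lambda>v. rec H (r v) (s v))"
proof (rule sigma1_fun_I2[where F = "rec H"])
  show "sigma1 (\<lambda>v. v 0 = rec H (v (Suc 0)) (v (Suc (Suc 0))))"
    unfolding rec_graph_iff[symmetric] rec_graph_def
    by (intro sigma1_ex delta1_sigma1 definability delta1_recursive_on sigma1_fun_val)
qed

end

section \<open>Ordinals\<close>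

lemma mem_irrefl: "\<not> x \<epsilon> x"
  by (rule mem_induct_delta1[where P = "\<lambda>x. \<not> x \<epsilon> x"]) (intro definability, blast)

definition transitive :: "'a \<Rightarrow> bool" where
  "transitive x \<longleftrightarrow> (\<forall>y. y \<epsilon> x \<longrightarrow> (\<forall>z. z \<epsilon> y \<longrightarrow> z \<epsilon> x))"

definition Ord :: "'a \<Rightarrow> bool" where
  "Ord x \<longleftrightarrow> transitive x \<and> (\<forall>y. y \<epsilon> x \<longrightarrow> transitive y)"

lemma delta1_Ord: "sigma1_fun r \<Longrightarrow> delta1 (\<lambda>v. Ord (r v))"
proof (rule delta1_subst1[where R = Ord])
  show "delta1 (\<lambda>v. Ord (v 0))"
    unfolding Ord_def transitive_def by (intro definability)
qed

lemma Ords_M: "x \<in> Ords M \<longleftrightarrow> Ord x"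
proof -
  have "trans_in M d \<longleftrightarrow> transitive d" for d
    unfolding trans_in_def transitive_def M_simps by blast
  then show ?thesis unfolding Ords_def Ord_def M_simps by simp
qed

lemma Ord_mem: "Ord x \<Longrightarrow> y \<epsilon> x \<Longrightarrow> Ord y"
  unfolding Ord_def transitive_def by blast

lemma Ord_trans: "Ord x \<Longrightarrow> y \<epsilon> x \<Longrightarrow> z \<epsilon> y \<Longrightarrow> z \<epsilon> x"
  unfolding Ord_def transitive_def by blast

text \<open>Otherwise take a minimal \<open>a\<close> that is incomparable with some ordinal, and then a minimal \<open>b\<close>
  incomparable with \<open>a\<close>. Both have the same elements.\<close>

lemma Ord_linear:
  assumes "Ord x" "Ord y"
  shows "x \<epsilon> y \<or> x = y \<or> y \<epsilon> x"
proof (rule ccontr)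
  let ?c = "\<lambda>x y. x \<epsilon> y \<or> x = y \<or> y \<epsilon> x"
  let ?P = "\<lambda>x. Ord x \<and> (\<exists>y. Ord y \<and> \<not> ?c x y)"
  assume "\<not> ?c x y"
  then have "?P x" using assms by blast
  moreover have "sigma1 (\<lambda>v. ?P (v 0))"
    by (intro sigma1_ex sigma1_conj delta1_sigma1 definability delta1_Ord)
  ultimately obtain a where a: "?P a" "\<And>y. y \<epsilon> a \<Longrightarrow> \<not> ?P y"
    using foundation_sigma1[of ?P x] by blast
  let ?Q = "\<lambda>y. Ord y \<and> \<not> ?c a y"
  have "sigma1 (\<lambda>v. ?Q (v 0))"
    by (intro delta1_sigma1 definability delta1_Ord)
  moreover obtain b0 where "?Q b0" using a(1) by blast
  ultimately obtain b where b: "?Q b" "\<And>y. y \<epsilon> b \<Longrightarrow> \<not> ?Q y"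
    using foundation_sigma1[of ?Q b0] by blast
  have "a = b"
  proof (rule extensionality)
    fix z
    show "z \<epsilon> a \<longleftrightarrow> z \<epsilon> b"
    proof
      assume z: "z \<epsilon> a"
      then have "Ord z" using a(1) Ord_mem by blast
      then have "?c z b" using a(2)[OF z] b(1) by blast
      then show "z \<epsilon> b" using z a(1) b(1) Ord_trans by blast
    next
      assume z: "z \<epsilon> b"
      then have "Ord z" using b(1) Ord_mem by blast
      then have "?c a z" using b(2)[OF z] by blast
      then show "z \<epsilon> a" using z a(1) b(1) Ord_trans by blast
    qed
  qed
  then show False using b(1) by blast
qed

lemma Ord_subset: "Ord x \<Longrightarrow> Ord y \<Longrightarrow> (\<And>z. z \<epsilon> x \<Longrightarrow> z \<epsilon> y) \<Longrightarrow> x = y \<or> x \<epsilon> y"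
  using Ord_linear mem_irrefl by blast

definition suc :: "'a \<Rightarrow> 'a" where
  "suc x = un x (upair x x)"

lemma mem_suc [simp]: "y \<epsilon> suc x \<longleftrightarrow> y \<epsilon> x \<or> y = x"
  unfolding suc_def by simp

lemma Ord_suc: "Ord x \<Longrightarrow> Ord (suc x)"
  unfolding Ord_def transitive_def mem_suc by blast

section \<open>Rank and the cumulative hierarchy\<close>

lemma repl_cong: "(\<And>z. z \<epsilon> a \<Longrightarrow> F z = G z) \<Longrightarrow> repl a F = repl a G"
  unfolding repl_def by (metis (no_types, lifting))

definition rank_step :: "'a \<Rightarrow> 'a \<Rightarrow> ('a \<Rightarrow> 'a) \<Rightarrow> 'a" where
  "rank_step p x G = bigun (repl x (\<lambda>z. suc (G z)))"

definition rk :: "'a \<Rightarrow> 'a" where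
  "rk x = rec rank_step undefined x"

lemma sigma1_fun_suc: "sigma1_fun r \<Longrightarrow> sigma1_fun (\<lambda>v. suc (r v))"
  unfolding suc_def by (intro sigma1_fun_un sigma1_fun_upair)

lemma recursor_rank_step: "recursor rank_step"
  unfolding recursor_def rank_step_def
proof (intro conjI allI impI)
  show "sigma1_fun (\<lambda>v. bigun (repl (v (Suc 0)) (\<lambda>z. suc (val (v (Suc (Suc 0))) z))))"
    by (intro sigma1_fun_bigun sigma1_fun_repl sigma1_fun_suc sigma1_fun_val definability)
next
  fix x and G G' :: "'a \<Rightarrow> 'a" assume "\<forall>z. z \<epsilon> x \<longrightarrow> G z = G' z"
  then have "repl x (\<lambda>z. suc (G z)) = repl x (\<lambda>z. suc (G' z))" by (intro repl_cong) simp
  then show "bigun (repl x (\<lambda>z. suc (G z))) = bigun (repl x (\<lambda>z. suc (G' z)))" by simp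
qed

lemma sigma1_fun_rk: "sigma1_fun r \<Longrightarrow> sigma1_fun (\<lambda>v. rk (r v))"
  unfolding rk_def by (intro sigma1_fun_rec[OF recursor_rank_step] sigma1_fun_const)

lemma mem_rk: "w \<epsilon> rk x \<longleftrightarrow> (\<exists>z. z \<epsilon> x \<and> (w \<epsilon> rk z \<or> w = rk z))"
proof -
  have "rk x = bigun (repl x (\<lambda>z. suc (rk z)))"
    using rec_eq[OF recursor_rank_step, of undefined x] by (simp add: rank_step_def rk_def)
  moreover have "w \<epsilon> repl x (\<lambda>z. suc (rk z)) \<longleftrightarrow> (\<exists>z. z \<epsilon> x \<and> w = suc (rk z))" for w
    by (rule mem_repl) (intro sigma1_fun_suc sigma1_fun_rk sigma1_fun_var)
  ultimately show ?thesis by auto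
qed

lemma rk_mem: "y \<epsilon> x \<Longrightarrow> rk y \<epsilon> rk x"
  by (subst mem_rk) blast

lemma Ord_rk: "Ord (rk x)"
proof (rule mem_induct_delta1[where P = "\<lambda>x. Ord (rk x)"])
  show "delta1 (\<lambda>v. Ord (rk (v 0)))" by (intro delta1_Ord sigma1_fun_rk sigma1_fun_var)
  fix x assume IH: "\<And>y. y \<epsilon> x \<Longrightarrow> Ord (rk y)"
  show "Ord (rk x)"
    unfolding Ord_def transitive_def
  proof (intro conjI allI impI)
    fix y z assume "y \<epsilon> rk x" "z \<epsilon> y"
    then show "z \<epsilon> rk x" using IH Ord_trans unfolding mem_rk[of _ x] by blast
  next
    fix y z w assume "y \<epsilon> rk x" "z \<epsilon> y" "w \<epsilon> z"
    then show "w \<epsilon> y" using IH Ord_mem Ord_trans unfolding mem_rk[of _ x] by blast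
  qed
qed

lemma rk_Ord: "Ord x \<Longrightarrow> rk x = x"
proof -
  have "Ord x \<longrightarrow> rk x = x"
  proof (rule mem_induct_delta1[where P = "\<lambda>x. Ord x \<longrightarrow> rk x = x"])
    show "delta1 (\<lambda>v. Ord (v 0) \<longrightarrow> rk (v 0) = v 0)" by (intro definability delta1_Ord sigma1_fun_rk)
    fix x assume IH: "\<And>y. y \<epsilon> x \<Longrightarrow> Ord y \<longrightarrow> rk y = y"
    show "Ord x \<longrightarrow> rk x = x"
    proof
      assume x: "Ord x"
      then have "rk y = y" if "y \<epsilon> x" for y using IH that Ord_mem by blast
      then have "w \<epsilon> rk x \<longleftrightarrow> (\<exists>z. z \<epsilon> x \<and> (w \<epsilon> z \<or> w = z))" for w
        unfolding mem_rk[of w x] by auto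
      then show "rk x = x" using Ord_trans[OF x] by (intro extensionality) blast
    qed
  qed
  then show "Ord x \<Longrightarrow> rk x = x" by blast
qed

lemma rk_rk [simp]: "rk (rk x) = rk x"
  by (rule rk_Ord[OF Ord_rk])

definition hier_step :: "'a \<Rightarrow> 'a \<Rightarrow> ('a \<Rightarrow> 'a) \<Rightarrow> 'a" where
  "hier_step p x G = bigun (repl x (\<lambda>z. pow (G z)))"

definition V :: "'a \<Rightarrow> 'a" where
  "V x = rec hier_step undefined x"

lemma recursor_hier_step: "recursor hier_step"
  unfolding recursor_def hier_step_def
proof (intro conjI allI impI)
  show "sigma1_fun (\<lambda>v. bigun (repl (v (Suc 0)) (\<lambda>z. pow (val (v (Suc (Suc 0))) z))))"
    by (intro sigma1_fun_bigun sigma1_fun_repl sigma1_fun_pow sigma1_fun_val definability)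
next
  fix x and G G' :: "'a \<Rightarrow> 'a" assume "\<forall>z. z \<epsilon> x \<longrightarrow> G z = G' z"
  then have "repl x (\<lambda>z. pow (G z)) = repl x (\<lambda>z. pow (G' z))" by (intro repl_cong) simp
  then show "bigun (repl x (\<lambda>z. pow (G z))) = bigun (repl x (\<lambda>z. pow (G' z)))" by simp
qed

lemma sigma1_fun_V: "sigma1_fun r \<Longrightarrow> sigma1_fun (\<lambda>v. V (r v))"
  unfolding V_def by (intro sigma1_fun_rec[OF recursor_hier_step] sigma1_fun_const)

lemma mem_V: "w \<epsilon> V x \<longleftrightarrow> (\<exists>z. z \<epsilon> x \<and> (\<forall>u. u \<epsilon> w \<longrightarrow> u \<epsilon> V z))"
proof -
  have "V x = bigun (repl x (\<lambda>z. pow (V z)))"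
    using rec_eq[OF recursor_hier_step, of undefined x] by (simp add: hier_step_def V_def)
  moreover have "w \<epsilon> repl x (\<lambda>z. pow (V z)) \<longleftrightarrow> (\<exists>z. z \<epsilon> x \<and> w = pow (V z))" for w
    by (rule mem_repl) (intro sigma1_fun_pow sigma1_fun_V sigma1_fun_var)
  ultimately show ?thesis by auto
qed

text \<open>The hierarchy is defined by \<open>V x = \<Union>{\<P> (V z) | z \<in> x}\<close>, so both directions follow by induction
  on \<open>x\<close>, for all ordinals \<open>a\<close> at once.\<close>

lemma mem_V_rk: "Ord a \<Longrightarrow> x \<epsilon> V a \<longleftrightarrow> rk x \<epsilon> a"
proof -
  have "\<forall>a. Ord a \<longrightarrow> (x \<epsilon> V a \<longleftrightarrow> rk x \<epsilon> a)"
  proof (rule mem_induct_pi1[where P = "\<lambda>x. \<forall>a. Ord a \<longrightarrow> (x \<epsilon> V a \<longleftrightarrow> rk x \<epsilon> a)"])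
    have "sigma1 (\<lambda>v. \<exists>a. \<not> (Ord a \<longrightarrow> (v 0 \<epsilon> V a \<longleftrightarrow> rk (v 0) \<epsilon> a)))"
      by (intro sigma1_ex delta1_sigma1 definability delta1_Ord sigma1_fun_V sigma1_fun_rk)
    then show "sigma1 (\<lambda>v. \<not> (\<forall>a. Ord a \<longrightarrow> (v 0 \<epsilon> V a \<longleftrightarrow> rk (v 0) \<epsilon> a)))"
      by simp
    fix x assume IH: "\<And>y. y \<epsilon> x \<Longrightarrow> \<forall>a. Ord a \<longrightarrow> (y \<epsilon> V a \<longleftrightarrow> rk y \<epsilon> a)"
    show "\<forall>a. Ord a \<longrightarrow> (x \<epsilon> V a \<longleftrightarrow> rk x \<epsilon> a)"
    proof (intro allI impI iffI)
      fix a assume a: "Ord a" "x \<epsilon> V a"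
      then obtain b where b: "b \<epsilon> a" "\<And>u. u \<epsilon> x \<Longrightarrow> u \<epsilon> V b" unfolding mem_V[of x a] by blast
      have "Ord b" using Ord_mem a(1) b(1) by blast
      then have "w \<epsilon> b" if "w \<epsilon> rk x" for w
        using that IH b(2) Ord_trans[of b] unfolding mem_rk[of w x] by blast
      then have "rk x = b \<or> rk x \<epsilon> b" using Ord_subset[OF Ord_rk \<open>Ord b\<close>] by blast
      then show "rk x \<epsilon> a" using b(1) Ord_trans[OF a(1)] by blast
    next
      fix a assume a: "Ord a" "rk x \<epsilon> a"
      have "u \<epsilon> V (rk x)" if "u \<epsilon> x" for u using IH[OF that] Ord_rk rk_mem[OF that] by blast
      then show "x \<epsilon> V a" using a(2) unfolding mem_V[of x a] by blast
    qed
  qed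
  then show "Ord a \<Longrightarrow> x \<epsilon> V a \<longleftrightarrow> rk x \<epsilon> a" by blast
qed

lemma V_I: "a \<epsilon> b \<Longrightarrow> (\<And>u. u \<epsilon> x \<Longrightarrow> u \<epsilon> V a) \<Longrightarrow> x \<epsilon> V b"
  unfolding mem_V[of x b] by blast

lemma V_trans: "Ord a \<Longrightarrow> x \<epsilon> V a \<Longrightarrow> y \<epsilon> x \<Longrightarrow> y \<epsilon> V a"
  using mem_V_rk rk_mem Ord_trans by blast

lemma rk_V: "Ord a \<Longrightarrow> rk (V a) = a"
proof (rule extensionality)
  fix w assume a: "Ord a"
  show "w \<epsilon> rk (V a) \<longleftrightarrow> w \<epsilon> a"
  proof
    assume "w \<epsilon> rk (V a)"
    then show "w \<epsilon> a" unfolding mem_rk[of w "V a"] using mem_V_rk[OF a] Ord_trans[OF a] by blast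
  next
    assume w: "w \<epsilon> a"
    then have "rk w = w" using a Ord_mem rk_Ord by blast
    then show "w \<epsilon> rk (V a)" using w mem_V_rk[OF a, of w] rk_mem[of w "V a"] by simp
  qed
qed

lemma V_mem_V: "Ord a \<Longrightarrow> Ord b \<Longrightarrow> V a \<epsilon> V b \<longleftrightarrow> a \<epsilon> b"
  by (simp add: mem_V_rk rk_V)

definition level :: "'a \<Rightarrow> bool" where
  "level x \<longleftrightarrow> (\<exists>a. Ord a \<and> x = V a)"

lemma level_iff: "level x \<longleftrightarrow> x = V (rk x)"
  unfolding level_def using rk_V Ord_rk by metis

lemma delta1_level: "sigma1_fun r \<Longrightarrow> delta1 (\<lambda>v. level (r v))"
  unfolding level_iff by (intro definability sigma1_fun_V sigma1_fun_rk)

lemma level_trans: "level x \<Longrightarrow> y \<epsilon> x \<Longrightarrow> z \<epsilon> y \<Longrightarrow> z \<epsilon> x"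
  unfolding level_def using V_trans by blast

lemma ex_level: "\<exists>y. level y \<and> x \<epsilon> y"
proof -
  have "x \<epsilon> V (suc (rk x))" using mem_V_rk[of "suc (rk x)" x] Ord_suc[OF Ord_rk] by simp
  then show ?thesis unfolding level_def using Ord_suc[OF Ord_rk] by blast
qed

lemma opair_in_iff [simp]: "opair_in M x y p \<longleftrightarrow> p = opair x y"
proof -
  have up: "upair_in M x y p \<longleftrightarrow> p = upair x y" for x y p
    unfolding upair_in_def using extensionality[of p "upair x y"] by auto
  show ?thesis unfolding opair_in_def opair_def by (simp add: up)
qed

lemma app_in_iff [simp]: "app_in M f x y \<longleftrightarrow> opair x y \<epsilon> f"
  unfolding app_in_def by simp

text \<open>A function as in the definition of \<open>is_rank\<close> agrees with \<open>rk\<close> on its domain, by induction.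
  Conversely the restriction of \<open>rk\<close> to a level is such a function.\<close>

lemma is_rank_iff: "is_rank M x a \<longleftrightarrow> a = rk x"
proof
  assume "is_rank M x a"
  then obtain d f where raw: "trans_in M d" "x \<epsilon> d" "opair x a \<epsilon> f" "function_on_in M f d"
    "\<forall>y\<in>UNIV. \<forall>b\<in>UNIV. y \<epsilon> d \<longrightarrow> opair y b \<epsilon> f \<longrightarrow>
      (\<forall>w\<in>UNIV. w \<epsilon> b \<longleftrightarrow> (\<exists>z\<in>UNIV. \<exists>c\<in>UNIV. z \<epsilon> y \<and> opair z c \<epsilon> f \<and> (w \<epsilon> c \<or> w = c)))"
    unfolding is_rank_def M_simps app_in_iff by (elim bexE conjE) (rule that)
  have d: "\<And>y z. z \<epsilon> y \<Longrightarrow> y \<epsilon> d \<Longrightarrow> z \<epsilon> d" "x \<epsilon> d" "opair x a \<epsilon> f"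
    using raw(1-3) unfolding trans_in_def M_simps by blast+
  have fn: "\<exists>!y. opair x y \<epsilon> f" if "x \<epsilon> d" for x
    using raw(4) that unfolding function_on_in_def by simp
  have eq: "w \<epsilon> b \<longleftrightarrow> (\<exists>z c. z \<epsilon> y \<and> opair z c \<epsilon> f \<and> (w \<epsilon> c \<or> w = c))"
    if "y \<epsilon> d" "opair y b \<epsilon> f" for y b w
    using raw(5)[THEN bspec[OF _ UNIV_I], THEN bspec[OF _ UNIV_I], THEN mp, THEN mp, OF that,
        THEN bspec[OF _ UNIV_I], of w] unfolding bex_UNIV .
  have "y \<epsilon> d \<longrightarrow> opair y (rk y) \<epsilon> f" for y
  proof (rule mem_induct_delta1[where P = "\<lambda>y. y \<epsilon> d \<longrightarrow> opair y (rk y) \<epsilon> f"])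
    show "delta1 (\<lambda>v. v 0 \<epsilon> d \<longrightarrow> opair (v 0) (rk (v 0)) \<epsilon> f)" by (intro definability sigma1_fun_rk sigma1_fun_opair)
    fix y assume IH: "\<And>z. z \<epsilon> y \<Longrightarrow> z \<epsilon> d \<longrightarrow> opair z (rk z) \<epsilon> f"
    show "y \<epsilon> d \<longrightarrow> opair y (rk y) \<epsilon> f"
    proof
      assume y: "y \<epsilon> d"
      then obtain b where b: "opair y b \<epsilon> f" using fn by blast
      have "opair z c \<epsilon> f \<longleftrightarrow> c = rk z" if "z \<epsilon> y" for z c
        using IH[OF that] d(1)[OF that y] fn by blast
      then have "b = rk y"
        using eq[OF y b] by (intro extensionality) (auto simp: mem_rk[of _ y])
      with b show "opair y (rk y) \<epsilon> f" by simp
    qed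
  qed
  then show "a = rk x" using d fn by blast
next
  assume a: "a = rk x"
  obtain b where b: "level b" "x \<epsilon> b" using ex_level by blast
  define f where "f = repl b (\<lambda>y. opair y (rk y))"
  have f: "opair y c \<epsilon> f \<longleftrightarrow> y \<epsilon> b \<and> c = rk y" for y c
    unfolding f_def by (subst mem_repl) (intro sigma1_fun_opair sigma1_fun_rk sigma1_fun_var, auto)
  have f': "p \<epsilon> f \<Longrightarrow> \<exists>y c. y \<epsilon> b \<and> p = opair y c" for p
    unfolding f_def by (subst (asm) mem_repl) (intro sigma1_fun_opair sigma1_fun_rk sigma1_fun_var, auto)
  have eq: "w \<epsilon> rk y \<longleftrightarrow> (\<exists>z c. z \<epsilon> y \<and> (z \<epsilon> b \<and> c = rk z) \<and> (w \<epsilon> c \<or> w = c))" if "y \<epsilon> b" for y w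
    using level_trans[OF b(1) that] unfolding mem_rk[of w y] by blast
  show "is_rank M x a"
    unfolding is_rank_def function_on_in_def trans_in_def M_simps app_in_iff opair_in_iff
  proof (rule bexI[of _ b, OF _ UNIV_I], rule bexI[of _ f, OF _ UNIV_I], unfold f, intro conjI ballI impI)
    show "x \<epsilon> b" "x \<epsilon> b" by (fact b(2))+
    show "a = rk x" by (fact a)
    show "z \<epsilon> b" if "z \<epsilon> y" "y \<epsilon> b" for y z using level_trans[OF b(1)] that by blast
    show "\<exists>x\<in>UNIV. \<exists>y\<in>UNIV. x \<epsilon> b \<and> p = opair x y" if "p \<epsilon> f" for p
      using f'[OF that] by blast
    show "\<exists>!c. c \<in> UNIV \<and> y \<epsilon> b \<and> c = rk y" if "y \<epsilon> b" for y using that by blast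
    show "w \<epsilon> c \<longleftrightarrow> (\<exists>z\<in>UNIV. \<exists>d\<in>UNIV. z \<epsilon> y \<and> (z \<epsilon> b \<and> d = rk z) \<and> (w \<epsilon> d \<or> w = d))"
      if "y \<epsilon> b" "y \<epsilon> b \<and> c = rk y" for y c w
      using eq[OF that(1), of w] that(2) by simp
  qed
qed

section \<open>Types of tuples\<close>

text \<open>The sets \<open>zero\<close>, \<open>one\<close> and \<open>two\<close> tag the three kinds of elements of a type.\<close>

definition zero :: 'a where "zero = sep undefined (\<lambda>w. w \<noteq> w)"

lemma mem_zero [simp]: "\<not> w \<epsilon> zero"
  unfolding zero_def by (subst mem_sep) (intro delta1_sigma1 definability, simp)

definition sing :: "'a \<Rightarrow> 'a" where "sing x = upair x x"

lemma mem_sing [simp]: "y \<epsilon> sing x \<longleftrightarrow> y = x"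
  unfolding sing_def by simp

lemma sigma1_fun_sing: "sigma1_fun r \<Longrightarrow> sigma1_fun (\<lambda>v. sing (r v))"
  unfolding sing_def by (intro sigma1_fun_upair)

definition one :: 'a where "one = sing zero"
definition two :: 'a where "two = sing one"

lemma tags_distinct: "zero \<noteq> one" "zero \<noteq> two" "one \<noteq> two"
proof -
  have "zero \<epsilon> one" "one \<epsilon> two" by (simp_all add: one_def two_def)
  then show "zero \<noteq> one" "zero \<noteq> two" "one \<noteq> two" using mem_zero mem_irrefl by metis+
qed

lemmas tags_distinct_simps [simp] = tags_distinct tags_distinct[symmetric]

definition put :: "'a \<Rightarrow> 'a \<Rightarrow> 'a \<Rightarrow> 'a" where
  "put f j m = un f (sing (opair j m))"

lemma mem_put [simp]: "p \<epsilon> put f j m \<longleftrightarrow> p \<epsilon> f \<or> p = opair j m"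
  unfolding put_def by simp

lemma sigma1_fun_put: "sigma1_fun r \<Longrightarrow> sigma1_fun s \<Longrightarrow> sigma1_fun t \<Longrightarrow> sigma1_fun (\<lambda>v. put (r v) (s v) (t v))"
  unfolding put_def by (intro sigma1_fun_un sigma1_fun_sing sigma1_fun_opair)

text \<open>A tuple is a set \<open>f\<close> of pairs of a label and an entry; \<open>G \<eta>\<close> codes the function from tuples to their
  types at \<open>\<eta>\<close>. The first clause records membership between entries; as no set is an element of
  itself, the codes with \<open>i = j\<close> are free to record which entries are levels. The second clause
  records the entries themselves, as far as they are small enough, and the third one the types
  at \<open>\<eta>\<close> of the tuples with one more entry \<open>m\<close>. Everything is cut down to \<open>V \<xi>\<close>: so
  there are at most as many types at \<open>\<xi>\<close> as subsets of \<open>V \<xi>\<close>, independently of \<open>X\<close>.\<close>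

definition type_set :: "'a \<Rightarrow> 'a \<Rightarrow> ('a \<Rightarrow> 'a) \<Rightarrow> 'a \<Rightarrow> 'a \<Rightarrow> 'a" where
  "type_set \<zeta> X G \<xi> f = sep (V \<xi>) (\<lambda>y.
     (\<exists>i. i \<epsilon> \<zeta> \<and> (\<exists>j. j \<epsilon> \<zeta> \<and> (\<exists>a. a \<epsilon> X \<and> (\<exists>b. b \<epsilon> X \<and>
        y = opair zero (opair i j) \<and> opair i a \<epsilon> f \<and> opair j b \<epsilon> f \<and> (a \<epsilon> b \<or> i = j \<and> level a))))) \<or>
     (\<exists>z. z \<epsilon> f \<and> y = opair one z) \<or>
     (\<exists>\<eta>. \<eta> \<epsilon> \<xi> \<and> (\<exists>j. j \<epsilon> \<zeta> \<and> (\<exists>m. m \<epsilon> X \<and>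
        y = opair two (opair j (opair \<eta> (val (G \<eta>) (put f j m))))))))"

text \<open>The recursion is on \<open>\<xi>\<close> alone. Its values are functions on the set of all tuples, because the
  type of a tuple depends on the types of other tuples.\<close>

definition type_step :: "'a \<Rightarrow> 'a \<Rightarrow> 'a \<Rightarrow> ('a \<Rightarrow> 'a) \<Rightarrow> 'a" where
  "type_step \<zeta> X \<xi> G = repl (pow (times \<zeta> X)) (\<lambda>f. opair f (type_set \<zeta> X G \<xi> f))"

lemmas definability_more =
  definability delta1_subset sigma1_fun_upair sigma1_fun_bigun sigma1_fun_pow sigma1_fun_opair sigma1_fun_un sigma1_fun_sep sigma1_fun_repl sigma1_fun_val sigma1_fun_times sigma1_fun_V sigma1_fun_rk
  delta1_level delta1_Ord sigma1_fun_put sigma1_fun_suc sigma1_fun_sing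

lemma sigma1_fun_type_step: "sigma1_fun (\<lambda>v. type_step \<zeta> (v 0) (v (Suc 0)) (val (v (Suc (Suc 0)))))"
  unfolding type_step_def type_set_def by (intro definability_more)

lemma recursor_type_step: "recursor (type_step \<zeta>)"
  unfolding recursor_def
proof (intro conjI allI impI)
  show "sigma1_fun (\<lambda>v. type_step \<zeta> (v 0) (v (Suc 0)) (val (v (Suc (Suc 0)))))" by (rule sigma1_fun_type_step)
  fix X \<xi> and G G' :: "'a \<Rightarrow> 'a" assume G: "\<forall>z. z \<epsilon> \<xi> \<longrightarrow> G z = G' z"
  have "type_set \<zeta> X G \<xi> f = type_set \<zeta> X G' \<xi> f" for f
    unfolding type_set_def by (rule arg_cong[where f = "sep (V \<xi>)"]) (use G in \<open>auto simp: fun_eq_iff\<close>)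
  then show "type_step \<zeta> X \<xi> G = type_step \<zeta> X \<xi> G'" unfolding type_step_def by simp
qed

text \<open>The type at \<open>\<xi>\<close> of the tuple \<open>f\<close> in \<open>X\<close>, where the labels are elements of \<open>\<zeta>\<close>.\<close>

definition tp :: "'a \<Rightarrow> 'a \<Rightarrow> 'a \<Rightarrow> 'a \<Rightarrow> 'a" where
  "tp \<zeta> X \<xi> f = val (rec (type_step \<zeta>) X \<xi>) f"

lemma sigma1_fun_tp: "sigma1_fun r \<Longrightarrow> sigma1_fun s \<Longrightarrow> sigma1_fun t \<Longrightarrow> sigma1_fun (\<lambda>v. tp \<zeta> (r v) (s v) (t v))"
  unfolding tp_def by (intro sigma1_fun_val sigma1_fun_rec[OF recursor_type_step])

lemma mem_tp:
  assumes f: "f \<epsilon> pow (times \<zeta> X)"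
  shows "y \<epsilon> tp \<zeta> X \<xi> f \<longleftrightarrow> y \<epsilon> V \<xi> \<and>
    ((\<exists>i. i \<epsilon> \<zeta> \<and> (\<exists>j. j \<epsilon> \<zeta> \<and> (\<exists>a. a \<epsilon> X \<and> (\<exists>b. b \<epsilon> X \<and>
        y = opair zero (opair i j) \<and> opair i a \<epsilon> f \<and> opair j b \<epsilon> f \<and> (a \<epsilon> b \<or> i = j \<and> level a))))) \<or>
     (\<exists>z. z \<epsilon> f \<and> y = opair one z) \<or>
     (\<exists>\<eta>. \<eta> \<epsilon> \<xi> \<and> (\<exists>j. j \<epsilon> \<zeta> \<and> (\<exists>m. m \<epsilon> X \<and>
        y = opair two (opair j (opair \<eta> (tp \<zeta> X \<eta> (put f j m))))))))"
proof -
  let ?G = "rec (type_step \<zeta>) X"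
  have "opair f c \<epsilon> ?G \<xi> \<longleftrightarrow> c = type_set \<zeta> X ?G \<xi> f" for c
  proof -
    have "sigma1_fun (\<lambda>v. opair (v 0) (type_set \<zeta> X ?G \<xi> (v 0)))"
      unfolding type_set_def by (intro definability_more sigma1_fun_rec[OF recursor_type_step])
    then show ?thesis
      unfolding rec_eq[OF recursor_type_step, of \<zeta> X \<xi>] type_step_def
      by (subst mem_repl) (use f in auto)
  qed
  then have eq: "tp \<zeta> X \<xi> f = type_set \<zeta> X ?G \<xi> f"
    unfolding tp_def by (rule val_eq)
  show ?thesis
    unfolding eq unfolding type_set_def tp_def
    by (rule mem_sep, intro delta1_sigma1 definability_more sigma1_fun_rec[OF recursor_type_step])
qed

lemma tp_subset: "f \<epsilon> pow (times \<zeta> X) \<Longrightarrow> y \<epsilon> tp \<zeta> X \<xi> f \<Longrightarrow> y \<epsilon> V \<xi>"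
  by (simp only: mem_tp)

end

section \<open>Back and forth above a cut\<close>

text \<open>The properties of the carrier of a rank-initial topless substructure.\<close>

locale cut = set_theory +
  fixes S :: "'a set"
  assumes S_nonempty: "\<exists>s. s \<in> S"
    and S_initial: "s \<in> S \<Longrightarrow> rk n = rk s \<or> rk n \<epsilon> rk s \<Longrightarrow> n \<in> S"
    and S_proper: "\<exists>\<xi>. Ord \<xi> \<and> \<xi> \<notin> S"
    and S_topless: "Ord \<xi> \<Longrightarrow> \<xi> \<notin> S \<Longrightarrow> \<exists>\<eta>. Ord \<eta> \<and> \<eta> \<notin> S \<and> \<eta> \<epsilon> \<xi>"
begin

definition above :: "'a \<Rightarrow> bool" where
  "above \<xi> \<longleftrightarrow> Ord \<xi> \<and> \<xi> \<notin> S"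

lemma above_pred: "above \<xi> \<Longrightarrow> \<exists>\<eta>. above \<eta> \<and> \<eta> \<epsilon> \<xi>"
  using S_topless unfolding above_def by blast

lemma S_V: "s \<in> S \<Longrightarrow> above \<xi> \<Longrightarrow> s \<epsilon> V \<xi>"
  using Ord_linear[OF Ord_rk, of \<xi> s] S_initial[of s \<xi>] rk_Ord[of \<xi>] mem_V_rk[of \<xi> s]
  unfolding above_def by auto

text \<open>If \<open>rk x\<close> were not in \<open>S\<close>, it would itself be one of the ordinals \<open>\<xi>\<close>, and \<open>x\<close> is not in
  \<open>V (rk x)\<close>.\<close>

lemma S_I:
  assumes "\<And>\<xi>. above \<xi> \<Longrightarrow> x \<epsilon> V \<xi>"
  shows "x \<in> S"
proof -
  have "rk x \<in> S"
    using assms[of "rk x"] mem_V_rk[OF Ord_rk, of x x] mem_irrefl Ord_rk unfolding above_def by blast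
  then show ?thesis using S_initial[of "rk x" x] by simp
qed

text \<open>Toplessness in its most useful form. For \<open>\<xi>\<close> above \<open>S\<close> choose \<open>\<eta> \<epsilon> \<xi>\<close> above \<open>S\<close>; then
  \<open>x\<close> is a subset of \<open>V \<eta>\<close> and hence an element of \<open>V \<xi>\<close>. In particular \<open>S\<close> is closed under
  pairs and successors.\<close>

lemma S_subset:
  assumes "\<And>u. u \<epsilon> x \<Longrightarrow> u \<in> S"
  shows "x \<in> S"
proof (rule S_I)
  fix \<xi> assume "above \<xi>"
  then obtain \<eta> where \<eta>: "above \<eta>" "\<eta> \<epsilon> \<xi>" using above_pred by blast
  show "x \<epsilon> V \<xi>" by (rule V_I[OF \<eta>(2)]) (use S_V assms \<eta>(1) in blast)
qed

lemma S_transitive: "x \<in> S \<Longrightarrow> u \<epsilon> x \<Longrightarrow> u \<in> S"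
  using S_initial[of x u] rk_mem by blast

lemma S_upair: "x \<in> S \<Longrightarrow> y \<in> S \<Longrightarrow> upair x y \<in> S"
  by (rule S_subset) auto

lemma S_opair: "x \<in> S \<Longrightarrow> y \<in> S \<Longrightarrow> opair x y \<in> S"
  unfolding opair_def by (intro S_upair)

lemma S_suc: "x \<in> S \<Longrightarrow> suc x \<in> S"
  by (rule S_subset) (auto dest: S_transitive)

lemma S_above: "k \<in> S \<Longrightarrow> Ord k \<Longrightarrow> above \<xi> \<Longrightarrow> k \<epsilon> \<xi>"
  using S_V[of k \<xi>] mem_V_rk[of \<xi> k] rk_Ord[of k] unfolding above_def by simp

text \<open>A move leads to an element of a set that has been matched already. So a position never refers to
  the universe as a whole, which is only reached through levels added to the position.\<close>

definition back_forth :: "('a \<times> 'a) set set \<Rightarrow> bool" where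
  "back_forth \<R> \<longleftrightarrow> (\<forall>H a b. H \<in> \<R> \<longrightarrow> (a, b) \<in> H \<longrightarrow>
     (level a \<longleftrightarrow> level b) \<and> (a \<in> S \<or> b \<in> S \<longrightarrow> a = b) \<and>
     (\<forall>c d. (c, d) \<in> H \<longrightarrow> (a \<epsilon> c \<longleftrightarrow> b \<epsilon> d)) \<and>
     (\<forall>m. m \<epsilon> a \<longrightarrow> (\<exists>n. n \<epsilon> b \<and> insert (m, n) H \<in> \<R>)) \<and>
     (\<forall>n. n \<epsilon> b \<longrightarrow> (\<exists>m. m \<epsilon> a \<and> insert (m, n) H \<in> \<R>)))"

definition similar :: "('a \<times> 'a) set \<Rightarrow> bool" where
  "similar H \<longleftrightarrow> (\<exists>\<R>. back_forth \<R> \<and> H \<in> \<R>)"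

lemma back_forthI:
  assumes "\<And>H a b. H \<in> \<R> \<Longrightarrow> (a, b) \<in> H \<Longrightarrow> level a \<longleftrightarrow> level b"
    and "\<And>H a b. H \<in> \<R> \<Longrightarrow> (a, b) \<in> H \<Longrightarrow> a \<in> S \<or> b \<in> S \<Longrightarrow> a = b"
    and "\<And>H a b c d. H \<in> \<R> \<Longrightarrow> (a, b) \<in> H \<Longrightarrow> (c, d) \<in> H \<Longrightarrow> a \<epsilon> c \<longleftrightarrow> b \<epsilon> d"
    and "\<And>H a b m. H \<in> \<R> \<Longrightarrow> (a, b) \<in> H \<Longrightarrow> m \<epsilon> a \<Longrightarrow> \<exists>n. n \<epsilon> b \<and> insert (m, n) H \<in> \<R>"
    and "\<And>H a b n. H \<in> \<R> \<Longrightarrow> (a, b) \<in> H \<Longrightarrow> n \<epsilon> b \<Longrightarrow> \<exists>m. m \<epsilon> a \<and> insert (m, n) H \<in> \<R>"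
  shows "back_forth \<R>"
  unfolding back_forth_def by (intro allI impI conjI) (rule assms; assumption)+

lemma
  assumes "similar H" "(a, b) \<in> H"
  shows similar_level: "level a \<longleftrightarrow> level b"
    and similar_fix: "a \<in> S \<or> b \<in> S \<Longrightarrow> a = b"
    and similar_mem: "(c, d) \<in> H \<Longrightarrow> a \<epsilon> c \<longleftrightarrow> b \<epsilon> d"
    and similar_forth: "m \<epsilon> a \<Longrightarrow> \<exists>n. n \<epsilon> b \<and> similar (insert (m, n) H)"
    and similar_back: "n \<epsilon> b \<Longrightarrow> \<exists>m. m \<epsilon> a \<and> similar (insert (m, n) H)"
proof -
  obtain \<R> where \<R>: "back_forth \<R>" "H \<in> \<R>" using assms(1) unfolding similar_def by blast
  note * = \<R>(1)[unfolded back_forth_def, rule_format, OF \<R>(2) assms(2)]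
  show "level a \<longleftrightarrow> level b" using * by blast
  show "a \<in> S \<or> b \<in> S \<Longrightarrow> a = b" using * by blast
  show "(c, d) \<in> H \<Longrightarrow> a \<epsilon> c \<longleftrightarrow> b \<epsilon> d" using * by blast
  show "m \<epsilon> a \<Longrightarrow> \<exists>n. n \<epsilon> b \<and> similar (insert (m, n) H)"
    using * \<R>(1) unfolding similar_def by blast
  show "n \<epsilon> b \<Longrightarrow> \<exists>m. m \<epsilon> a \<and> similar (insert (m, n) H)"
    using * \<R>(1) unfolding similar_def by blast
qed

lemma similar_mono:
  assumes "similar H" "K \<subseteq> H"
  shows "similar K"
  unfolding similar_def
proof (intro exI conjI)
  show "K \<in> {K. \<exists>H. similar H \<and> K \<subseteq> H}" using assms by blast
  show "back_forth {K. \<exists>H. similar H \<and> K \<subseteq> H}"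
  proof (rule back_forthI; unfold mem_Collect_eq; elim exE conjE)
    fix K H a b assume H: "(a, b) \<in> K" "similar H" "K \<subseteq> H"
    then have ab: "(a, b) \<in> H" by blast
    show "level a \<longleftrightarrow> level b" using similar_level H(2) ab .
    show "a \<in> S \<or> b \<in> S \<Longrightarrow> a = b" using similar_fix H(2) ab .
    show "a \<epsilon> c \<longleftrightarrow> b \<epsilon> d" if "(c, d) \<in> K" for c d using similar_mem[OF H(2) ab] H(3) that by blast
    show "\<exists>n. n \<epsilon> b \<and> (\<exists>H. similar H \<and> insert (m, n) K \<subseteq> H)" if m: "m \<epsilon> a" for m
      using similar_forth[OF H(2) ab m] H(3) by (meson insert_mono)
    show "\<exists>m. m \<epsilon> a \<and> (\<exists>H. similar H \<and> insert (m, n) K \<subseteq> H)" if n: "n \<epsilon> b" for n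
      using similar_back[OF H(2) ab n] H(3) by (meson insert_mono)
  qed
qed

lemma similar_comp:
  assumes "similar H" "similar H'" "K \<subseteq> H O H'"
  shows "similar K"
  unfolding similar_def
proof (intro exI conjI)
  let ?R = "{K. \<exists>H H'. similar H \<and> similar H' \<and> K \<subseteq> H O H'}"
  show "K \<in> ?R" using assms by blast
  show "back_forth ?R"
  proof (rule back_forthI; unfold mem_Collect_eq; elim exE conjE)
    fix K H H' a c assume H: "(a, c) \<in> K" "similar H" "similar H'" "K \<subseteq> H O H'"
    then obtain b where ab: "(a, b) \<in> H" and bc: "(b, c) \<in> H'" by blast
    show "level a \<longleftrightarrow> level c" using similar_level[OF H(2) ab] similar_level[OF H(3) bc] by simp
    show "a \<in> S \<or> c \<in> S \<Longrightarrow> a = c" using similar_fix[OF H(2) ab] similar_fix[OF H(3) bc] by blast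
    show "a \<epsilon> x \<longleftrightarrow> c \<epsilon> z" if "(x, z) \<in> K" for x z
    proof -
      obtain y where "(x, y) \<in> H" "(y, z) \<in> H'" using H(4) \<open>(x, z) \<in> K\<close> by blast
      then show ?thesis using similar_mem[OF H(2) ab] similar_mem[OF H(3) bc] by blast
    qed
    show "\<exists>n. n \<epsilon> c \<and> (\<exists>H H'. similar H \<and> similar H' \<and> insert (m, n) K \<subseteq> H O H')" if m: "m \<epsilon> a" for m
    proof -
      obtain l where l: "l \<epsilon> b" "similar (insert (m, l) H)" using similar_forth[OF H(2) ab m] by blast
      obtain n where n: "n \<epsilon> c" "similar (insert (l, n) H')" using similar_forth[OF H(3) bc l(1)] by blast
      have "insert (m, n) K \<subseteq> insert (m, l) H O insert (l, n) H'" using H(4) by blast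
      then show ?thesis using l n by blast
    qed
    show "\<exists>m. m \<epsilon> a \<and> (\<exists>H H'. similar H \<and> similar H' \<and> insert (m, n) K \<subseteq> H O H')" if n: "n \<epsilon> c" for n
    proof -
      obtain l where l: "l \<epsilon> b" "similar (insert (l, n) H')" using similar_back[OF H(3) bc n] by blast
      obtain m where m: "m \<epsilon> a" "similar (insert (m, l) H)" using similar_back[OF H(2) ab l(1)] by blast
      have "insert (m, n) K \<subseteq> insert (m, l) H O insert (l, n) H'" using H(4) by blast
      then show ?thesis using l m by blast
    qed
  qed
qed

lemma zero_S: "zero \<in> S" by (rule S_subset) simp
lemma one_S: "one \<in> S" by (rule S_subset) (simp add: one_def zero_S)
lemma two_S: "two \<in> S" by (rule S_subset) (simp add: two_def one_S)

definition coded :: "'a \<Rightarrow> 'a \<Rightarrow> 'a \<Rightarrow> bool" where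
  "coded k X f \<longleftrightarrow> (\<forall>p. p \<epsilon> f \<longrightarrow> (\<exists>j x. p = opair j x \<and> j \<epsilon> k \<and> x \<epsilon> X)) \<and>
     (\<forall>j x y. opair j x \<epsilon> f \<longrightarrow> opair j y \<epsilon> f \<longrightarrow> x = y)"

text \<open>The labels are elements of an ordinal \<open>k \<in> S\<close>, so they can occur in types at every ordinal above
  \<open>S\<close>, and \<open>k\<close> itself is a fresh label. The ordinal \<open>\<xi>\<close> is hidden by the quantifier since each
  move replaces it by a smaller one.\<close>

definition same_type :: "'a \<Rightarrow> 'a \<Rightarrow> 'a \<Rightarrow> 'a \<Rightarrow> bool" where
  "same_type X X' f g \<longleftrightarrow> level X \<and> X \<notin> S \<and> level X' \<and> X' \<notin> S \<and>
     (\<exists>k \<zeta> \<xi>. k \<in> S \<and> Ord k \<and> coded k X f \<and> coded k X' g \<and>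
        above \<zeta> \<and> above \<xi> \<and> (\<xi> = \<zeta> \<or> \<xi> \<epsilon> \<zeta>) \<and> tp \<zeta> X \<xi> f = tp \<zeta> X' \<xi> g)"

text \<open>With the levels \<open>X\<close> and \<open>X'\<close> themselves in the position, a move may lead to any of their elements.\<close>

definition matching :: "'a \<Rightarrow> 'a \<Rightarrow> 'a \<Rightarrow> 'a \<Rightarrow> ('a \<times> 'a) set" where
  "matching X X' f g = insert (X, X') {(x, y). \<exists>j. opair j x \<epsilon> f \<and> opair j y \<epsilon> g}"

lemma same_type_sym: "same_type X X' f g \<Longrightarrow> same_type X' X g f"
  unfolding same_type_def by metis

lemma matching_sym: "(a, b) \<in> matching X X' f g \<longleftrightarrow> (b, a) \<in> matching X' X g f"
  unfolding matching_def by auto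

lemma coded_pow:
  assumes "coded k X f" "k \<in> S" "Ord k" "above \<zeta>"
  shows "f \<epsilon> pow (times \<zeta> X)"
proof -
  have "k \<epsilon> \<zeta>" using S_above assms(2-4) by blast
  then show ?thesis using assms(1,4) Ord_trans[of \<zeta> k] unfolding coded_def above_def by auto
qed

lemma coded_mem: "coded k X f \<Longrightarrow> opair j x \<epsilon> f \<Longrightarrow> j \<epsilon> k \<and> x \<epsilon> X"
  unfolding coded_def by fastforce

lemma coded_unique: "coded k X f \<Longrightarrow> opair j x \<epsilon> f \<Longrightarrow> opair j y \<epsilon> f \<Longrightarrow> x = y"
  unfolding coded_def by blast

text \<open>The code of the fact in question is an element of \<open>S\<close>, and hence of \<open>V \<xi>\<close>.\<close>

lemma same_type_atomic:
  assumes "same_type X X' f g" "opair i a \<epsilon> f" "opair j c \<epsilon> f" "opair i b \<epsilon> g" "opair j d \<epsilon> g"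
    and "a \<epsilon> c \<or> i = j \<and> level a"
  shows "b \<epsilon> d \<or> i = j \<and> level b"
proof -
  obtain k \<zeta> \<xi> where k: "k \<in> S" "Ord k" "coded k X f" "coded k X' g" "above \<zeta>" "above \<xi>"
    "tp \<zeta> X \<xi> f = tp \<zeta> X' \<xi> g"
    using assms(1) unfolding same_type_def by blast
  note f = coded_pow[OF k(3,1,2,5)] and g = coded_pow[OF k(4,1,2,5)]
  have ij: "i \<epsilon> k" "j \<epsilon> k" "a \<epsilon> X" "c \<epsilon> X"
    using coded_mem[OF k(3)] assms(2,3) by blast+
  have "k \<epsilon> \<zeta>" using S_above k by blast
  then have \<zeta>: "i \<epsilon> \<zeta>" "j \<epsilon> \<zeta>" using ij Ord_trans k(5) unfolding above_def by blast+
  let ?y = "opair zero (opair i j)"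
  have "?y \<in> S" using S_opair zero_S ij S_transitive[OF k(1)] by blast
  then have "?y \<epsilon> V \<xi>" using S_V k(6) by blast
  then have "?y \<epsilon> tp \<zeta> X \<xi> f"
    unfolding mem_tp[OF f] using \<zeta> ij assms(2,3,6) by blast
  then have "?y \<epsilon> tp \<zeta> X' \<xi> g" using k(7) by simp
  then obtain b' d' where "opair i b' \<epsilon> g" "opair j d' \<epsilon> g" "b' \<epsilon> d' \<or> i = j \<and> level b'"
    unfolding mem_tp[OF g] by auto
  then show ?thesis using coded_unique[OF k(4)] assms(4,5) by metis
qed

lemma same_type_mem:
  assumes "same_type X X' f g" "(a, b) \<in> matching X X' f g" "(c, d) \<in> matching X X' f g" "a \<epsilon> c"
  shows "b \<epsilon> d"
proof -
  obtain k where k: "coded k X f" "coded k X' g" "level X" "level X'"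
    using assms(1) unfolding same_type_def by blast
  consider "(a, b) = (X, X')" | i where "opair i a \<epsilon> f" "opair i b \<epsilon> g"
    using assms(2) unfolding matching_def by blast
  then show ?thesis
  proof cases
    case 1
    consider "(c, d) = (X, X')" | j where "opair j c \<epsilon> f"
      using assms(3) unfolding matching_def by blast
    then have "X \<epsilon> X"
      by cases (use 1 assms(4) level_trans[OF k(3)] coded_mem[OF k(1)] in blast)+
    then show ?thesis using mem_irrefl by blast
  next
    case (2 i)
    consider "(c, d) = (X, X')" | j where "opair j c \<epsilon> f" "opair j d \<epsilon> g"
      using assms(3) unfolding matching_def by blast
    then show ?thesis
    proof cases
      case 1
      then show ?thesis using coded_mem[OF k(2)] 2 by blast
    next
      case (2 j)
      have "b \<epsilon> d \<or> i = j \<and> level b"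
        using same_type_atomic[OF assms(1) \<open>opair i a \<epsilon> f\<close> 2(1) \<open>opair i b \<epsilon> g\<close> 2(2)] assms(4) by blast
      moreover have "i \<noteq> j"
        using coded_unique[OF k(1)] \<open>opair i a \<epsilon> f\<close> 2(1) assms(4) mem_irrefl by blast
      ultimately show ?thesis by blast
    qed
  qed
qed

lemma same_type_level:
  assumes "same_type X X' f g" "(a, b) \<in> matching X X' f g" "level a"
  shows "level b"
proof -
  consider "(a, b) = (X, X')" | i where "opair i a \<epsilon> f" "opair i b \<epsilon> g"
    using assms(2) unfolding matching_def by blast
  then show ?thesis
  proof cases
    case 1
    then show ?thesis using assms(1) unfolding same_type_def by simp
  next
    case 2
    then show ?thesis using same_type_atomic[OF assms(1) 2(1) 2(1) 2(2) 2(2)] assms(3) mem_irrefl by blast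
  qed
qed

lemma same_type_fix:
  assumes "same_type X X' f g" "(a, b) \<in> matching X X' f g" "a \<in> S"
  shows "a = b"
proof -
  obtain k \<zeta> \<xi> where k: "k \<in> S" "Ord k" "coded k X f" "coded k X' g" "above \<zeta>" "above \<xi>"
    "tp \<zeta> X \<xi> f = tp \<zeta> X' \<xi> g" "X \<notin> S"
    using assms(1) unfolding same_type_def by blast
  note f = coded_pow[OF k(3,1,2,5)] and g = coded_pow[OF k(4,1,2,5)]
  obtain i where i: "opair i a \<epsilon> f" "opair i b \<epsilon> g"
    using assms(2,3) k(8) unfolding matching_def by blast
  let ?y = "opair one (opair i a)"
  have "?y \<in> S" using S_opair one_S assms(3) coded_mem[OF k(3) i(1)] S_transitive[OF k(1)] by blast
  then have "?y \<epsilon> V \<xi>" using S_V k(6) by blast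
  then have "?y \<epsilon> tp \<zeta> X' \<xi> g"
    unfolding k(7)[symmetric] mem_tp[OF f] using i(1) by blast
  then have "opair i a \<epsilon> g" unfolding mem_tp[OF g] by auto
  then show ?thesis using coded_unique[OF k(4)] i(2) by blast
qed

lemma above_opair:
  assumes "above \<xi>"
  shows "\<exists>\<eta>. above \<eta> \<and> \<eta> \<epsilon> \<xi> \<and> (\<forall>x y. x \<epsilon> V \<eta> \<longrightarrow> y \<epsilon> V \<eta> \<longrightarrow> opair x y \<epsilon> V \<xi>)"
proof -
  obtain \<xi>1 where 1: "above \<xi>1" "\<xi>1 \<epsilon> \<xi>" using above_pred[OF assms] by blast
  obtain \<xi>2 where 2: "above \<xi>2" "\<xi>2 \<epsilon> \<xi>1" using above_pred[OF 1(1)] by blast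
  have "opair x y \<epsilon> V \<xi>" if "x \<epsilon> V \<xi>2" "y \<epsilon> V \<xi>2" for x y
  proof -
    have "upair x' y' \<epsilon> V \<xi>1" if "x' \<epsilon> V \<xi>2" "y' \<epsilon> V \<xi>2" for x' y'
      by (rule V_I[OF 2(2)]) (use that in auto)
    then show ?thesis unfolding opair_def by (intro V_I[OF 1(2)]) (use that in auto)
  qed
  moreover have "\<xi>2 \<epsilon> \<xi>" using Ord_trans 1 2 assms unfolding above_def by blast
  ultimately show ?thesis using 2(1) by blast
qed

lemma coded_put:
  assumes "coded k X f" "m \<epsilon> X"
  shows "coded (suc k) X (put f k m)"
proof -
  have "\<not> opair k x \<epsilon> f" for x using coded_mem[OF assms(1), of k x] mem_irrefl by blast
  then show ?thesis using assms unfolding coded_def mem_put mem_suc opair_eq by blast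
qed

text \<open>The type of the extended tuple at some \<open>\<eta>\<close> far enough below \<open>\<xi>\<close> is coded by an element of the
  type at \<open>\<xi>\<close>, so it is also the type of an extension of the other tuple.\<close>

lemma same_type_forth:
  assumes "same_type X X' f g" "m \<epsilon> X"
  shows "\<exists>n f' g'. n \<epsilon> X' \<and> same_type X X' f' g' \<and>
    insert (m, n) (matching X X' f g) \<subseteq> matching X X' f' g'"
proof -
  obtain k \<zeta> \<xi> where k: "k \<in> S" "Ord k" "coded k X f" "coded k X' g" "above \<zeta>" "above \<xi>"
    "\<xi> = \<zeta> \<or> \<xi> \<epsilon> \<zeta>" "tp \<zeta> X \<xi> f = tp \<zeta> X' \<xi> g"
    "level X" "level X'" "X \<notin> S" "X' \<notin> S"
    using assms(1) unfolding same_type_def by blast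
  note f = coded_pow[OF k(3,1,2,5)] and g = coded_pow[OF k(4,1,2,5)]
  \<comment> \<open>The code consists of three nested pairs, each of which costs one of the steps from \<open>\<eta>\<close> up to \<open>\<xi>\<close>.\<close>
  obtain \<xi>1 where 1: "above \<xi>1" "\<xi>1 \<epsilon> \<xi>" "\<And>x y. x \<epsilon> V \<xi>1 \<Longrightarrow> y \<epsilon> V \<xi>1 \<Longrightarrow> opair x y \<epsilon> V \<xi>"
    using above_opair[OF k(6)] by blast
  obtain \<xi>2 where 2: "above \<xi>2" "\<xi>2 \<epsilon> \<xi>1" "\<And>x y. x \<epsilon> V \<xi>2 \<Longrightarrow> y \<epsilon> V \<xi>2 \<Longrightarrow> opair x y \<epsilon> V \<xi>1"
    using above_opair[OF 1(1)] by blast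
  obtain \<xi>3 where 3: "above \<xi>3" "\<xi>3 \<epsilon> \<xi>2" "\<And>x y. x \<epsilon> V \<xi>3 \<Longrightarrow> y \<epsilon> V \<xi>3 \<Longrightarrow> opair x y \<epsilon> V \<xi>2"
    using above_opair[OF 2(1)] by blast
  obtain \<eta> where \<eta>: "above \<eta>" "\<eta> \<epsilon> \<xi>3" using above_pred[OF 3(1)] by blast
  have \<eta>\<xi>: "\<eta> \<epsilon> \<xi>" using 1 2 3 \<eta> k(6) Ord_trans unfolding above_def by meson
  then have \<eta>\<zeta>: "\<eta> \<epsilon> \<zeta>" using k(5,7) Ord_trans unfolding above_def by blast
  have k\<zeta>: "k \<epsilon> \<zeta>" using S_above k by blast
  have sk: "suc k \<in> S" "Ord (suc k)" using S_suc Ord_suc k(1,2) by blast+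
  let ?t = "tp \<zeta> X \<eta> (put f k m)"
  have f': "coded (suc k) X (put f k m)" by (rule coded_put[OF k(3) assms(2)])
  have "?t \<epsilon> V \<xi>3"
    by (rule V_I[OF \<eta>(2)]) (rule tp_subset[OF coded_pow[OF f' sk k(5)]])
  moreover have "\<eta> \<epsilon> V \<xi>3"
    using \<eta> mem_V_rk[of \<xi>3 \<eta>] rk_Ord[of \<eta>] 3(1) unfolding above_def by simp
  ultimately have "opair \<eta> ?t \<epsilon> V \<xi>2" by (intro 3(3))
  then have "opair k (opair \<eta> ?t) \<epsilon> V \<xi>1" by (intro 2(3) S_V[OF k(1) 2(1)])
  then have "opair two (opair k (opair \<eta> ?t)) \<epsilon> V \<xi>" by (intro 1(3) S_V[OF two_S 1(1)])
  then have "opair two (opair k (opair \<eta> ?t)) \<epsilon> tp \<zeta> X' \<xi> g"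
    unfolding k(8)[symmetric] mem_tp[OF f] using \<eta>\<xi> k\<zeta> assms(2) by blast
  then obtain n where n: "n \<epsilon> X'" "?t = tp \<zeta> X' \<eta> (put g k n)"
    unfolding mem_tp[OF g] by auto
  have g': "coded (suc k) X' (put g k n)" by (rule coded_put[OF k(4) n(1)])
  have "same_type X X' (put f k m) (put g k n)"
    unfolding same_type_def using k(5,9-12) sk f' g' \<eta>(1) \<eta>\<zeta> n(2) by blast
  moreover have "insert (m, n) (matching X X' f g) \<subseteq> matching X X' (put f k m) (put g k n)"
    unfolding matching_def by auto
  ultimately show ?thesis using n(1) by blast
qed

text \<open>Positions with equal types form a back-and-forth system: after each move the types agree at a
  smaller ordinal that is still above \<open>S\<close>, and there is no least such ordinal. By symmetry only
  the moves in one direction need to be considered.\<close>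

lemma same_type_similar:
  assumes "same_type X X' f g"
  shows "similar (matching X X' f g)"
  unfolding similar_def
proof (intro exI conjI)
  let ?R = "{H. \<exists>X X' f g. same_type X X' f g \<and> H \<subseteq> matching X X' f g}"
  show "matching X X' f g \<in> ?R" using assms by blast
  have in_level: "a \<epsilon> X \<or> a = X" if "same_type X X' f g" "(a, b) \<in> matching X X' f g" for a b X X' f g
    using that coded_mem unfolding same_type_def matching_def by blast
  have forth: "\<exists>n f' g'. n \<epsilon> b \<and> same_type X X' f' g' \<and> insert (m, n) (matching X X' f g) \<subseteq> matching X X' f' g'"
    if st: "same_type X X' f g" and ab: "(a, b) \<in> matching X X' f g" and m: "m \<epsilon> a" for a b m X X' f g
  proof -
    have "m \<epsilon> X"
      using in_level[OF st ab] m level_trans[of X] st unfolding same_type_def by blast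
    then obtain n f' g' where n: "same_type X X' f' g'"
      "insert (m, n) (matching X X' f g) \<subseteq> matching X X' f' g'"
      using same_type_forth[OF st] by blast
    then have "n \<epsilon> b" using same_type_mem[OF n(1), of m n a b] ab m by blast
    with n show ?thesis by blast
  qed
  show "back_forth ?R"
  proof (rule back_forthI; unfold mem_Collect_eq; elim exE conjE)
    fix H X X' f g a b
    assume ab: "(a, b) \<in> H" and st: "same_type X X' f g" and H: "H \<subseteq> matching X X' f g"
    have ts: "same_type X' X g f" by (rule same_type_sym[OF st])
    have ab': "(a, b) \<in> matching X X' f g" "(b, a) \<in> matching X' X g f"
      using ab H matching_sym by blast+
    show "level a \<longleftrightarrow> level b"
      using same_type_level[OF st ab'(1)] same_type_level[OF ts ab'(2)] by blast
    show "a \<in> S \<or> b \<in> S \<Longrightarrow> a = b"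
      using same_type_fix[OF st ab'(1)] same_type_fix[OF ts ab'(2)] by blast
    show "a \<epsilon> c \<longleftrightarrow> b \<epsilon> d" if "(c, d) \<in> H" for c d
    proof -
      have "(c, d) \<in> matching X X' f g" "(d, c) \<in> matching X' X g f"
        using that H matching_sym by blast+
      then show ?thesis
        using same_type_mem[OF st ab'(1)] same_type_mem[OF ts ab'(2)] by blast
    qed
    show "\<exists>n. n \<epsilon> b \<and> (\<exists>X X' f g. same_type X X' f g \<and> insert (m, n) H \<subseteq> matching X X' f g)"
      if "m \<epsilon> a" for m
      using forth[OF st ab'(1) that] H by (meson insert_mono subset_trans)
    show "\<exists>m. m \<epsilon> a \<and> (\<exists>X X' f g. same_type X X' f g \<and> insert (m, n) H \<subseteq> matching X X' f g)"
      if n: "n \<epsilon> b" for n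
    proof -
      obtain m f' g' where m: "m \<epsilon> a" "same_type X' X f' g'"
        "insert (n, m) (matching X' X g f) \<subseteq> matching X' X f' g'"
        using forth[OF ts ab'(2) n] by blast
      have "insert (m, n) H \<subseteq> matching X X' g' f'"
        using H m(3) unfolding matching_def by blast
      then show ?thesis using m(1) same_type_sym[OF m(2)] by blast
    qed
  qed
qed

section \<open>Reflection\<close>

lemma finite_bound: "finite P \<Longrightarrow> \<exists>x. \<forall>p\<in>P. p \<epsilon> x"
proof (induction rule: finite_induct)
  case (insert p P)
  then obtain x where "\<forall>p\<in>P. p \<epsilon> x" by blast
  then have "\<forall>q\<in>insert p P. q \<epsilon> un x (sing p)" by simp
  then show ?case by blast
qed simp

text \<open>The labels are the natural numbers of \<open>M\<close> up to the size of \<open>P\<close>, which all belong to \<open>S\<close>. The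
  tuple does not depend on the level in which it is considered later.\<close>

lemma code_finite:
  "finite P \<Longrightarrow> \<exists>k f. k \<in> S \<and> Ord k \<and> (\<forall>p\<in>P. \<exists>j. opair j p \<epsilon> f) \<and>
     (\<forall>X. (\<forall>p\<in>P. p \<epsilon> X) \<longrightarrow> coded k X f)"
proof (induction rule: finite_induct)
  case empty
  have "Ord zero" unfolding Ord_def transitive_def by simp
  moreover have "coded zero X zero" for X unfolding coded_def by simp
  ultimately show ?case using zero_S by blast
next
  case (insert p P)
  then obtain k f where k: "k \<in> S" "Ord k" "\<forall>p\<in>P. \<exists>j. opair j p \<epsilon> f"
    "\<And>X. (\<forall>p\<in>P. p \<epsilon> X) \<Longrightarrow> coded k X f" by blast
  have "suc k \<in> S" "Ord (suc k)" using k S_suc Ord_suc by blast+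
  moreover have "\<forall>q\<in>insert p P. \<exists>j. opair j q \<epsilon> put f k p"
    using k(3) unfolding mem_put by blast
  moreover have "coded (suc k) X (put f k p)" if "\<forall>q\<in>insert p P. q \<epsilon> X" for X
    using coded_put k(4) that by simp
  ultimately show ?case by blast
qed

lemma level_V: "Ord a \<Longrightarrow> level (V a)"
  unfolding level_def by blast

lemma level_above:
  assumes "above \<theta>" "\<theta> \<epsilon> \<gamma>" "Ord \<gamma>"
  shows "V \<gamma> \<notin> S"
proof
  assume "V \<gamma> \<in> S"
  then have "\<gamma> \<in> S" using S_initial[of "V \<gamma>" \<gamma>] rk_V[OF assms(3)] rk_Ord[OF assms(3)] by simp
  then show False using S_transitive assms(1,2) unfolding above_def by blast
qed

text \<open>Such a \<open>c\<close> stands in for the universe when a finite map with domain \<open>P\<close> is extended.\<close>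

definition reflects :: "'a \<Rightarrow> 'a set \<Rightarrow> bool" where
  "reflects c P \<longleftrightarrow> (\<forall>x. level x \<longrightarrow> (\<exists>x'. x' \<epsilon> c \<and> similar (insert (x, x') (Id_on P))))"

lemma reflects_mono:
  assumes "reflects c Q" "P \<subseteq> Q"
  shows "reflects c P"
  unfolding reflects_def
proof (intro allI impI)
  fix x assume "level x"
  then obtain x' where x': "x' \<epsilon> c" "similar (insert (x, x') (Id_on Q))"
    using assms(1) unfolding reflects_def by blast
  have "insert (x, x') (Id_on P) \<subseteq> insert (x, x') (Id_on Q)" using assms(2) by blast
  then show "\<exists>x'. x' \<epsilon> c \<and> similar (insert (x, x') (Id_on P))"
    using x' similar_mono by blast
qed

text \<open>The pairs of an \<open>m \<in> A\<close> and the type of the tuple of \<open>m\<close> and the elements of \<open>P\<close> in some level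
  form a set, by Separation from \<open>A \<times> \<P> (V \<zeta>)\<close>. Collection bounds the levels that are needed to
  realize all of them. The set \<open>z\<close> serves to make \<open>c\<close> as large as desired.\<close>

lemma ex_reflects:
  assumes "finite P"
  shows "\<exists>c. level c \<and> z \<epsilon> c \<and> (\<forall>m. m \<epsilon> A \<longrightarrow> reflects c (insert m P))"
proof -
  obtain \<zeta> where \<zeta>: "above \<zeta>" using S_proper unfolding above_def by blast
  obtain k f where k: "k \<in> S" "Ord k" "\<forall>p\<in>P. \<exists>j. opair j p \<epsilon> f"
    "\<And>X. (\<forall>p\<in>P. p \<epsilon> X) \<Longrightarrow> coded k X f" using code_finite[OF assms] by blast
  obtain u where u: "\<forall>p\<in>P. p \<epsilon> u" using finite_bound[OF assms] by blast
  \<comment> \<open>An ordinal above \<open>S\<close> such that \<open>P\<close> and \<open>A\<close> are contained in \<open>V \<theta>\<close>.\<close>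
  define \<theta> where "\<theta> = rk (un (sing \<zeta>) (un u A))"
  have "\<zeta> \<epsilon> \<theta>"
    using rk_mem[of \<zeta> "un (sing \<zeta>) (un u A)"] \<zeta> rk_Ord[of \<zeta>] unfolding \<theta>_def above_def by simp
  then have \<theta>: "above \<theta>"
    using S_transitive[of \<theta> \<zeta>] \<zeta> Ord_rk unfolding above_def \<theta>_def by blast
  have u\<theta>: "rk p \<epsilon> \<theta>" if "p \<epsilon> u \<or> p \<epsilon> A" for p
    unfolding \<theta>_def by (rule rk_mem) (use that in auto)
  let ?N = "\<lambda>p \<gamma>. Ord \<gamma> \<and> \<theta> \<epsilon> \<gamma> \<and> (\<exists>m. m \<epsilon> A \<and> p = opair m (tp \<zeta> (V \<gamma>) \<zeta> (put f k m)))"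
  have N: "delta1 (\<lambda>v. ?N (v 0) (v (Suc 0)))"
    by (intro definability_more sigma1_fun_tp)
  have "sigma1 (\<lambda>v. \<exists>\<gamma>. ?N (v 0) \<gamma>)"
    by (intro sigma1_ex delta1_sigma1 definability_more sigma1_fun_tp)
  then obtain R where R: "\<And>p. p \<epsilon> R \<longleftrightarrow> p \<epsilon> times A (pow (V \<zeta>)) \<and> (\<exists>\<gamma>. ?N p \<gamma>)"
    using separation[of "\<lambda>p. \<exists>\<gamma>. ?N p \<gamma>" "times A (pow (V \<zeta>))"] by blast
  obtain B where B: "\<And>p. p \<epsilon> R \<Longrightarrow> \<exists>\<gamma>. \<gamma> \<epsilon> B \<and> ?N p \<gamma>"
    using collection[OF delta1_sigma1[OF N], of R] R by blast
  obtain c where c: "level c" "upair z (V (rk B)) \<epsilon> c" using ex_level by blast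
  have c': "z \<epsilon> c" "V (rk B) \<epsilon> c" using level_trans[OF c] by simp_all
  have "reflects c (insert m P)" if m: "m \<epsilon> A" for m
    unfolding reflects_def
  proof (intro allI impI)
    fix x assume x: "level x"
    \<comment> \<open>The given level may be too small to contain the tuple; it is an element of \<open>V \<gamma>\<close>, which is not.\<close>
    define \<gamma> where "\<gamma> = rk (upair x \<theta>)"
    have \<gamma>: "Ord \<gamma>" unfolding \<gamma>_def by (rule Ord_rk)
    have x\<gamma>: "rk x \<epsilon> \<gamma>" "\<theta> \<epsilon> \<gamma>"
      using rk_mem[of x "upair x \<theta>"] rk_mem[of \<theta> "upair x \<theta>"] rk_Ord \<theta> unfolding \<gamma>_def above_def by simp_all
    have coded: "coded (suc k) (V \<gamma>') (put f k m)" if "Ord \<gamma>'" "\<theta> \<epsilon> \<gamma>'" for \<gamma>'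
    proof (rule coded_put)
      have "p \<epsilon> V \<gamma>'" if "p \<epsilon> u \<or> p \<epsilon> A" for p
        using mem_V_rk[OF \<open>Ord \<gamma>'\<close>] Ord_trans[OF \<open>Ord \<gamma>'\<close> \<open>\<theta> \<epsilon> \<gamma>'\<close>] u\<theta>[OF that] by blast
      then show "coded k (V \<gamma>') f" "m \<epsilon> V \<gamma>'" using k(4) u m by blast+
    qed
    have sk: "suc k \<in> S" "Ord (suc k)" using k S_suc Ord_suc by blast+
    let ?p = "opair m (tp \<zeta> (V \<gamma>) \<zeta> (put f k m))"
    have "tp \<zeta> (V \<gamma>) \<zeta> (put f k m) \<epsilon> pow (V \<zeta>)"
      using tp_subset[OF coded_pow[OF coded[OF \<gamma> x\<gamma>(2)] sk \<zeta>]] by simp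
    then have "?p \<epsilon> R" unfolding R using m \<gamma> x\<gamma>(2) by auto
    then obtain \<gamma>' where \<gamma>': "\<gamma>' \<epsilon> B" "?N ?p \<gamma>'" using B by blast
    then have \<gamma>'2: "Ord \<gamma>'" "\<theta> \<epsilon> \<gamma>'" "tp \<zeta> (V \<gamma>) \<zeta> (put f k m) = tp \<zeta> (V \<gamma>') \<zeta> (put f k m)"
      by auto
    have "same_type (V \<gamma>) (V \<gamma>') (put f k m) (put f k m)"
      unfolding same_type_def
      using level_V \<gamma> \<gamma>'2 level_above[OF \<theta>] x\<gamma>(2) sk coded \<zeta> by blast
    from same_type_similar[OF this]
    have "similar (insert (V \<gamma>, V \<gamma>') (Id_on (insert m P)))"
      by (rule similar_mono) (use k(3) in \<open>auto simp: matching_def\<close>)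
    moreover have "x \<epsilon> V \<gamma>" using mem_V_rk[OF \<gamma>] x\<gamma>(1) by blast
    ultimately obtain x' where x': "x' \<epsilon> V \<gamma>'"
      "similar (insert (x, x') (insert (V \<gamma>, V \<gamma>') (Id_on (insert m P))))"
      using similar_forth[of _ "V \<gamma>" "V \<gamma>'" x] by blast
    have "V \<gamma>' \<epsilon> V (rk B)"
      using V_mem_V[OF \<gamma>'2(1) Ord_rk] rk_mem[OF \<gamma>'(1)] rk_Ord[OF \<gamma>'2(1)] by simp
    then have "x' \<epsilon> c" using x'(1) c' level_trans[OF c(1)] by blast
    then show "\<exists>x'. x' \<epsilon> c \<and> similar (insert (x, x') (Id_on (insert m P)))"
      using similar_mono[OF x'(2)] by blast
  qed
  with c(1) c'(1) show ?thesis by blast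
qed

section \<open>Approximations\<close>

text \<open>The finite map \<open>H\<close> can be continued with values in \<open>b\<close>: each level of the universe, however large,
  has a counterpart in \<open>b\<close>.\<close>

definition good :: "('a \<times> 'a) set \<Rightarrow> 'a \<Rightarrow> bool" where
  "good H b \<longleftrightarrow> finite H \<and> level b \<and> (\<forall>x. level x \<longrightarrow> (\<exists>y. y \<epsilon> b \<and> similar (insert (x, y) H)))"

text \<open>A level \<open>x\<close> looks like some \<open>x' \<epsilon> c\<close> over the domain of \<open>H\<close>, and \<open>x'\<close> has a counterpart
  in \<open>d\<close> because \<open>c\<close> is matched with \<open>d\<close>.\<close>

lemma good_reflects:
  assumes "reflects c (fst ` H)" "similar (insert (c, d) H)" "finite H" "level d"
  shows "good H d"
  unfolding good_def
proof (intro conjI allI impI assms(3,4))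
  fix x assume "level x"
  then obtain x' where x': "x' \<epsilon> c" "similar (insert (x, x') (Id_on (fst ` H)))"
    using assms(1) unfolding reflects_def by blast
  obtain y where y: "y \<epsilon> d" "similar (insert (x', y) (insert (c, d) H))"
    using similar_forth[OF assms(2) _ x'(1)] by blast
  have "insert (x, y) H \<subseteq> insert (x, x') (Id_on (fst ` H)) O insert (x', y) (insert (c, d) H)"
    by force
  with similar_comp[OF x'(2) y(2)] y(1) show "\<exists>y. y \<epsilon> d \<and> similar (insert (x, y) H)" by blast
qed

lemma good_similar: "good H b \<Longrightarrow> similar H"
  unfolding good_def using similar_mono ex_level by (metis subset_insertI)

text \<open>The element \<open>m\<close> lies in a level, which has a counterpart in \<open>b\<close>.\<close>

lemma good_range:
  assumes "good H b" "(m, n) \<in> H"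
  shows "n \<epsilon> b"
proof -
  obtain x where x: "level x" "m \<epsilon> x" using ex_level by blast
  then obtain y where y: "y \<epsilon> b" "similar (insert (x, y) H)" using assms(1) unfolding good_def by blast
  have "n \<epsilon> y" using similar_mem[OF y(2), of m n x y] x assms(2) by blast
  then show ?thesis using y(1) level_trans assms(1) unfolding good_def by blast
qed

lemma good_step:
  assumes "good H b"
  obtains c d where "level c" "z \<epsilon> c" "\<And>m. m \<epsilon> A \<Longrightarrow> reflects c (insert m (fst ` H))"
    "d \<epsilon> b" "level d" "similar (insert (c, d) H)"
proof -
  have "finite (fst ` H)" using assms(1) unfolding good_def by blast
  then obtain c where c: "level c" "z \<epsilon> c" "\<And>m. m \<epsilon> A \<Longrightarrow> reflects c (insert m (fst ` H))"
    using ex_reflects[of "fst ` H" z A] by blast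
  then obtain d where d: "d \<epsilon> b" "similar (insert (c, d) H)"
    using assms(1) unfolding good_def by blast
  have "level d" using similar_level[OF d(2), of c d] c(1) by blast
  show thesis by (rule that[OF c(1,2) _ d(1) \<open>level d\<close> d(2)]) (rule c(3))
qed

text \<open>Choose a reflecting level \<open>c\<close> that contains \<open>m\<close>. The new value and the new bound are found in the
  counterpart of \<open>c\<close>.\<close>

lemma good_forth:
  assumes "good H b"
  shows "\<exists>n b'. b' \<epsilon> b \<and> good (insert (m, n) H) b'"
proof -
  obtain c d where c: "level c" "m \<epsilon> c" "\<And>k. k \<epsilon> sing m \<Longrightarrow> reflects c (insert k (fst ` H))"
    "d \<epsilon> b" "level d" "similar (insert (c, d) H)"
    using good_step[OF assms, of m "sing m"] by blast
  obtain n where n: "n \<epsilon> d" "similar (insert (m, n) (insert (c, d) H))"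
    using similar_forth[OF c(6) _ c(2)] by blast
  have "good (insert (m, n) H) d"
  proof (rule good_reflects)
    show "reflects c (fst ` insert (m, n) H)" using c(3)[of m] by simp
    show "similar (insert (c, d) (insert (m, n) H))" by (rule similar_mono[OF n(2)]) blast
  qed (use assms c in \<open>auto simp: good_def\<close>)
  with c(4) show ?thesis by blast
qed

text \<open>Here \<open>c\<close> has to be chosen before the preimage \<open>m\<close> is known. It must reflect for all the elements
  of \<open>a\<close> at the same time.\<close>

lemma good_back:
  assumes "good H b" "(a, d) \<in> H" "n \<epsilon> d"
  shows "\<exists>m b'. b' \<epsilon> b \<and> good (insert (m, n) H) b'"
proof -
  from good_step[OF assms(1), of a] obtain c e where
    c: "\<And>m. m \<epsilon> a \<Longrightarrow> reflects c (insert m (fst ` H))" "e \<epsilon> b" "level e" "similar (insert (c, e) H)"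
    by blast
  obtain m where m: "m \<epsilon> a" "similar (insert (m, n) (insert (c, e) H))"
    using similar_back[OF c(4) _ assms(3), of a] assms(2) by blast
  have "good (insert (m, n) H) e"
  proof (rule good_reflects)
    show "reflects c (fst ` insert (m, n) H)" using c(1)[OF m(1)] by simp
    show "similar (insert (c, e) (insert (m, n) H))" by (rule similar_mono[OF m(2)]) blast
  qed (use assms c in \<open>auto simp: good_def\<close>)
  with c(2) show ?thesis by blast
qed

text \<open>The image \<open>n\<close> of a reflecting level is a new bound for the original map, as an alternative to
  keeping \<open>n\<close> as a value.\<close>

lemma good_lower:
  assumes "good H b"
  obtains c n b' where "level n" "b' \<epsilon> b" "good (insert (c, n) H) b'" "good H n"
proof -
  obtain c d where c: "level c" "\<And>m. m \<epsilon> sing b \<Longrightarrow> reflects c (insert m (fst ` H))"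
    using good_step[OF assms, of b "sing b"] by blast
  have refl: "reflects c (fst ` H)"
    by (rule reflects_mono[OF c(2)[of b]]) auto
  obtain n b' where n: "b' \<epsilon> b" "good (insert (c, n) H) b'" using good_forth[OF assms] by blast
  have sim: "similar (insert (c, n) H)" by (rule good_similar[OF n(2)])
  have "level n" using similar_level[OF sim, of c n] c(1) by blast
  moreover have "good H n"
    by (rule good_reflects[OF refl sim]) (use assms \<open>level n\<close> in \<open>auto simp: good_def\<close>)
  ultimately show thesis using that n by blast
qed

text \<open>For \<open>\<xi> \<in> \<xi>1 \<in> \<gamma>\<close> above \<open>S\<close> and each subset \<open>Y\<close> of \<open>W = V \<xi>1\<close>, the set
  \<open>thick Y = Y \<union> (\<gamma> - W)\<close> has rank \<open>\<gamma>\<close> and determines \<open>Y\<close>. The types at \<open>\<xi>\<close> are elements of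
  \<open>W\<close>, so by Cantor's argument two of these sets have the same type in a large level \<open>X\<close>. They
  remain similar when any further level is added, since a level \<open>c\<close> that reflects for all sets of
  rank \<open>\<gamma>\<close> is an element of \<open>X\<close>.\<close>

lemma indiscernible_pair:
  assumes "finite P" "above \<gamma>"
  obtains m m' where "m \<noteq> m'" "rk m = \<gamma>" "rk m' = \<gamma>"
    "\<And>x. level x \<Longrightarrow> \<exists>x'. level x' \<and> similar (insert (x, x') (insert (m', m) (Id_on P)))"
proof -
  obtain \<xi>1 where \<xi>1: "above \<xi>1" "\<xi>1 \<epsilon> \<gamma>" using above_pred[OF assms(2)] by blast
  obtain \<xi> where \<xi>: "above \<xi>" "\<xi> \<epsilon> \<xi>1" using above_pred[OF \<xi>1(1)] by blast
  have Ords: "Ord \<gamma>" "Ord \<xi>1" "Ord \<xi>" using assms(2) \<xi>1 \<xi> unfolding above_def by blast+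
  have \<gamma>A: "\<And>m. rk m = \<gamma> \<Longrightarrow> m \<epsilon> V (suc \<gamma>)"
    using mem_V_rk[OF Ord_suc[OF Ords(1)]] by simp
  obtain k f where k: "k \<in> S" "Ord k" "\<forall>p\<in>P. \<exists>j. opair j p \<epsilon> f"
    "\<And>X. (\<forall>p\<in>P. p \<epsilon> X) \<Longrightarrow> coded k X f" using code_finite[OF assms(1)] by blast
  have sk: "suc k \<in> S" "Ord (suc k)" using k S_suc Ord_suc by blast+
  obtain u where u: "\<forall>p\<in>P. p \<epsilon> u" using finite_bound[OF assms(1)] by blast
  obtain c where c: "\<And>m. m \<epsilon> V (suc \<gamma>) \<Longrightarrow> reflects c (insert m P)"
    using ex_reflects[OF assms(1)] by blast
  obtain X where X: "level X" "upair (upair c u) (V (suc \<gamma>)) \<epsilon> X" using ex_level by blast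
  have "upair c u \<epsilon> X" "V (suc \<gamma>) \<epsilon> X" using level_trans[OF X] by simp_all
  then have X': "c \<epsilon> X" "u \<epsilon> X" "V (suc \<gamma>) \<epsilon> X" using level_trans[OF X(1)] mem_upair by blast+
  have "\<gamma> \<epsilon> X" using level_trans[OF X(1) X'(3)] \<gamma>A rk_Ord[OF Ords(1)] by blast
  then have XS: "X \<notin> S" using S_transitive assms(2) unfolding above_def by blast

  define W where "W = V \<xi>1"
  define thick where "thick Y = un Y (sep \<gamma> (\<lambda>\<eta>. \<not> \<eta> \<epsilon> W))" for Y
  have mem_thick: "w \<epsilon> thick Y \<longleftrightarrow> w \<epsilon> Y \<or> w \<epsilon> \<gamma> \<and> \<not> w \<epsilon> W" for w Y
    unfolding thick_def mem_un by (subst mem_sep) (intro delta1_sigma1 definability, rule refl)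
  have rk_thick: "rk (thick Y) = \<gamma>" if Y: "\<And>w. w \<epsilon> Y \<Longrightarrow> w \<epsilon> W" for Y
  proof (rule extensionality)
    fix w
    have el: "rk z \<epsilon> \<gamma>" if "z \<epsilon> thick Y" for z
    proof -
      consider "z \<epsilon> W" | "z \<epsilon> \<gamma>" using \<open>z \<epsilon> thick Y\<close> Y unfolding mem_thick by blast
      then show ?thesis
      proof cases
        case 1
        then show ?thesis using mem_V_rk[OF Ords(2)] Ord_trans[OF Ords(1) \<xi>1(2)] unfolding W_def by blast
      next
        case 2
        then show ?thesis using rk_Ord Ord_mem[OF Ords(1)] by metis
      qed
    qed
    have \<eta>W: "\<eta> \<epsilon> W \<longleftrightarrow> \<eta> \<epsilon> \<xi>1" if "\<eta> \<epsilon> \<gamma>" for \<eta>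
      using mem_V_rk[OF Ords(2), of \<eta>] rk_Ord[OF Ord_mem[OF Ords(1) that]] unfolding W_def by simp
    show "w \<epsilon> rk (thick Y) \<longleftrightarrow> w \<epsilon> \<gamma>"
    proof
      assume "w \<epsilon> rk (thick Y)"
      then show "w \<epsilon> \<gamma>" using el Ord_trans[OF Ords(1)] unfolding mem_rk[of w "thick Y"] by blast
    next
      assume w: "w \<epsilon> \<gamma>"
      have rkw: "rk w = w" using rk_Ord[OF Ord_mem[OF Ords(1) w]] .
      show "w \<epsilon> rk (thick Y)"
      proof (cases "w \<epsilon> W")
        case False
        then show ?thesis using rk_mem[of w "thick Y"] w rkw unfolding mem_thick by simp
      next
        case True
        then have "w \<epsilon> \<xi>1" using \<eta>W[OF w] by blast
        moreover have "\<xi>1 \<epsilon> thick Y"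
          unfolding mem_thick using \<xi>1(2) \<eta>W[OF \<xi>1(2)] mem_irrefl by blast
        ultimately show ?thesis
          using rk_Ord[OF Ords(2)] unfolding mem_rk[of w "thick Y"] by metis
      qed
    qed
  qed
  define h where "h Y = tp \<xi> X \<xi> (put f k (thick Y))" for Y
  have coded: "coded (suc k) X (put f k m)" if "rk m = \<gamma>" for m
  proof (rule coded_put)
    show "coded k X f" using k(4) u level_trans[OF X(1) X'(2)] by blast
    show "m \<epsilon> X" using level_trans[OF X(1) X'(3) \<gamma>A[OF that]] .
  qed
  have hW: "h Y \<epsilon> W" if "\<And>w. w \<epsilon> Y \<Longrightarrow> w \<epsilon> W" for Y
    unfolding W_def h_def
    by (rule V_I[OF \<xi>(2)]) (rule tp_subset[OF coded_pow[OF coded[OF rk_thick[OF that]] sk \<xi>(1)]])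
  define D where "D = sep W (\<lambda>t. \<exists>Y. Y \<epsilon> pow W \<and> t = h Y \<and> \<not> t \<epsilon> Y)"
  have mem_D: "t \<epsilon> D \<longleftrightarrow> t \<epsilon> W \<and> (\<exists>Y. Y \<epsilon> pow W \<and> t = h Y \<and> \<not> t \<epsilon> Y)" for t
    unfolding D_def h_def thick_def
    by (rule mem_sep, intro delta1_sigma1 definability_more sigma1_fun_tp)
  have DW: "\<And>w. w \<epsilon> D \<Longrightarrow> w \<epsilon> W" unfolding mem_D by blast
  have "h D \<epsilon> W" by (rule hW[OF DW])
  \<comment> \<open>If \<open>h Y = h D\<close> held only for \<open>Y = D\<close>, then \<open>h D\<close> would belong to \<open>D\<close> just in case it does not.\<close>
  then obtain Y where Y: "\<And>w. w \<epsilon> Y \<Longrightarrow> w \<epsilon> W" "h D = h Y" "Y \<noteq> D"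
    using mem_D[of "h D"] DW mem_pow by metis
  then obtain w where w: "w \<epsilon> Y \<longleftrightarrow> \<not> w \<epsilon> D" using extensionality by blast
  then have "w \<epsilon> W" using Y(1) DW by blast
  then have "thick Y \<noteq> thick D" using mem_thick[of w Y] mem_thick[of w D] w by auto
  moreover have rk: "rk (thick Y) = \<gamma>" "rk (thick D) = \<gamma>" using rk_thick[OF Y(1)] rk_thick[OF DW] by auto
  moreover have "\<exists>x'. level x' \<and> similar (insert (x, x') (insert (thick D, thick Y) (Id_on P)))"
    if x: "level x" for x
  proof -
    have "same_type X X (put f k (thick D)) (put f k (thick Y))"
      unfolding same_type_def using X(1) XS sk coded rk \<xi>(1) Y(2) unfolding h_def by blast
    from same_type_similar[OF this]
    have sim: "similar (insert (X, X) (insert (thick D, thick Y) (Id_on P)))"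
      by (rule similar_mono) (use k(3) in \<open>auto simp: matching_def\<close>)
    obtain x1 where x1: "x1 \<epsilon> c" "similar (insert (x, x1) (Id_on (insert (thick D) P)))"
      using c[OF \<gamma>A[OF rk(2)]] x unfolding reflects_def by blast
    obtain x2 where x2: "similar (insert (x1, x2) (insert (X, X) (insert (thick D, thick Y) (Id_on P))))"
      using similar_forth[OF sim, of X X x1] level_trans[OF X(1) X'(1) x1(1)] by blast
    have "insert (x, x2) (insert (thick D, thick Y) (Id_on P)) \<subseteq> insert (x, x1) (Id_on (insert (thick D) P)) O
        insert (x1, x2) (insert (X, X) (insert (thick D, thick Y) (Id_on P)))"
      by auto
    from similar_comp[OF x1(2) x2 this] have
      "similar (insert (x, x2) (insert (thick D, thick Y) (Id_on P)))" .
    moreover from similar_level[OF this, of x x2] x have "level x2" by simp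
    ultimately show ?thesis by blast
  qed
  ultimately show thesis by (rule that)
qed

text \<open>If the next value happens to be \<open>m\<close> itself, then \<open>m\<close> is also a possible value for its
  indiscernible companion \<open>m'\<close>.\<close>

lemma good_move:
  assumes "good H b" "above \<gamma>"
  shows "\<exists>m n b'. b' \<epsilon> b \<and> rk m = \<gamma> \<and> n \<noteq> m \<and> good (insert (m, n) H) b'"
proof -
  have "finite (fst ` H)" using assms(1) unfolding good_def by blast
  then obtain m m' where m: "m \<noteq> m'" "rk m = \<gamma>" "rk m' = \<gamma>"
    "\<And>x. level x \<Longrightarrow> \<exists>x'. level x' \<and> similar (insert (x, x') (insert (m', m) (Id_on (fst ` H))))"
    using indiscernible_pair[OF _ assms(2)] by metis
  obtain n b' where n: "b' \<epsilon> b" "good (insert (m, n) H) b'" using good_forth[OF assms(1)] by blast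
  show ?thesis
  proof (cases "n = m")
    case False
    then show ?thesis using n m(2) by blast
  next
    case True
    have "good (insert (m', m) H) b'"
      unfolding good_def
    proof (intro conjI allI impI)
      show "finite (insert (m', m) H)" "level b'" using n(2) unfolding good_def by auto
      fix x assume "level x"
      then obtain x' where x': "level x'" "similar (insert (x, x') (insert (m', m) (Id_on (fst ` H))))"
        using m(4) by blast
      then obtain y where y: "y \<epsilon> b'" "similar (insert (x', y) (insert (m, m) H))"
        using n(2) True unfolding good_def by blast
      have "insert (x, y) (insert (m', m) H) \<subseteq>
          insert (x, x') (insert (m', m) (Id_on (fst ` H))) O insert (x', y) (insert (m, m) H)"
        by force
      from similar_comp[OF x'(2) y(2) this] y(1)
      show "\<exists>y. y \<epsilon> b' \<and> similar (insert (x, y) (insert (m', m) H))" by blast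
    qed
    then show ?thesis using n(1) m(1,3) by blast
  qed
qed

text \<open>Let \<open>n\<close> be the image of a reflecting level. If \<open>\<delta> \<epsilon> n\<close>, then \<open>n\<close> is kept as a value. Otherwise
  \<open>n\<close> becomes the bound, and lowering it once more brings the bound strictly below \<open>\<delta>\<close>.\<close>

lemma good_cut:
  assumes "good H b" "Ord \<delta>"
  shows "\<exists>H' b'. H \<subseteq> H' \<and> b' \<epsilon> b \<and> good H' b' \<and>
    ((\<exists>y\<in>snd ` H'. \<delta> \<epsilon> y) \<or> (\<exists>\<beta>. \<beta> \<epsilon> \<delta> \<and> b' = V \<beta>))"
proof -
  obtain c n b' where n: "level n" "b' \<epsilon> b" "good (insert (c, n) H) b'" "good H n"
    using good_lower[OF assms(1)] .
  have "n \<epsilon> b"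
    using good_range[OF n(3), of c n] n(2) level_trans assms(1) unfolding good_def by blast
  show ?thesis
  proof (cases "\<delta> \<epsilon> n")
    case True
    then show ?thesis using n(2,3) by (intro exI[of _ "insert (c, n) H"] exI[of _ b']) auto
  next
    case False
    obtain c1 n1 b1 where n1: "level n1" "b1 \<epsilon> n" "good (insert (c1, n1) H) b1"
      using good_lower[OF n(4)] .
    obtain \<beta> \<nu> where \<beta>: "Ord \<beta>" "b1 = V \<beta>" "Ord \<nu>" "n = V \<nu>"
      using n1(3) n(1) unfolding good_def level_def by blast
    have "\<beta> \<epsilon> \<nu>" using n1(2) \<beta> V_mem_V by blast
    moreover have "\<not> \<delta> \<epsilon> \<nu>" using False mem_V_rk[OF \<beta>(3), of \<delta>] rk_Ord[OF assms(2)] \<beta>(4) by simp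
    ultimately have "\<beta> \<epsilon> \<delta>" using Ord_linear[OF assms(2) \<beta>(3)] Ord_trans[OF assms(2)] by blast
    moreover have "b1 \<epsilon> b" using n1(2) \<open>n \<epsilon> b\<close> level_trans assms(1) unfolding good_def by blast
    ultimately show ?thesis using n1(3) \<beta>(2) by (intro exI[of _ "insert (c1, n1) H"] exI[of _ b1]) auto
  qed
qed

text \<open>An element of one of the two values has a counterpart in \<open>a\<close>, and therefore belongs to the other.\<close>

lemma similar_fun: "similar H \<Longrightarrow> (a, y) \<in> H \<Longrightarrow> (a, y') \<in> H \<Longrightarrow> y = y'"
proof (rule extensionality)
  have *: "z \<epsilon> y'" if H: "similar H" "(a, y) \<in> H" "(a, y') \<in> H" "z \<epsilon> y" for y y' z
  proof -
    obtain m where m: "m \<epsilon> a" "similar (insert (m, z) H)" using similar_back[OF H(1,2,4)] by blast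
    then show ?thesis using similar_mem[OF m(2), of m z a y'] H(3) by blast
  qed
  fix z assume "similar H" "(a, y) \<in> H" "(a, y') \<in> H"
  then show "z \<epsilon> y \<longleftrightarrow> z \<epsilon> y'" using * by blast
qed

lemma similar_inj: "similar H \<Longrightarrow> (a, y) \<in> H \<Longrightarrow> (a', y) \<in> H \<Longrightarrow> a = a'"
proof (rule extensionality)
  have *: "z \<epsilon> a'" if H: "similar H" "(a, y) \<in> H" "(a', y) \<in> H" "z \<epsilon> a" for a a' z
  proof -
    obtain n where n: "n \<epsilon> y" "similar (insert (z, n) H)" using similar_forth[OF H(1,2,4)] by blast
    then show ?thesis using similar_mem[OF n(2), of z n a' y] H(3) by blast
  qed
  fix z assume "similar H" "(a, y) \<in> H" "(a', y) \<in> H"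
  then show "z \<epsilon> a \<longleftrightarrow> z \<epsilon> a'" using * by blast
qed

section \<open>The embedding as a limit of finite maps\<close>

text \<open>The three conjuncts make the limit total with a range closed under elements, topless, and different
  from the identity at the rank \<open>a\<close>. They persist when the map grows and the bound shrinks, so each
  pair \<open>(a, n)\<close> has to be dealt with only once.\<close>

definition meets :: "'a \<times> 'a \<Rightarrow> ('a \<times> 'a) set \<times> 'a \<Rightarrow> bool" where
  "meets t s \<longleftrightarrow> (case (t, s) of ((a, n), (H, b)) \<Rightarrow>
     (\<exists>y. (a, y) \<in> H \<and> (n \<epsilon> y \<longrightarrow> n \<in> snd ` H)) \<and>
     (Ord a \<longrightarrow> (\<exists>y\<in>snd ` H. a \<epsilon> y) \<or> (\<exists>\<beta>. \<beta> \<epsilon> a \<and> (\<forall>z. z \<epsilon> b \<longrightarrow> z \<epsilon> V \<beta>))) \<and>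
     (above a \<longrightarrow> (\<exists>m n. (m, n) \<in> H \<and> rk m = a \<and> n \<noteq> m)))"

lemma good_meets:
  assumes "good H b"
  shows "\<exists>H' b'. H \<subseteq> H' \<and> b' \<epsilon> b \<and> good H' b' \<and> meets (a, n) (H', b')"
proof -
  have below: "b'' \<epsilon> b" if "b'' \<epsilon> b'" "b' \<epsilon> b" "good K b" for b b' b'' K
    using that level_trans unfolding good_def by blast
  obtain y b1 where 1: "b1 \<epsilon> b" "good (insert (a, y) H) b1" using good_forth[OF assms] by blast
  define H1 where "H1 = insert (a, y) H"
  obtain H2 b2 where 2: "H1 \<subseteq> H2" "b2 \<epsilon> b" "good H2 b2" "n \<epsilon> y \<longrightarrow> n \<in> snd ` H2"
  proof (cases "n \<epsilon> y")
    case True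
    then obtain m b2 where "b2 \<epsilon> b1" "good (insert (m, n) H1) b2"
      using good_back[OF 1(2), of a y n] unfolding H1_def by blast
    then show ?thesis using that[of "insert (m, n) H1" b2] below[OF _ 1(1) assms] by auto
  next
    case False
    then show ?thesis using that[of H1 b1] 1 unfolding H1_def by blast
  qed
  obtain H3 b3 where 3: "H2 \<subseteq> H3" "b3 \<epsilon> b" "good H3 b3"
    "Ord a \<longrightarrow> (\<exists>y\<in>snd ` H3. a \<epsilon> y) \<or> (\<exists>\<beta>. \<beta> \<epsilon> a \<and> b3 = V \<beta>)"
  proof (cases "Ord a")
    case True
    from good_cut[OF 2(3) this] that show ?thesis using below[OF _ 2(2) assms] by blast
  next
    case False
    then show ?thesis using that[of H2 b2] 2 by blast
  qed
  obtain H4 b4 where 4: "H3 \<subseteq> H4" "b4 \<epsilon> b" "good H4 b4" "b4 = b3 \<or> b4 \<epsilon> b3"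
    "above a \<longrightarrow> (\<exists>m n. (m, n) \<in> H4 \<and> rk m = a \<and> n \<noteq> m)"
  proof (cases "above a")
    case True
    obtain m n b4 where "b4 \<epsilon> b3" "rk m = a" "n \<noteq> m" "good (insert (m, n) H3) b4"
      using good_move[OF 3(3) True] by blast
    then show ?thesis
      using that[of "insert (m, n) H3" b4] below[OF _ 3(2) assms] by blast
  next
    case False
    then show ?thesis using that[of H3 b3] 3 by blast
  qed
  have b43: "z \<epsilon> b3" if "z \<epsilon> b4" for z
    using 4(4) that level_trans 3(3) unfolding good_def by blast
  have "meets (a, n) (H4, b4)"
    unfolding meets_def prod.case
  proof (intro conjI impI)
    have "(a, y) \<in> H4" "snd ` H2 \<subseteq> snd ` H4" using 2(1) 3(1) 4(1) unfolding H1_def by blast+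
    then show "\<exists>y. (a, y) \<in> H4 \<and> (n \<epsilon> y \<longrightarrow> n \<in> snd ` H4)" using 2(4) by blast
    assume "Ord a"
    with 3(4) show "(\<exists>y\<in>snd ` H4. a \<epsilon> y) \<or> (\<exists>\<beta>. \<beta> \<epsilon> a \<and> (\<forall>z. z \<epsilon> b4 \<longrightarrow> z \<epsilon> V \<beta>))"
      using b43 4(1) by blast
  qed (use 4(5) in blast)
  moreover have "H \<subseteq> H4" using 2(1) 3(1) 4(1) unfolding H1_def by blast
  ultimately show ?thesis using 4(2,3) by blast
qed

text \<open>A chain of good maps that meets the requirements for all pairs has an embedding \<open>i\<close> as its union.
  Its range is closed under elements. It is rank-initial because \<open>i\<close> maps levels to levels, and the
  range contains each \<open>x\<close> of rank below \<open>\<alpha>\<close> because \<open>i\<close> fixes \<open>V \<alpha>\<close>.\<close>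

theorem self_embedding:
  assumes countable: "countable (UNIV :: 'a set)" and \<alpha>: "Ord \<alpha>"
  obtains \<beta> i where "Ord \<beta>" "inj i" "\<And>x y. i x \<epsilon> i y \<longleftrightarrow> x \<epsilon> y" "\<And>s. s \<in> S \<Longrightarrow> i s = s"
    "\<And>n m. rk n = rk (i m) \<or> rk n \<epsilon> rk (i m) \<Longrightarrow> n \<in> range i"
    "\<And>x. rk x \<epsilon> \<alpha> \<Longrightarrow> x \<in> range i" "\<And>x. rk (i x) \<epsilon> \<beta>"
    "\<And>\<delta>. Ord \<delta> \<Longrightarrow> \<delta> \<notin> range i \<Longrightarrow> \<exists>\<mu>. Ord \<mu> \<and> \<mu> \<notin> range i \<and> \<mu> \<epsilon> \<delta>"
    "\<And>\<gamma>. Ord \<gamma> \<Longrightarrow> \<gamma> \<notin> S \<Longrightarrow> \<exists>m. rk m = \<gamma> \<and> i m \<noteq> m"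
proof -
  obtain c where c: "level c" "reflects c {V \<alpha>}"
    using ex_reflects[of "{}" undefined "sing (V \<alpha>)"] by auto
  have good0: "good {(V \<alpha>, V \<alpha>)} c"
    unfolding good_def
  proof (intro conjI allI impI)
    fix x assume "level x"
    then obtain y where "y \<epsilon> c" "similar (insert (x, y) (Id_on {V \<alpha>}))"
      using c(2) unfolding reflects_def by blast
    moreover have "Id_on {V \<alpha>} = {(V \<alpha>, V \<alpha>)}" by auto
    ultimately show "\<exists>y. y \<epsilon> c \<and> similar {(x, y), (V \<alpha>, V \<alpha>)}" by auto
  qed (use c in auto)
  define task :: "nat \<Rightarrow> 'a \<times> 'a" where "task = from_nat_into UNIV"
  have "countable (UNIV :: ('a \<times> 'a) set)"
    using countable_SIGMA[OF countable, of "\<lambda>_. UNIV"] countable by simp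
  then have task: "\<exists>k. task k = t" for t
    unfolding task_def by (metis UNIV_I from_nat_into_surj)
  let ?P = "\<lambda>(k::nat) s. good (fst s) (snd s) \<and> (k = 0 \<longrightarrow> s = ({(V \<alpha>, V \<alpha>)}, c))"
  let ?Q = "\<lambda>(k::nat) s s'. fst s \<subseteq> fst s' \<and> snd s' \<epsilon> snd s \<and> meets (task k) s'"
  have "\<exists>s. \<forall>k. ?P k (s k) \<and> ?Q k (s k) (s (Suc k))"
  proof (rule dependent_nat_choice)
    show "\<exists>s. ?P 0 s" using good0 by simp
    fix s k assume "?P k s"
    then obtain H' b' where "fst s \<subseteq> H'" "b' \<epsilon> snd s" "good H' b'" "meets (task k) (H', b')"
      using good_meets[of "fst s" "snd s" "fst (task k)" "snd (task k)"] by auto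
    then show "\<exists>s'. ?P (Suc k) s' \<and> ?Q k s s'" by (intro exI[of _ "(H', b')"]) simp
  qed
  then obtain s where s: "\<And>k. ?P k (s k)" "\<And>k. ?Q k (s k) (s (Suc k))" by blast
  define H where "H k = fst (s k)" for k
  define b where "b k = snd (s k)" for k
  have good: "good (H k) (b k)" for k using s(1) unfolding H_def b_def by blast
  have start: "H 0 = {(V \<alpha>, V \<alpha>)}" "b 0 = c" using s(1)[of 0] unfolding H_def b_def by simp_all
  have sim: "similar (H k)" for k by (rule good_similar[OF good])
  have mono: "H k \<subseteq> H l" if "k \<le> l" for k l
    using that lift_Suc_mono_le[of H] s(2) unfolding H_def by blast
  have b_mono: "z \<epsilon> b l \<longrightarrow> z \<epsilon> b k" if "k \<le> l" for k l z
    using that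
  proof (induction rule: dec_induct)
    case (step n)
    have "b (Suc n) \<epsilon> b n" using s(2) unfolding b_def by blast
    then show ?case using step level_trans good unfolding good_def by blast
  qed simp
  have meets: "meets t (H (Suc k), b (Suc k))" if "task k = t" for t k
    using s(2)[of k] that unfolding H_def b_def by simp
  define R where "R = (\<Union>k. H k)"
  have common: "\<exists>k. p \<in> H k \<and> q \<in> H k" if pq: "p \<in> R" "q \<in> R" for p q
  proof -
    obtain k l where "p \<in> H k" "q \<in> H l" using pq unfolding R_def by blast
    then have "p \<in> H (max k l)" "q \<in> H (max k l)"
      using mono[of k "max k l"] mono[of l "max k l"] by auto
    then show ?thesis by blast
  qed
  have total: "\<exists>y. (a, y) \<in> R" for a
  proof -
    obtain k where "task k = (a, a)" using task by blast
    from meets[OF this] show ?thesis unfolding meets_def R_def by blast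
  qed
  have R_fun: "y = y'" if "(a, y) \<in> R" "(a, y') \<in> R" for a y y'
    using common[OF that] sim similar_fun by blast
  define i where "i a = (SOME y. (a, y) \<in> R)" for a
  have iR: "(a, i a) \<in> R" for a unfolding i_def by (rule someI_ex[OF total])
  then have R_iff: "(a, y) \<in> R \<longleftrightarrow> y = i a" for a y using R_fun by blast
  have range_mem: "n \<in> range i" if "n \<epsilon> i a" for n a
  proof -
    obtain k where "task k = (a, n)" using task by blast
    from meets[OF this] obtain y where y: "(a, y) \<in> H (Suc k)" "n \<epsilon> y \<longrightarrow> n \<in> snd ` H (Suc k)"
      unfolding meets_def by blast
    then have "y = i a" using R_iff unfolding R_def by blast
    with y that obtain m where "(m, n) \<in> H (Suc k)" by force
    then show ?thesis using R_iff unfolding R_def by blast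
  qed
  have pair: "\<exists>k. (x, i x) \<in> H k \<and> (y, i y) \<in> H k" for x y by (rule common[OF iR iR])
  have mem: "i x \<epsilon> i y \<longleftrightarrow> x \<epsilon> y" for x y using pair[of x y] sim similar_mem by blast
  have in_b: "\<exists>l\<ge>k. i m \<epsilon> b l" for m k
  proof -
    obtain l where "(m, i m) \<in> H l" using iR unfolding R_def by blast
    then have "(m, i m) \<in> H (max k l)" using mono[of l "max k l"] by auto
    then show ?thesis using good_range[OF good] by (intro exI[of _ "max k l"]) simp
  qed
  have initial: "n \<in> range i" if n: "rk n = rk (i m) \<or> rk n \<epsilon> rk (i m)" for n m
  proof -
    obtain x where x: "level x" "m \<epsilon> x" using ex_level by blast
    then have "level (i x)" using pair[of x x] sim similar_level by blast
    then obtain \<gamma> where \<gamma>: "Ord \<gamma>" "i x = V \<gamma>" unfolding level_def by blast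
    have "i m \<epsilon> V \<gamma>" using mem[of m x] x(2) \<gamma>(2) by simp
    then have "rk (i m) \<epsilon> \<gamma>" using mem_V_rk[OF \<gamma>(1)] by blast
    have "rk n \<epsilon> \<gamma>"
      using n
    proof
      assume "rk n = rk (i m)"
      with \<open>rk (i m) \<epsilon> \<gamma>\<close> show ?thesis by (rule back_subst[OF _ sym])
    next
      assume "rk n \<epsilon> rk (i m)"
      then show ?thesis by (rule Ord_trans[OF \<gamma>(1) \<open>rk (i m) \<epsilon> \<gamma>\<close>])
    qed
    then have "n \<epsilon> i x" unfolding \<gamma>(2) mem_V_rk[OF \<gamma>(1)] .
    then show ?thesis by (rule range_mem)
  qed
  have "(V \<alpha>, V \<alpha>) \<in> H 0" unfolding start(1) by (rule singletonI)
  then have "(V \<alpha>, V \<alpha>) \<in> R" unfolding R_def by blast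
  then have V\<alpha>: "i (V \<alpha>) = V \<alpha>" unfolding R_iff by (rule sym)
  obtain \<beta> where \<beta>: "Ord \<beta>" "c = V \<beta>" using c(1) unfolding level_def by blast
  show thesis
  proof (rule that[of \<beta> i])
    show "Ord \<beta>" by (rule \<beta>(1))
    show "inj i"
    proof (rule injI)
      fix x y assume "i x = i y"
      then show "x = y" using pair[of x y] sim similar_inj by metis
    qed
    show "i x \<epsilon> i y \<longleftrightarrow> x \<epsilon> y" for x y by (rule mem)
    show "i s = s" if "s \<in> S" for s using pair[of s s] sim similar_fix that by metis
    show "n \<in> range i" if "rk n = rk (i m) \<or> rk n \<epsilon> rk (i m)" for n m by (rule initial[OF that])
    show "x \<in> range i" if "rk x \<epsilon> \<alpha>" for x
      by (rule range_mem[of x "V \<alpha>"]) (unfold V\<alpha> mem_V_rk[OF \<alpha>], rule that)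
    show "rk (i x) \<epsilon> \<beta>" for x
    proof -
      have "i x \<epsilon> b 0" using in_b[of 0 x] b_mono[of 0] by blast
      then show ?thesis unfolding start(2) \<beta>(2) mem_V_rk[OF \<beta>(1)] .
    qed
    show "\<exists>\<mu>. Ord \<mu> \<and> \<mu> \<notin> range i \<and> \<mu> \<epsilon> \<delta>" if \<delta>: "Ord \<delta>" "\<delta> \<notin> range i" for \<delta>
    proof -
      obtain k where "task k = (\<delta>, \<delta>)" using task by blast
      from meets[OF this] \<delta> consider y where "y \<in> snd ` H (Suc k)" "\<delta> \<epsilon> y"
        | \<mu> where "\<mu> \<epsilon> \<delta>" "\<forall>z. z \<epsilon> b (Suc k) \<longrightarrow> z \<epsilon> V \<mu>"
        unfolding meets_def by blast
      then show ?thesis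
      proof cases
        case 1
        then obtain a where "(a, y) \<in> H (Suc k)" by (metis imageE prod.collapse)
        then have "y = i a" unfolding R_iff[symmetric] R_def by blast
        then have "\<delta> \<in> range i" using range_mem 1(2) by simp
        then show ?thesis using \<delta> by blast
      next
        case 2
        have \<mu>: "Ord \<mu>" using Ord_mem \<delta> 2(1) by blast
        have "\<mu> \<noteq> i m" for m
        proof
          assume "\<mu> = i m"
          then have "\<mu> \<epsilon> V \<mu>" using in_b[of "Suc k" m] b_mono[of "Suc k"] 2(2) by blast
          then show False unfolding mem_V_rk[OF \<mu>] rk_Ord[OF \<mu>] using mem_irrefl by blast
        qed
        then show ?thesis using \<mu> 2(1) by blast
      qed
    qed
    show "\<exists>m. rk m = \<gamma> \<and> i m \<noteq> m" if "Ord \<gamma>" "\<gamma> \<notin> S" for \<gamma>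
    proof -
      obtain k where "task k = (\<gamma>, \<gamma>)" using task by blast
      from meets[OF this] that obtain m n where "(m, n) \<in> H (Suc k)" "rk m = \<gamma>" "n \<noteq> m"
        unfolding meets_def above_def by blast
      moreover from this have "n = i m" using R_iff unfolding R_def by blast
      ultimately show ?thesis by blast
    qed
  qed
qed

end

section \<open>Transport along an isomorphism\<close>

text \<open>The map \<open>x \<mapsto> {x}\<close> is injective, but the empty set is not a value.\<close>

lemma infinite_carrier:
  assumes "models M KPP"
  shows "infinite (carrier M)"
proof
  assume fin: "finite (carrier M)"
  have ne: "carrier M \<noteq> {}" using assms unfolding models_def by blast
  define v :: "nat \<Rightarrow> 'a" where "v n = (SOME x. x \<in> carrier M)" for n
  have v: "range v \<subseteq> carrier M" using ne some_in_eq unfolding v_def by blast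
  have "sat M v Pairing" using assms v unfolding models_def KPP_def by blast
  then have pair: "\<forall>x\<in>carrier M. \<exists>p\<in>carrier M. \<forall>w\<in>carrier M. mem M w p \<longleftrightarrow> w = x"
    unfolding Pairing_def by (simp add: sat_Iff) metis
  then obtain f where f: "\<And>x. x \<in> carrier M \<Longrightarrow> f x \<in> carrier M"
    "\<And>x w. x \<in> carrier M \<Longrightarrow> w \<in> carrier M \<Longrightarrow> mem M w (f x) \<longleftrightarrow> w = x"
    by metis
  have "inj_on f (carrier M)" using f by (metis inj_onI)
  then have surj: "f ` carrier M = carrier M" using endo_inj_surj[OF fin] f(1) by blast
  have "models M (Separation Delta0P)" using assms unfolding models_def KPP_def by blast
  moreover have "Neg (Eq 0 0) \<in> Delta0P" by (intro Delta0P.intros)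
  ultimately have "\<forall>a\<in>carrier M. \<exists>b\<in>carrier M. \<forall>c\<in>carrier M.
      mem M c b \<longleftrightarrow> mem M c a \<and> sat M (v(0 := c)) (Neg (Eq 0 0))"
    unfolding models_Separation_iff using v by blast
  then obtain b where b: "b \<in> carrier M" "\<And>c. c \<in> carrier M \<Longrightarrow> \<not> mem M c b" using ne by auto
  then obtain x where "x \<in> carrier M" "b = f x" using surj by blast
  then show False using b(2) f(2)[of x x] by blast
qed

context
  fixes M N :: "_ memstruct" and h
  assumes bij: "bij_betw h (carrier N) (carrier M)"
    and mem_N: "\<And>x y. x \<in> carrier N \<Longrightarrow> y \<in> carrier N \<Longrightarrow> mem N x y \<longleftrightarrow> mem M (h x) (h y)"
begin

lemma iso_carrier: "x \<in> carrier N \<Longrightarrow> h x \<in> carrier M"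
  using bij by (rule bij_betwE[rule_format])

lemma iso_eq: "x \<in> carrier N \<Longrightarrow> y \<in> carrier N \<Longrightarrow> h x = h y \<longleftrightarrow> x = y"
  using bij by (meson bij_betw_imp_inj_on inj_on_eq_iff)

lemma iso_ball: "(\<forall>y\<in>carrier M. P y) \<longleftrightarrow> (\<forall>x\<in>carrier N. P (h x))"
  using bij by (metis bij_betw_imp_surj_on ball_imageD image_eqI imageE)

lemma iso_bex: "(\<exists>y\<in>carrier M. P y) \<longleftrightarrow> (\<exists>x\<in>carrier N. P (h x))"
  using iso_ball[of "\<lambda>y. \<not> P y"] by blast

lemma iso_sat:
  "range v \<subseteq> carrier N \<Longrightarrow> sat N v \<phi> \<longleftrightarrow> sat M (h \<circ> v) \<phi>"
proof (induction \<phi> arbitrary: v)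
  case (Ex x \<phi>)
  have "sat N (v(x := a)) \<phi> \<longleftrightarrow> sat M ((h \<circ> v)(x := h a)) \<phi>" if "a \<in> carrier N" for a
  proof -
    have "range (v(x := a)) \<subseteq> carrier N" using Ex.prems that by auto
    from Ex.IH[OF this] show ?thesis unfolding fun_upd_comp .
  qed
  then show ?case unfolding sat.simps iso_bex by blast
next
  case (All x \<phi>)
  have "sat N (v(x := a)) \<phi> \<longleftrightarrow> sat M ((h \<circ> v)(x := h a)) \<phi>" if "a \<in> carrier N" for a
  proof -
    have "range (v(x := a)) \<subseteq> carrier N" using All.prems that by auto
    from All.IH[OF this] show ?thesis unfolding fun_upd_comp .
  qed
  then show ?case unfolding sat.simps iso_ball by blast
qed (auto simp: mem_N iso_eq image_subset_iff)

lemma iso_models: "models M T \<Longrightarrow> models N T"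
proof -
  assume M: "models M T"
  have "sat N v \<phi>" if "\<phi> \<in> T" "range v \<subseteq> carrier N" for v \<phi>
  proof -
    have "range (h \<circ> v) \<subseteq> carrier M" using that(2) iso_carrier by auto
    then show ?thesis using M that iso_sat unfolding models_def by blast
  qed
  moreover have "carrier N \<noteq> {}"
    using M bij unfolding models_def bij_betw_def by auto
  ultimately show ?thesis unfolding models_def by blast
qed

lemma iso_trans_in: "x \<in> carrier N \<Longrightarrow> trans_in N x \<longleftrightarrow> trans_in M (h x)"
  unfolding trans_in_def iso_ball by (simp add: mem_N)

lemma iso_Ords: "x \<in> carrier N \<Longrightarrow> x \<in> Ords N \<longleftrightarrow> h x \<in> Ords M"
  unfolding Ords_def mem_Collect_eq iso_ball by (simp add: iso_trans_in mem_N iso_carrier)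

lemma iso_app_in:
  assumes "x \<in> carrier N" "y \<in> carrier N" "f \<in> carrier N"
  shows "app_in N f x y \<longleftrightarrow> app_in M (h f) (h x) (h y)"
    and iso_opair_in: "opair_in N x y f \<longleftrightarrow> opair_in M (h x) (h y) (h f)"
proof -
  have up: "upair_in N x y f \<longleftrightarrow> upair_in M (h x) (h y) (h f)"
    if "x \<in> carrier N" "y \<in> carrier N" "f \<in> carrier N" for x y f
    unfolding upair_in_def iso_ball using that by (simp add: mem_N iso_eq)
  have op: "opair_in N x y f \<longleftrightarrow> opair_in M (h x) (h y) (h f)"
    if "x \<in> carrier N" "y \<in> carrier N" "f \<in> carrier N" for x y f
    unfolding opair_in_def iso_bex using that by (simp add: up)
  show "opair_in N x y f \<longleftrightarrow> opair_in M (h x) (h y) (h f)" using op assms by blast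
  show "app_in N f x y \<longleftrightarrow> app_in M (h f) (h x) (h y)"
    unfolding app_in_def iso_bex using assms by (simp add: op mem_N)
qed

lemma iso_ex1: "(\<exists>!y. y \<in> carrier M \<and> P y) \<longleftrightarrow> (\<exists>!x. x \<in> carrier N \<and> P (h x))"
proof -
  have "(\<exists>!x. x \<in> carrier N \<and> P (h x)) \<longleftrightarrow>
      (\<exists>x\<in>carrier N. P (h x) \<and> (\<forall>y\<in>carrier N. P (h y) \<longrightarrow> h y = h x))"
    using iso_eq by blast
  also have "\<dots> \<longleftrightarrow> (\<exists>x\<in>carrier M. P x \<and> (\<forall>y\<in>carrier M. P y \<longrightarrow> y = x))"
    by (simp only: iso_ball iso_bex)
  finally show ?thesis by blast
qed

lemma iso_function_on_in:
  assumes "f \<in> carrier N" "d \<in> carrier N"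
  shows "function_on_in N f d \<longleftrightarrow> function_on_in M (h f) (h d)"
  unfolding function_on_in_def iso_ball iso_bex iso_ex1 using assms
  by (simp add: mem_N iso_app_in iso_opair_in cong: conj_cong)

lemma iso_is_rank:
  assumes "x \<in> carrier N" "a \<in> carrier N"
  shows "is_rank N x a \<longleftrightarrow> is_rank M (h x) (h a)"
  unfolding is_rank_def iso_bex iso_ball using assms
  by (simp add: mem_N iso_app_in iso_function_on_in iso_trans_in iso_eq)

end

text \<open>A countable infinite structure is isomorphic to one whose carrier is the type of natural numbers. There
  \<open>S\<close> becomes a cut, and the embedding is carried back along the isomorphism.\<close>

theorem corollary5p2p11:
  fixes M S :: "'a memstruct"
  assumes "models M (KPP \<union> Separation (SigmaP 2) \<union> Foundation (PiP 2))"
    and "countable (carrier M)"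
    and "nonstandard M"
    and "substructure S M"
    and "rank_initial S M (\<lambda>x. x)"
    and "topless S M (\<lambda>x. x)"
  shows "\<forall>\<alpha>\<in>Ords M. \<exists>\<beta>\<in>Ords M. \<exists>i.
    embedding M M i \<and> topless M M i \<and> rank_initial M M i \<and>
    (\<forall>s\<in>carrier S. i s = s) \<and>
    below_rank M \<alpha> \<subseteq> i ` carrier M \<and> i ` carrier M \<subseteq> below_rank M \<beta> \<and>
    (\<forall>\<gamma>\<in>Ords M - carrier S. \<exists>m\<in>carrier M. rank M m = \<gamma> \<and> i m \<noteq> m)"
proof -
  have "models M KPP" using assms(1) unfolding models_def by blast
  then have "infinite (carrier M)" by (rule infinite_carrier)
  with assms(2) obtain e :: "'a \<Rightarrow> nat" where "bij_betw e (carrier M) UNIV"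
    by (rule countableE_infinite)
  then obtain h :: "nat \<Rightarrow> 'a" where h: "bij_betw h UNIV (carrier M)"
    using bij_betw_inv_into by blast
  define E where "E x y = mem M (h x) (h y)" for x y
  define N where "N = \<lparr>carrier = UNIV, mem = E\<rparr>"
  have bij: "bij_betw h (carrier N) (carrier M)" using h by (simp add: N_def)
  have mem_N: "mem N x y \<longleftrightarrow> mem M (h x) (h y)" for x y by (simp add: N_def E_def)
  have carrier_N: "x \<in> carrier N" for x by (simp add: N_def)
  have hM: "h x \<in> carrier M" for x using h bij_betwE by blast
  have h_eq: "h x = h y \<longleftrightarrow> x = y" for x y using h by (simp add: bij_betw_def inj_eq)
  have onto: "\<exists>x. y = h x" if "y \<in> carrier M" for y using h that unfolding bij_betw_def by blast
  interpret set_theory E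
    by unfold_locales (rule iso_models[OF bij mem_N assms(1), unfolded N_def])
  have MN: "membership.M E = N" by (simp add: M_def N_def)
  have ord: "h x \<in> Ords M \<longleftrightarrow> Ord x" for x
    using iso_Ords[OF bij mem_N carrier_N, of x] Ords_M[of x] unfolding MN by simp
  have rank: "rank M (h x) = h (rk x)" for x
    unfolding rank_def
  proof (rule the_equality)
    have is_rank: "is_rank M (h x) (h a) \<longleftrightarrow> a = rk x" for a
      using iso_is_rank[OF bij mem_N carrier_N carrier_N, of x a] is_rank_iff[of x a] unfolding MN by simp
    show "h (rk x) \<in> carrier M \<and> is_rank M (h x) (h (rk x))"
      using hM is_rank by simp
    fix b assume b: "b \<in> carrier M \<and> is_rank M (h x) b"
    then obtain a where a: "b = h a" using onto by blast
    then show "b = h (rk x)" using b is_rank[of a] by simp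
  qed
  have mem: "mem M (h x) (h y) \<longleftrightarrow> E x y" for x y by (simp add: E_def)
  define S' where "S' = {x. h x \<in> carrier S}"
  have S: "carrier S \<noteq> {}" "carrier S \<subseteq> carrier M"
    using assms(4) unfolding substructure_def by blast+
  interpret cut E S'
  proof unfold_locales
    show "\<exists>s. s \<in> S'" using S onto unfolding S'_def by blast
    show "n \<in> S'" if "s \<in> S'" "rk n = rk s \<or> E (rk n) (rk s)" for s n
    proof -
      have "h n \<in> (\<lambda>x. x) ` carrier S"
      proof -
        have "rank M (h n) = rank M (h s) \<or> mem M (rank M (h n)) (rank M (h s))"
          using that(2) unfolding rank mem h_eq .
        then show ?thesis
          using assms(5) that(1) hM[of n] unfolding rank_initial_def S'_def by blast
      qed
      then show ?thesis unfolding S'_def by simp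
    qed
    obtain a where a: "a \<in> Ords M" "carrier S \<subseteq> below_rank M a"
      using assms(6) unfolding topless_def image_ident by blast
    then obtain \<alpha> where "a = h \<alpha>" using onto unfolding Ords_def by blast
    with a have \<alpha>: "Ord \<alpha>" "carrier S \<subseteq> below_rank M (h \<alpha>)" using ord by simp_all
    have "\<alpha> \<notin> S'"
    proof
      assume "\<alpha> \<in> S'"
      then have "h \<alpha> \<in> below_rank M (h \<alpha>)" using \<alpha>(2) unfolding S'_def by blast
      then have "E (rk \<alpha>) \<alpha>" unfolding below_rank_def by (simp only: mem_Collect_eq rank mem)
      then show False unfolding rk_Ord[OF \<alpha>(1)] using mem_irrefl by blast
    qed
    then show "\<exists>\<xi>. Ord \<xi> \<and> \<xi> \<notin> S'" using \<alpha>(1) by blast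
    show "\<exists>\<eta>. Ord \<eta> \<and> \<eta> \<notin> S' \<and> E \<eta> \<xi>" if \<xi>: "Ord \<xi>" "\<xi> \<notin> S'" for \<xi>
    proof -
      have "h \<xi> \<in> Ords M - carrier S" using \<xi> ord unfolding S'_def by simp
      then obtain b where b: "b \<in> Ords M" "b \<notin> carrier S" "\<not> (h \<xi> = b \<or> mem M (h \<xi>) b)"
        using assms(6) unfolding topless_def image_ident by blast
      then obtain \<eta> where \<eta>: "b = h \<eta>" using onto unfolding Ords_def by blast
      then have "Ord \<eta>" "\<eta> \<notin> S'" "\<not> (\<xi> = \<eta> \<or> E \<xi> \<eta>)"
        using b ord unfolding S'_def \<eta> h_eq mem by simp_all
      then show ?thesis using Ord_linear[OF \<xi>(1)] by blast
    qed
  qed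
  show ?thesis
  proof
    fix a assume "a \<in> Ords M"
    then obtain \<alpha> where \<alpha>: "a = h \<alpha>" "Ord \<alpha>" using onto ord unfolding Ords_def by blast
    obtain \<beta> i where i: "Ord \<beta>" "inj i" "\<And>x y. E (i x) (i y) \<longleftrightarrow> E x y" "\<And>s. s \<in> S' \<Longrightarrow> i s = s"
      "\<And>n m. rk n = rk (i m) \<or> E (rk n) (rk (i m)) \<Longrightarrow> n \<in> range i"
      "\<And>x. E (rk x) \<alpha> \<Longrightarrow> x \<in> range i" "\<And>x. E (rk (i x)) \<beta>"
      "\<And>\<delta>. Ord \<delta> \<Longrightarrow> \<delta> \<notin> range i \<Longrightarrow> \<exists>\<mu>. Ord \<mu> \<and> \<mu> \<notin> range i \<and> E \<mu> \<delta>"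
      "\<And>\<gamma>. Ord \<gamma> \<Longrightarrow> \<gamma> \<notin> S' \<Longrightarrow> \<exists>m. rk m = \<gamma> \<and> i m \<noteq> m"
      by (rule self_embedding[OF _ \<alpha>(2)]) simp_all
    show "\<exists>\<beta>\<in>Ords M. \<exists>i.
        embedding M M i \<and> topless M M i \<and> rank_initial M M i \<and>
        (\<forall>s\<in>carrier S. i s = s) \<and>
        below_rank M a \<subseteq> i ` carrier M \<and> i ` carrier M \<subseteq> below_rank M \<beta> \<and>
        (\<forall>\<gamma>\<in>Ords M - carrier S. \<exists>m\<in>carrier M. rank M m = \<gamma> \<and> i m \<noteq> m)"
    proof (rule bexI[of _ "h \<beta>"], rule exI[of _ "\<lambda>y. h (i (inv h y))"])
      let ?j = "\<lambda>y. h (i (inv h y))"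
      have "inj h" using h by (simp add: bij_betw_def)
      then have j: "?j (h x) = h (i x)" for x by simp
      have range_j: "h x \<in> ?j ` carrier M \<longleftrightarrow> x \<in> range i" for x
      proof -
        have "?j ` carrier M = h ` range i"
          using h j unfolding bij_betw_def by force
        then show ?thesis using \<open>inj h\<close> by (simp add: inj_image_mem_iff)
      qed
      have jM: "?j ` carrier M \<subseteq> carrier M" using hM by blast
      have emb: "embedding M M ?j"
        unfolding embedding_def
      proof (intro conjI ballI jM)
        show "inj_on ?j (carrier M)"
        proof (rule inj_onI)
          fix x y assume "x \<in> carrier M" "y \<in> carrier M" "?j x = ?j y"
          then obtain x' y' where "x = h x'" "y = h y'" "h (i x') = h (i y')" using onto j by metis
          then show "x = y" using i(2) h_eq by (simp add: inj_eq)
        qed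
        fix x y assume "x \<in> carrier M" "y \<in> carrier M"
        then obtain x' y' where "x = h x'" "y = h y'" using onto by blast
        then show "mem M (?j x) (?j y) \<longleftrightarrow> mem M x y" using i(3) j by (simp add: mem)
      qed
      have below: "?j ` carrier M \<subseteq> below_rank M (h \<beta>)"
      proof
        fix y assume "y \<in> ?j ` carrier M"
        then obtain x where "y = h (i x)" using onto j by blast
        then show "y \<in> below_rank M (h \<beta>)"
          using i(7) hM unfolding below_rank_def by (simp add: rank mem)
      qed
      show \<beta>: "h \<beta> \<in> Ords M" using i(1) ord by blast
      have "rank_initial M M ?j"
        unfolding rank_initial_def
      proof (intro conjI ballI impI emb)
        fix n m assume "n \<in> carrier M" "m \<in> carrier M"
          "rank M n = rank M (?j m) \<or> mem M (rank M n) (rank M (?j m))"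
        moreover from this obtain n' m' where nm: "n = h n'" "m = h m'" using onto by blast
        ultimately have "rk n' = rk (i m') \<or> E (rk n') (rk (i m'))"
          using j by (simp add: rank mem h_eq)
        then show "n \<in> ?j ` carrier M" using i(5) range_j nm by blast
      qed
      moreover have "\<not> (\<exists>\<delta>\<in>Ords M - ?j ` carrier M. \<forall>\<mu>\<in>Ords M - ?j ` carrier M. \<delta> = \<mu> \<or> mem M \<delta> \<mu>)"
      proof
        assume "\<exists>\<delta>\<in>Ords M - ?j ` carrier M. \<forall>\<mu>\<in>Ords M - ?j ` carrier M. \<delta> = \<mu> \<or> mem M \<delta> \<mu>"
        then obtain d where d: "d \<in> Ords M" "d \<notin> ?j ` carrier M"
          "\<And>\<mu>. \<mu> \<in> Ords M \<Longrightarrow> \<mu> \<notin> ?j ` carrier M \<Longrightarrow> d = \<mu> \<or> mem M d \<mu>" by blast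
        then obtain \<delta> where \<delta>: "d = h \<delta>" using onto unfolding Ords_def by blast
        then have "Ord \<delta>" "\<delta> \<notin> range i" using d(1,2) ord range_j by blast+
        then obtain \<mu> where \<mu>: "Ord \<mu>" "\<mu> \<notin> range i" "E \<mu> \<delta>" using i(8) by blast
        have "h \<mu> \<in> Ords M" unfolding ord by (rule \<mu>(1))
        moreover have "h \<mu> \<notin> ?j ` carrier M" unfolding range_j by (rule \<mu>(2))
        ultimately have "d = h \<mu> \<or> mem M d (h \<mu>)" by (rule d(3))
        then have "\<delta> = \<mu> \<or> E \<delta> \<mu>" unfolding \<delta> h_eq mem .
        then show False
          using \<mu>(3) Ord_trans[OF \<mu>(1), of \<delta> \<mu>] mem_irrefl by blast
      qed
      moreover have "?j s = s" if s: "s \<in> carrier S" for s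
      proof -
        obtain x where "s = h x" using S(2) onto s by blast
        then show ?thesis using s i(4)[of x] j unfolding S'_def by simp
      qed
      moreover have "below_rank M a \<subseteq> ?j ` carrier M"
      proof
        fix y assume y: "y \<in> below_rank M a"
        then obtain x where x: "y = h x" using onto unfolding below_rank_def by blast
        then have "E (rk x) \<alpha>" using y \<alpha>(1) unfolding below_rank_def by (simp add: rank mem)
        then show "y \<in> ?j ` carrier M" using i(6) range_j x by blast
      qed
      moreover have "\<exists>m\<in>carrier M. rank M m = c \<and> ?j m \<noteq> m" if c: "c \<in> Ords M - carrier S" for c
      proof -
        obtain \<gamma> where \<gamma>: "c = h \<gamma>" using onto c unfolding Ords_def by blast
        then have "Ord \<gamma>" "\<gamma> \<notin> S'" using c ord unfolding S'_def by blast+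
        then obtain m where "rk m = \<gamma>" "i m \<noteq> m" using i(9) by blast
        then have "rank M (h m) = c" "?j (h m) \<noteq> h m" using \<gamma> j by (simp_all add: rank h_eq)
        then show ?thesis using hM by blast
      qed
      ultimately show "embedding M M ?j \<and> topless M M ?j \<and> rank_initial M M ?j \<and>
          (\<forall>s\<in>carrier S. ?j s = s) \<and>
          below_rank M a \<subseteq> ?j ` carrier M \<and> ?j ` carrier M \<subseteq> below_rank M (h \<beta>) \<and>
          (\<forall>\<gamma>\<in>Ords M - carrier S. \<exists>m\<in>carrier M. rank M m = \<gamma> \<and> ?j m \<noteq> m)"
        using emb below \<beta> unfolding topless_def by blast
    qed
  qed
qed

end
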